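(* Let $X$ be a compact Riemann surface of genus $g\ge 1$ with an anticonformal involution $\bar J$, and let $\eta\not\equiv 0$ be a real holomorphic differential on $X$, i.e. a holomorphic $1$-form with $\bar J^*\eta=\overline{\eta}$. Suppose that for every odd cycle $C^-\in H_1^-(X,\mathbb{R})$ such that $C^-\circ R=0$ for every real oval $R$ of $(X,\bar J)$, one has $$\int_{C^-}\eta=0 .$$ Then the foliation $\eta^2>0$ on $X$ is Jenkins–Strebel (equivalently, the quadratic differential $\eta^2$ is Jenkins–Strebel).
   Context: $X$ is a compact Riemann surface of genus $g$ with an anticonformal (antiholomorphic) involution $\bar J:X\to X$. The real ovals of $(X,\bar J)$ are the connected components of the fixed point set of $\bar J$; they are smooth closed curves (there may be none), and each, with a chosen orientation, defines a class in $H_1(X,\mathbb{Z})$ fixed by $\bar J$. The involution acts on $H_1(X,\mathbb{R})$, and $H_1^\pm(X,\mathbb{R}):=(I\pm\bar J)H_1(X,\mathbb{R})$ are the $\pm1$ eigenspaces; elements of $H_1^+(X,\mathbb{R})$ are called even cycles and elements of $H_1^-(X,\mathbb{R})$ odd cycles. The symbol $\circ$ denotes the intersection form on $H_1(X,\mathbb{R})$. For a nonzero holomorphic quadratic differential $q$ on $X$, the foliation $q>0$ is the singular foliation whose leaves (horizontal trajectories) are the maximal curves in $X\setminus\{\text{zeros of }q\}$ on tangent vectors of which $q$ is positive; for $q=\eta^2$ these are the curves along which $\eta$ is real, i.e. along which $\mathrm{Im}\int\eta$ is locally constant. The critical graph is the union of the zeros of $q$ and of all leaves that tend to a zero of $q$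 in at least one direction. The foliation $q>0$ (and the differential $q$) is called Jenkins–Strebel if its critical graph is compact and every leaf not contained in the critical graph is closed; when the critical graph is nonempty (i.e. $g\ge 2$), this means that the complement of the critical graph is a finite union of cylinders, each swept out by homotopic closed leaves. *)

theory Defs
  imports
    "HOL-Complex_Analysis.Complex_Analysis"
    "HOL-Homology.Homology"
begin

section \<open>Riemann surfaces\<close>

text \<open>A surface is an abstract topology \<open>X\<close> with an atlas \<open>A\<close>, which need not be maximal. A chart is
  a domain together with a coordinate function; the values of the latter off the domain are
  irrelevant.\<close>

type_synonym 'a chart = "'a set \<times> ('a \<Rightarrow> complex)"

abbreviation cdom :: "'a chart \<Rightarrow> 'a set" where
  "cdom c \<equiv> fst c"

abbreviation coord :: "'a chart \<Rightarrow> 'a \<Rightarrow> complex" where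
  "coord c \<equiv> snd c"

definition cinv :: "'a chart \<Rightarrow> complex \<Rightarrow> 'a" where
  "cinv c = inv_into (cdom c) (coord c)"

definition is_chart :: "'a topology \<Rightarrow> 'a chart \<Rightarrow> bool" where
  "is_chart X c \<longleftrightarrow>
     openin X (cdom c) \<and> open (coord c ` cdom c) \<and>
     homeomorphic_map (subtopology X (cdom c)) (top_of_set (coord c ` cdom c)) (coord c)"

definition transition :: "'a chart \<Rightarrow> 'a chart \<Rightarrow> complex \<Rightarrow> complex" where
  "transition c d = coord d \<circ> cinv c"

definition riemann_surface :: "'a topology \<Rightarrow> 'a chart set \<Rightarrow> bool" where
  "riemann_surface X A \<longleftrightarrow>
     topspace X \<noteq> {} \<and> connected_space X \<and> Hausdorff_space X \<and>
     (\<forall>c\<in>A. is_chart X c) \<and> (\<Union>c\<in>A. cdom c) = topspace X \<and>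
     (\<forall>c\<in>A. \<forall>d\<in>A. transition c d holomorphic_on coord c ` (cdom c \<inter> cdom d))"

definition compact_riemann_surface :: "'a topology \<Rightarrow> 'a chart set \<Rightarrow> bool" where
  "compact_riemann_surface X A \<longleftrightarrow> riemann_surface X A \<and> compact_space X"

text \<open>The genus is half the rank of the integral singular homology group \<open>H\<^sub>1(X, \<int>)\<close>.\<close>

definition has_genus :: "'a topology \<Rightarrow> nat \<Rightarrow> bool" where
  "has_genus X g \<longleftrightarrow> homology_group 1 X \<cong> free_Abelian_group {..<2 * g}"

definition anticonformal_involution :: "'a topology \<Rightarrow> 'a chart set \<Rightarrow> ('a \<Rightarrow> 'a) \<Rightarrow> bool" where
  "anticonformal_involution X A J \<longleftrightarrow>
     continuous_map X X J \<and> (\<forall>x\<in>topspace X. J (J x) = x) \<and>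
     (\<forall>c\<in>A. \<forall>d\<in>A. (cnj \<circ> coord d \<circ> J \<circ> cinv c)
        holomorphic_on coord c ` {x \<in> cdom c. J x \<in> cdom d})"


section \<open>Holomorphic differentials\<close>

text \<open>A holomorphic differential of order \<open>k\<close> is given by its coefficient in each chart: the local
  expression in the chart \<open>c\<close> with coordinate \<open>z\<close> is \<open>\<eta> c z dz\<^sup>k\<close>. Order \<open>1\<close> gives holomorphic
  1-forms, order \<open>2\<close> gives holomorphic quadratic differentials.\<close>

type_synonym 'a differential = "'a chart \<Rightarrow> complex \<Rightarrow> complex"

definition holomorphic_differential :: "nat \<Rightarrow> 'a chart set \<Rightarrow> 'a differential \<Rightarrow> bool" where
  "holomorphic_differential k A \<eta> \<longleftrightarrow>
     (\<forall>c\<in>A. \<eta> c holomorphic_on coord c ` cdom c) \<and>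
     (\<forall>c\<in>A. \<forall>d\<in>A. \<forall>z \<in> coord c ` (cdom c \<inter> cdom d).
        \<eta> c z = \<eta> d (transition c d z) * deriv (transition c d) z ^ k)"

definition nonzero_differential :: "'a chart set \<Rightarrow> 'a differential \<Rightarrow> bool" where
  "nonzero_differential A \<eta> \<longleftrightarrow> (\<exists>c\<in>A. \<exists>z \<in> coord c ` cdom c. \<eta> c z \<noteq> 0)"

text \<open>The condition \<open>J\<^sup>* \<eta> = cnj \<eta>\<close> for a 1-form \<open>\<eta>\<close>. In coordinates \<open>z\<close>, \<open>w\<close> of the charts \<open>c\<close>, \<open>d\<close> the
  involution is \<open>w = cnj (h z)\<close> with \<open>h\<close> holomorphic, so that \<open>dw = cnj (h' z) d(cnj z)\<close> and hence
  \<open>J\<^sup>* (\<eta> d w dw) = \<eta> d (cnj (h z)) cnj (h' z) d(cnj z)\<close>.\<close>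

definition real_differential :: "'a chart set \<Rightarrow> ('a \<Rightarrow> 'a) \<Rightarrow> 'a differential \<Rightarrow> bool" where
  "real_differential A J \<eta> \<longleftrightarrow>
     (\<forall>c\<in>A. \<forall>d\<in>A. \<forall>x \<in> cdom c. J x \<in> cdom d \<longrightarrow>
        (let h = cnj \<circ> coord d \<circ> J \<circ> cinv c; z = coord c x
         in \<eta> d (cnj (h z)) * cnj (deriv h z) = cnj (\<eta> c z)))"


section \<open>Singular chains with real coefficients\<close>

type_synonym 'a rchain = "((nat \<Rightarrow> real) \<Rightarrow> 'a) \<Rightarrow>\<^sub>0 real"

definition rchain_in :: "nat \<Rightarrow> 'a topology \<Rightarrow> 'a rchain \<Rightarrow> bool" where
  "rchain_in p X C \<longleftrightarrow> Poly_Mapping.keys C \<subseteq> singular_simplex_set p X"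

text \<open>The real-linear extension of the boundary operator \<^const>\<open>chain_boundary\<close>.\<close>

definition rboundary :: "nat \<Rightarrow> 'a rchain \<Rightarrow> 'a rchain" where
  "rboundary p C =
     (if p = 0 then 0 else
      (\<Sum>\<sigma>\<in>Poly_Mapping.keys C. \<Sum>k\<le>p.
         Poly_Mapping.single (singular_face p k \<sigma>) ((-1) ^ k * Poly_Mapping.lookup C \<sigma>)))"

definition rchain_map :: "nat \<Rightarrow> ('a \<Rightarrow> 'b) \<Rightarrow> 'a rchain \<Rightarrow> 'b rchain" where
  "rchain_map p f C =
     (\<Sum>\<sigma>\<in>Poly_Mapping.keys C. Poly_Mapping.single (simplex_map p f \<sigma>) (Poly_Mapping.lookup C \<sigma>))"

text \<open>Elements of \<open>H\<^sub>1(X, \<real>)\<close> are represented by real singular 1-cycles, and equality of classes is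
  the relation \<open>homologous1\<close>.\<close>

definition rcycle1 :: "'a topology \<Rightarrow> 'a rchain \<Rightarrow> bool" where
  "rcycle1 X C \<longleftrightarrow> rchain_in 1 X C \<and> rboundary 1 C = 0"

definition homologous1 :: "'a topology \<Rightarrow> 'a rchain \<Rightarrow> 'a rchain \<Rightarrow> bool" where
  "homologous1 X C D \<longleftrightarrow> (\<exists>E. rchain_in 2 X E \<and> rboundary 2 E = C - D)"

text \<open>The cycles whose class lies in \<open>(I - J) H\<^sub>1(X, \<real>)\<close>.\<close>

definition odd_cycle :: "'a topology \<Rightarrow> ('a \<Rightarrow> 'a) \<Rightarrow> 'a rchain \<Rightarrow> bool" where
  "odd_cycle X J C \<longleftrightarrow>
     rcycle1 X C \<and> (\<exists>D. rcycle1 X D \<and> homologous1 X C (D - rchain_map 1 J D))"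


section \<open>Closed curves and the intersection form\<close>

text \<open>A closed curve is a continuous 1-periodic map on the real line.\<close>

definition closed_curve :: "'a topology \<Rightarrow> (real \<Rightarrow> 'a) \<Rightarrow> bool" where
  "closed_curve X \<gamma> \<longleftrightarrow> continuous_map euclideanreal X \<gamma> \<and> (\<forall>t. \<gamma> (t + 1) = \<gamma> t)"

text \<open>The multiple \<open>r\<close> of the cycle of a closed curve. The standard 1-simplex is parametrized by its
  barycentric coordinate number \<open>1\<close>, so it runs from vertex \<open>0\<close> to vertex \<open>1\<close>.\<close>

definition curve_cycle :: "real \<Rightarrow> (real \<Rightarrow> 'a) \<Rightarrow> 'a rchain" where
  "curve_cycle r \<gamma> = Poly_Mapping.single (restrict (\<lambda>x. \<gamma> (x 1)) (standard_simplex 1)) r"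

definition crossings :: "(real \<Rightarrow> 'a) \<Rightarrow> (real \<Rightarrow> 'a) \<Rightarrow> (real \<times> real) set" where
  "crossings \<gamma> \<delta> = {(s, t). s \<in> {0..<1} \<and> t \<in> {0..<1} \<and> \<gamma> s = \<delta> t}"

text \<open>Two closed curves are transverse if they cross finitely often and at each crossing both are
  differentiable with tangent vectors that are linearly independent over \<open>\<real>\<close>; recall that
  \<open>Im (cnj u * v)\<close> is the determinant of \<open>u\<close>, \<open>v\<close>. Smoothness away from the crossings plays no
  role for the intersection number.\<close>

definition transverse :: "'a chart set \<Rightarrow> (real \<Rightarrow> 'a) \<Rightarrow> (real \<Rightarrow> 'a) \<Rightarrow> bool" where
  "transverse A \<gamma> \<delta> \<longleftrightarrow>
     finite (crossings \<gamma> \<delta>) \<and>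
     (\<forall>(s, t) \<in> crossings \<gamma> \<delta>. \<forall>c\<in>A. \<gamma> s \<in> cdom c \<longrightarrow>
        (\<exists>u v. ((coord c \<circ> \<gamma>) has_vector_derivative u) (at s) \<and>
               ((coord c \<circ> \<delta>) has_vector_derivative v) (at t) \<and> Im (cnj u * v) \<noteq> 0))"

text \<open>The sign of a crossing with respect to the complex orientation; it does not depend on the
  chart because coordinate changes are holomorphic.\<close>

definition crossing_sign :: "'a chart set \<Rightarrow> (real \<Rightarrow> 'a) \<Rightarrow> (real \<Rightarrow> 'a) \<Rightarrow> real \<times> real \<Rightarrow> real" where
  "crossing_sign A \<gamma> \<delta> = (\<lambda>(s, t).
     let c = (SOME c. c \<in> A \<and> \<gamma> s \<in> cdom c)
     in sgn (Im (cnj (vector_derivative (coord c \<circ> \<gamma>) (at s)) *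
                 vector_derivative (coord c \<circ> \<delta>) (at t))))"

definition crossing_number :: "'a chart set \<Rightarrow> (real \<Rightarrow> 'a) \<Rightarrow> (real \<Rightarrow> 'a) \<Rightarrow> real" where
  "crossing_number A \<gamma> \<delta> = (\<Sum>p\<in>crossings \<gamma> \<delta>. crossing_sign A \<gamma> \<delta> p)"

text \<open>The intersection form \<open>C \<circ> D = n\<close> on \<open>H\<^sub>1(X, \<real>)\<close>: write the classes of \<open>C\<close> and \<open>D\<close> as real
  combinations of closed curves that are pairwise transverse, and extend the signed count of
  crossings bilinearly. On a compact Riemann surface every pair of classes has such a
  representation, and the value does not depend on its choice.\<close>

definition has_intersection_number ::
    "'a topology \<Rightarrow> 'a chart set \<Rightarrow> 'a rchain \<Rightarrow> 'a rchain \<Rightarrow> real \<Rightarrow> bool" where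
  "has_intersection_number X A C D n \<longleftrightarrow>
     (\<exists>(k::nat) (l::nat) \<gamma> \<delta> r s.
        (\<forall>i<k. closed_curve X (\<gamma> i)) \<and> (\<forall>j<l. closed_curve X (\<delta> j)) \<and>
        homologous1 X C (\<Sum>i<k. curve_cycle (r i) (\<gamma> i)) \<and>
        homologous1 X D (\<Sum>j<l. curve_cycle (s j) (\<delta> j)) \<and>
        (\<forall>i<k. \<forall>j<l. transverse A (\<gamma> i) (\<delta> j)) \<and>
        n = (\<Sum>i<k. \<Sum>j<l. r i * s j * crossing_number A (\<gamma> i) (\<delta> j)))"

definition real_ovals :: "'a topology \<Rightarrow> ('a \<Rightarrow> 'a) \<Rightarrow> 'a set set" where
  "real_ovals X J = connected_components_of (subtopology X {x \<in> topspace X. J x = x})"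

text \<open>A simple closed curve that runs once through a real oval; its homology class is that of the
  oval with the orientation given by the curve.\<close>

definition oriented_real_oval :: "'a topology \<Rightarrow> ('a \<Rightarrow> 'a) \<Rightarrow> (real \<Rightarrow> 'a) \<Rightarrow> bool" where
  "oriented_real_oval X J R \<longleftrightarrow>
     closed_curve X R \<and> inj_on R {0..<1} \<and> range R \<in> real_ovals X J"


section \<open>Integration of holomorphic 1-forms\<close>

definition local_primitive ::
    "'a topology \<Rightarrow> 'a chart set \<Rightarrow> 'a differential \<Rightarrow> 'a set \<Rightarrow> ('a \<Rightarrow> complex) \<Rightarrow> bool" where
  "local_primitive X A \<eta> U F \<longleftrightarrow>
     openin X U \<and>
     (\<forall>c\<in>A. \<forall>x \<in> U \<inter> cdom c. ((F \<circ> cinv c) has_field_derivative \<eta> c (coord c x)) (at (coord c x)))"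

text \<open>Singular simplices are only continuous, so the integral is defined by means of a primitive
  along the path: a function on \<open>[0, 1]\<close> that locally is the composition of the path with a local
  primitive of \<open>\<eta>\<close>. Such a function exists and is unique up to an additive constant.\<close>

definition primitive_along ::
    "'a topology \<Rightarrow> 'a chart set \<Rightarrow> 'a differential \<Rightarrow> (real \<Rightarrow> 'a) \<Rightarrow> (real \<Rightarrow> complex) \<Rightarrow> bool" where
  "primitive_along X A \<eta> \<gamma> f \<longleftrightarrow>
     (\<forall>t\<in>{0..1}. \<exists>U F e. e > 0 \<and> local_primitive X A \<eta> U F \<and>
        (\<forall>s\<in>{0..1}. \<bar>s - t\<bar> < e \<longrightarrow> \<gamma> s \<in> U \<and> f s = F (\<gamma> s)))"

definition path_integral_form ::
    "'a topology \<Rightarrow> 'a chart set \<Rightarrow> 'a differential \<Rightarrow> (real \<Rightarrow> 'a) \<Rightarrow> complex" where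
  "path_integral_form X A \<eta> \<gamma> = (THE I. \<exists>f. primitive_along X A \<eta> \<gamma> f \<and> I = f 1 - f 0)"

definition simplex_path :: "((nat \<Rightarrow> real) \<Rightarrow> 'a) \<Rightarrow> real \<Rightarrow> 'a" where
  "simplex_path \<sigma> t = \<sigma> (\<lambda>i. if i = 0 then 1 - t else if i = 1 then t else 0)"

definition chain_integral ::
    "'a topology \<Rightarrow> 'a chart set \<Rightarrow> 'a differential \<Rightarrow> 'a rchain \<Rightarrow> complex" where
  "chain_integral X A \<eta> C =
     (\<Sum>\<sigma>\<in>Poly_Mapping.keys C.
        of_real (Poly_Mapping.lookup C \<sigma>) * path_integral_form X A \<eta> (simplex_path \<sigma>))"


section \<open>The horizontal foliation of a quadratic differential\<close>

definition zeros :: "'a chart set \<Rightarrow> 'a differential \<Rightarrow> 'a set" where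
  "zeros A q = {x. \<exists>c\<in>A. x \<in> cdom c \<and> q c (coord c x) = 0}"

text \<open>Curves off the zeros on whose tangent vectors \<open>q\<close> is positive. The parameter interval is open
  and therefore may be taken to be the whole real line.\<close>

definition horizontal_curve ::
    "'a topology \<Rightarrow> 'a chart set \<Rightarrow> 'a differential \<Rightarrow> (real \<Rightarrow> 'a) \<Rightarrow> bool" where
  "horizontal_curve X A q \<gamma> \<longleftrightarrow>
     continuous_map euclideanreal X \<gamma> \<and> range \<gamma> \<inter> zeros A q = {} \<and>
     (\<forall>t. \<forall>c\<in>A. \<gamma> t \<in> cdom c \<longrightarrow>
        (\<exists>v r. ((coord c \<circ> \<gamma>) has_vector_derivative v) (at t) \<and>
               r > 0 \<and> q c (coord c (\<gamma> t)) * v\<^sup>2 = complex_of_real r))"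

definition leaf :: "'a topology \<Rightarrow> 'a chart set \<Rightarrow> 'a differential \<Rightarrow> 'a set \<Rightarrow> bool" where
  "leaf X A q L \<longleftrightarrow>
     (\<exists>\<gamma>. horizontal_curve X A q \<gamma> \<and> range \<gamma> = L) \<and>
     (\<forall>\<delta>. horizontal_curve X A q \<delta> \<longrightarrow> L \<subseteq> range \<delta> \<longrightarrow> range \<delta> = L)"

definition closed_leaf :: "'a topology \<Rightarrow> 'a chart set \<Rightarrow> 'a differential \<Rightarrow> 'a set \<Rightarrow> bool" where
  "closed_leaf X A q L \<longleftrightarrow>
     leaf X A q L \<and>
     (\<exists>\<gamma> T. horizontal_curve X A q \<gamma> \<and> range \<gamma> = L \<and> T > 0 \<and> (\<forall>t. \<gamma> (t + T) = \<gamma> t))"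

text \<open>Reversing a horizontal curve gives a horizontal curve, so it is enough to let \<open>t\<close> tend to
  plus infinity.\<close>

definition critical_leaf :: "'a topology \<Rightarrow> 'a chart set \<Rightarrow> 'a differential \<Rightarrow> 'a set \<Rightarrow> bool" where
  "critical_leaf X A q L \<longleftrightarrow>
     leaf X A q L \<and>
     (\<exists>\<gamma> p. horizontal_curve X A q \<gamma> \<and> range \<gamma> = L \<and> p \<in> zeros A q \<and> limitin X \<gamma> p at_top)"

definition critical_graph :: "'a topology \<Rightarrow> 'a chart set \<Rightarrow> 'a differential \<Rightarrow> 'a set" where
  "critical_graph X A q = zeros A q \<union> \<Union>{L. critical_leaf X A q L}"

definition jenkins_strebel :: "'a topology \<Rightarrow> 'a chart set \<Rightarrow> 'a differential \<Rightarrow> bool" where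
  "jenkins_strebel X A q \<longleftrightarrow>
     holomorphic_differential 2 A q \<and> nonzero_differential A q \<and>
     compactin X (critical_graph X A q) \<and>
     (\<forall>L. leaf X A q L \<longrightarrow> \<not> L \<subseteq> critical_graph X A q \<longrightarrow> closed_leaf X A q L)"

end

theory Submission
  imports Defs
begin

text \<open>
  Let \<open>Y\<close> be the complement of the fixed points of \<open>J\<close>, that is, of the real ovals. A loop \<open>\<gamma>\<close> in \<open>Y\<close> and
  its mirror image \<open>J \<circ> \<gamma>\<close> do not meet the ovals, so the odd cycle \<open>\<gamma> - J \<circ> \<gamma>\<close> has intersection number
  \<open>0\<close> with each of them. Since \<open>\<eta>\<close> is real, its integral over this cycle is \<open>2 \<i>\<close> times the imaginary
  part of its integral over \<open>\<gamma>\<close>, and the hypothesis makes it vanish (\<open>loop_height_change_zero\<close>). Hence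
  \<open>Im \<integral> \<eta>\<close> is a single-valued function \<open>h\<close> on \<open>Y\<close>; on the ovals put \<open>h = 0\<close>. As \<open>\<eta>\<close> is real along
  the ovals, these consist of zeros and horizontal arcs, so that every leaf lies either in \<open>Y\<close> or in an
  oval (\<open>horizontal_curve_real_or_nonreal\<close>). In both cases \<open>h\<close> is constant on the leaf.

  Every point of the surface has a neighbourhood in which \<open>h\<close> differs from the imaginary part of a local
  primitive by finitely many constants: off the ovals by one, and near a point of an oval by one on
  the oval and one on each of its two sides, because there \<open>J\<close> is complex conjugation in a suitable coordinate
  (\<open>height_jumps_finite\<close>). This holds at zeros of \<open>\<eta>\<close> as well. A leaf therefore meets a small flow box
  in finitely many horizontal segments, and this finiteness gives both parts of the claim.

  A leaf is parametrized by a maximal unit speed trajectory. If the trajectory is not injective, it is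
  periodic and the leaf is closed. If it is injective, it cannot return infinitely often to a flow
  box, since there are only finitely many segments to return to; so its cluster points at the forward
  end are zeros of \<open>\<eta>\<close>. There are finitely many of these, hence the trajectory converges to a
  zero and the leaf is critical (\<open>leaf_closed_or_critical\<close>).

  A critical leaf converges to a zero \<open>p\<close>, which leaves only finitely many possible values of \<open>h\<close>,
  given by the height of \<open>p\<close> and the constants at \<open>p\<close>. So all critical leaves together occupy finitely
  many heights in a flow box, and their union with the zeros is closed (\<open>critical_graph_compact\<close>).
\<close>

section \<open>Continuity by neighbourhoods\<close>

lemma continuous_map_eventually_in_openin:
  fixes S :: "'b::topological_space set"
  assumes "continuous_map (top_of_set S) X f" "t \<in> S" "openin X W" "f t \<in> W"
  shows "\<forall>\<^sub>F s in at t within S. f s \<in> W"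
proof -
  have "openin (top_of_set S) {s \<in> topspace (top_of_set S). f s \<in> W}"
    using assms unfolding continuous_map by blast
  then obtain T where "open T" "{s \<in> S. f s \<in> W} = S \<inter> T"
    unfolding openin_open by auto
  then show ?thesis
    using assms unfolding eventually_at_topological by (intro exI[of _ T]) auto
qed

lemma continuous_map_from_eventually_in_openin:
  fixes S :: "'b::topological_space set"
  assumes "\<And>t. t \<in> S \<Longrightarrow> f t \<in> topspace X"
    and "\<And>t W. \<lbrakk>t \<in> S; openin X W; f t \<in> W\<rbrakk> \<Longrightarrow> \<forall>\<^sub>F s in at t within S. f s \<in> W"
  shows "continuous_map (top_of_set S) X f"
  unfolding continuous_map
proof (intro conjI allI impI)
  show "f ` topspace (top_of_set S) \<subseteq> topspace X"
    using assms(1) by auto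
next
  fix W assume W: "openin X W"
  show "openin (top_of_set S) {s \<in> topspace (top_of_set S). f s \<in> W}"
  proof (subst openin_subopen, intro ballI)
    fix t assume t: "t \<in> {s \<in> topspace (top_of_set S). f s \<in> W}"
    then obtain T where T: "open T" "t \<in> T" "\<forall>s\<in>T. s \<noteq> t \<longrightarrow> s \<in> S \<longrightarrow> f s \<in> W"
      using assms(2)[of t W] W unfolding eventually_at_topological by auto
    have "openin (top_of_set S) (S \<inter> T)"
      using T by (simp add: openin_open_Int)
    with t T show "\<exists>T. openin (top_of_set S) T \<and> t \<in> T \<and> T \<subseteq> {s \<in> topspace (top_of_set S). f s \<in> W}"
      by (intro exI[of _ "S \<inter> T"]) auto
  qed
qed

lemma eventually_nhds_in_openin:
  fixes S :: "'b::topological_space set"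
  assumes "continuous_map (top_of_set S) X f" "open S" "t \<in> S" "openin X W" "f t \<in> W"
  shows "\<forall>\<^sub>F s in nhds t. f s \<in> W"
proof -
  have "\<forall>\<^sub>F s in at t. f s \<in> W"
    using continuous_map_eventually_in_openin[OF assms(1,3,4,5)] at_within_open[OF assms(3,2)]
    by simp
  then show ?thesis
    using assms(5) by (simp add: eventually_nhds_conv_at)
qed

section \<open>Charts and local primitives\<close>

locale riemann_surface_form =
  fixes X :: "'a topology" and A :: "'a chart set" and \<eta> :: "'a differential"
  assumes surface: "riemann_surface X A"
    and form: "holomorphic_differential 1 A \<eta>"
begin

lemma Hausdorff: "Hausdorff_space X"
  using surface by (simp add: riemann_surface_def)

lemma chart_at:
  assumes "x \<in> topspace X"
  obtains c where "c \<in> A" "x \<in> cdom c"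
  using assms surface unfolding riemann_surface_def by blast

lemma openin_cdom: "c \<in> A \<Longrightarrow> openin X (cdom c)"
  using surface by (auto simp: riemann_surface_def is_chart_def)

lemma cdom_subset: "c \<in> A \<Longrightarrow> cdom c \<subseteq> topspace X"
  using openin_cdom openin_subset by blast

lemma homeomorphic_coord:
  "c \<in> A \<Longrightarrow> homeomorphic_map (subtopology X (cdom c)) (top_of_set (coord c ` cdom c)) (coord c)"
  using surface by (auto simp: riemann_surface_def is_chart_def)

lemma inj_on_coord: "c \<in> A \<Longrightarrow> inj_on (coord c) (cdom c)"
  using homeomorphic_imp_injective_map[OF homeomorphic_coord] cdom_subset
  by (metis inf.absorb_iff2 topspace_subtopology)

lemma cinv_coord [simp]: "\<lbrakk>c \<in> A; x \<in> cdom c\<rbrakk> \<Longrightarrow> cinv c (coord c x) = x"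
  by (simp add: cinv_def inj_on_coord)

lemma coord_cinv [simp]: "z \<in> coord c ` cdom c \<Longrightarrow> coord c (cinv c z) = z"
  by (simp add: cinv_def f_inv_into_f)

lemma cinv_in_cdom: "z \<in> coord c ` cdom c \<Longrightarrow> cinv c z \<in> cdom c"
  by (simp add: cinv_def inv_into_into)

lemma continuous_map_coord:
  "c \<in> A \<Longrightarrow> continuous_map (subtopology X (cdom c)) euclidean (coord c)"
  using homeomorphic_imp_continuous_map[OF homeomorphic_coord]
  by (simp add: continuous_map_in_subtopology)

lemma open_coord_image:
  assumes "c \<in> A" "openin X U" "U \<subseteq> cdom c"
  shows "open (coord c ` U)"
proof -
  have "openin (subtopology X (cdom c)) U"
    using assms openin_cdom by (simp add: openin_open_subtopology)
  then have "openin (top_of_set (coord c ` cdom c)) (coord c ` U)"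
    using homeomorphic_imp_open_map[OF homeomorphic_coord[OF assms(1)]]
    by (simp add: open_map_def)
  moreover have "open (coord c ` cdom c)"
    using assms(1) surface by (auto simp: riemann_surface_def is_chart_def)
  ultimately show ?thesis
    using openin_open_trans by blast
qed

lemma open_coord_cdom: "c \<in> A \<Longrightarrow> open (coord c ` cdom c)"
  by (simp add: open_coord_image openin_cdom)

lemma openin_coord_preimage:
  assumes "c \<in> A" "open V"
  shows "openin X {x \<in> cdom c. coord c x \<in> V}"
proof -
  have "openin (subtopology X (cdom c)) {x \<in> topspace (subtopology X (cdom c)). coord c x \<in> V}"
    using continuous_map_coord[OF assms(1)] assms(2) by (simp add: continuous_map)
  moreover have "topspace (subtopology X (cdom c)) = cdom c"
    using cdom_subset[OF assms(1)] by auto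
  ultimately show ?thesis
    using openin_cdom[OF assms(1)] by (metis openin_open_subtopology)
qed

lemma eventually_coord_in:
  assumes "c \<in> A" "openin X W" "x \<in> W" "x \<in> cdom c"
  shows "\<forall>\<^sub>F z in nhds (coord c x). z \<in> coord c ` (W \<inter> cdom c)"
proof (rule eventually_nhds_in_open)
  show "open (coord c ` (W \<inter> cdom c))"
    using assms by (intro open_coord_image openin_Int openin_cdom) auto
qed (use assms in auto)

lemma continuous_map_cinv:
  "c \<in> A \<Longrightarrow> continuous_map (top_of_set (coord c ` cdom c)) X (cinv c)"
proof (rule continuous_map_from_eventually_in_openin)
  fix z W assume c: "c \<in> A" and z: "z \<in> coord c ` cdom c" and W: "openin X W" "cinv c z \<in> W"
  have "\<forall>\<^sub>F z in nhds (coord c (cinv c z)). z \<in> coord c ` (W \<inter> cdom c)"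
    using c z W by (intro eventually_coord_in) (auto simp: cinv_in_cdom)
  then have "\<forall>\<^sub>F z in nhds z. z \<in> coord c ` (W \<inter> cdom c)"
    using z by simp
  then have "\<forall>\<^sub>F z in nhds z. cinv c z \<in> W"
    by eventually_elim (use c in auto)
  then show "\<forall>\<^sub>F z in at z within coord c ` cdom c. cinv c z \<in> W"
    by (simp add: eventually_at_filter eventually_mono)
next
  fix z assume "c \<in> A" "z \<in> coord c ` cdom c"
  then show "cinv c z \<in> topspace X"
    using cinv_in_cdom[of z c] cdom_subset[of c] by auto
qed

lemma eventually_cinv_in:
  assumes "c \<in> A" "openin X W" "x \<in> W" "x \<in> cdom c"
  shows "\<forall>\<^sub>F z in nhds (coord c x). cinv c z \<in> W \<inter> cdom c \<and> coord c (cinv c z) = z"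
  using eventually_coord_in[OF assms] by eventually_elim (use assms in auto)

lemma coefficient_holomorphic: "c \<in> A \<Longrightarrow> \<eta> c holomorphic_on coord c ` cdom c"
  using form by (simp add: holomorphic_differential_def)

lemma coefficient_transition:
  assumes "c \<in> A" "d \<in> A" "x \<in> cdom c" "x \<in> cdom d"
  shows "\<eta> c (coord c x) = \<eta> d (coord d x) * deriv (transition c d) (coord c x)"
proof -
  have "\<eta> c (coord c x) = \<eta> d (transition c d (coord c x)) * deriv (transition c d) (coord c x) ^ 1"
    using form assms unfolding holomorphic_differential_def by blast
  then show ?thesis using assms by (simp add: transition_def)
qed

lemma transition_has_derivative:
  assumes "c \<in> A" "d \<in> A" "x \<in> cdom c" "x \<in> cdom d"
  shows "(transition c d has_field_derivative deriv (transition c d) (coord c x)) (at (coord c x))"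
proof (rule holomorphic_derivI)
  show "transition c d holomorphic_on coord c ` (cdom c \<inter> cdom d)"
    using surface assms by (simp add: riemann_surface_def)
  show "open (coord c ` (cdom c \<inter> cdom d))"
    using assms by (intro open_coord_image openin_Int openin_cdom) auto
qed (use assms in auto)

text \<open>A primitive need only be checked in one chart, because the coefficients of \<open>\<eta>\<close> transform
  by the chain rule.\<close>

lemma local_primitive_single_chart:
  assumes c: "c \<in> A" "U \<subseteq> cdom c" and U: "openin X U"
    and F: "\<And>x. x \<in> U \<Longrightarrow> ((F \<circ> cinv c) has_field_derivative \<eta> c (coord c x)) (at (coord c x))"
  shows "local_primitive X A \<eta> U F"
  unfolding local_primitive_def
proof (intro conjI ballI U)
  fix d x assume d: "d \<in> A" and x: "x \<in> U \<inter> cdom d"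
  let ?T = "transition d c"
  have T: "(?T has_field_derivative deriv ?T (coord d x)) (at (coord d x))"
    using c d x by (intro transition_has_derivative) auto
  have "?T (coord d x) = coord c x"
    using c d x by (simp add: transition_def)
  then have "((F \<circ> cinv c \<circ> ?T) has_field_derivative
      \<eta> c (coord c x) * deriv ?T (coord d x)) (at (coord d x))"
    using DERIV_chain[OF _ T] F x by simp
  moreover have "\<forall>\<^sub>F z in nhds (coord d x). (F \<circ> cinv d) z = (F \<circ> cinv c \<circ> ?T) z"
    using eventually_cinv_in[OF d U, of x] x c by (auto simp: transition_def elim!: eventually_mono)
  moreover have "\<eta> d (coord d x) = \<eta> c (coord c x) * deriv ?T (coord d x)"
    using c d x by (intro coefficient_transition) auto
  ultimately show "((F \<circ> cinv d) has_field_derivative \<eta> d (coord d x)) (at (coord d x))"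
    by (subst DERIV_cong_ev[OF refl _ refl]) auto
qed

lemma local_primitiveD:
  assumes "local_primitive X A \<eta> U F" "c \<in> A" "x \<in> U" "x \<in> cdom c"
  shows "((F \<circ> cinv c) has_field_derivative \<eta> c (coord c x)) (at (coord c x))"
  using assms unfolding local_primitive_def by blast

lemma local_primitive_openin: "local_primitive X A \<eta> U F \<Longrightarrow> openin X U"
  by (simp add: local_primitive_def)

lemma local_primitive_subset:
  assumes "local_primitive X A \<eta> U F" "openin X V" "V \<subseteq> U"
  shows "local_primitive X A \<eta> V F"
  using assms unfolding local_primitive_def by blast

lemma local_primitive_add_const:
  assumes "local_primitive X A \<eta> U F"
  shows "local_primitive X A \<eta> U (\<lambda>x. F x + k)"
  unfolding local_primitive_def
proof (intro conjI ballI)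
  fix c x assume "c \<in> A" "x \<in> U \<inter> cdom c"
  then have "((\<lambda>z. (F \<circ> cinv c) z + k) has_field_derivative \<eta> c (coord c x) + 0) (at (coord c x))"
    by (intro DERIV_add DERIV_const local_primitiveD[OF assms]) auto
  then show "((\<lambda>x. F x + k) \<circ> cinv c has_field_derivative \<eta> c (coord c x)) (at (coord c x))"
    by (simp add: o_def)
qed (use assms local_primitive_openin in blast)

lemma local_primitive_exists:
  assumes "x \<in> topspace X"
  obtains U F where "x \<in> U" "local_primitive X A \<eta> U F"
proof -
  obtain c where c: "c \<in> A" "x \<in> cdom c" using chart_at assms by blast
  then obtain r where r: "r > 0" "ball (coord c x) r \<subseteq> coord c ` cdom c"
    using openE[OF open_coord_cdom[OF c(1)], of "coord c x"] by auto
  have "\<eta> c holomorphic_on ball (coord c x) r"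
    using coefficient_holomorphic[OF c(1)] r(2) holomorphic_on_subset by blast
  then obtain P where P: "\<And>z. z \<in> ball (coord c x) r \<Longrightarrow>
      (P has_field_derivative \<eta> c z) (at z within ball (coord c x) r)"
    using holomorphic_convex_primitive' convex_ball open_ball by blast
  let ?U = "{y \<in> cdom c. coord c y \<in> ball (coord c x) r}"
  have "local_primitive X A \<eta> ?U (P \<circ> coord c)"
  proof (rule local_primitive_single_chart)
    show "openin X ?U" using c openin_coord_preimage by blast
    fix y assume y: "y \<in> ?U"
    have "(P has_field_derivative \<eta> c (coord c y)) (at (coord c y))"
      using P[of "coord c y"] y by (simp add: at_within_open[OF _ open_ball])
    moreover have "\<forall>\<^sub>F z in nhds (coord c y). (P \<circ> coord c \<circ> cinv c) z = P z"
      using eventually_cinv_in[OF c(1) openin_cdom[OF c(1)], of y] y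
      by (auto elim: eventually_mono)
    ultimately show "((P \<circ> coord c \<circ> cinv c) has_field_derivative \<eta> c (coord c y)) (at (coord c y))"
      by (subst DERIV_cong_ev[OF refl _ refl]) auto
  qed (use c in auto)
  then show ?thesis using that[of ?U] c r by auto
qed

lemma continuous_map_local_primitive:
  assumes F: "local_primitive X A \<eta> U F" 
  shows "continuous_map (subtopology X U) euclidean F"
  unfolding continuous_map
proof (intro conjI allI impI)
  fix B :: "complex set" assume B: "openin euclidean B"
  have U: "openin X U" "U \<subseteq> topspace X"
    using local_primitive_openin[OF F] openin_subset by blast+
  have "openin X {x \<in> U. F x \<in> B}"
  proof (subst openin_subopen, intro ballI)
    fix x assume x: "x \<in> {x \<in> U. F x \<in> B}"
    then obtain c where c: "c \<in> A" "x \<in> cdom c" using U chart_at by blast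
    have "isCont (F \<circ> cinv c) (coord c x)"
      using local_primitiveD[OF F] x c DERIV_isCont by blast
    then have "\<forall>\<^sub>F z in nhds (coord c x). (F \<circ> cinv c) z \<in> B"
      using B x c topological_tendstoD[of "F \<circ> cinv c" "F x" "nhds (coord c x)" B]
        tendsto_at_iff_tendsto_nhds[of "F \<circ> cinv c" "coord c x"]
      by (simp add: isCont_def)
    moreover have "\<forall>\<^sub>F z in nhds (coord c x). cinv c z \<in> U \<inter> cdom c"
      using eventually_cinv_in[OF c(1) U(1), of x] x c by (auto elim: eventually_mono)
    ultimately have "\<forall>\<^sub>F z in nhds (coord c x). cinv c z \<in> {x \<in> U. F x \<in> B}"
      by eventually_elim auto
    then obtain V where V: "open V" "coord c x \<in> V" "\<forall>z\<in>V. cinv c z \<in> {x \<in> U. F x \<in> B}"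
      unfolding eventually_nhds by blast
    show "\<exists>T. openin X T \<and> x \<in> T \<and> T \<subseteq> {x \<in> U. F x \<in> B}"
      using V c openin_coord_preimage[OF c(1) V(1)]
      by (intro exI[of _ "{y \<in> cdom c. coord c y \<in> V}"]) force
  qed
  then show "openin (subtopology X U) {x \<in> topspace (subtopology X U). F x \<in> B}"
    using U by (simp add: openin_open_subtopology inf.absorb2 Collect_mono_iff)
qed auto

lemma openin_local_primitive_preimage:
  assumes "local_primitive X A \<eta> U F" "open B"
  shows "openin X {x \<in> U. F x \<in> B}"
proof -
  have U: "openin X U" "U \<subseteq> topspace X"
    using local_primitive_openin[OF assms(1)] openin_subset by blast+
  have "openin (subtopology X U) {x \<in> topspace (subtopology X U). F x \<in> B}"
    using continuous_map_local_primitive[OF assms(1)] assms(2) unfolding continuous_map by auto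
  moreover have "{x \<in> topspace (subtopology X U). F x \<in> B} = {x \<in> U. F x \<in> B}"
    using U by auto
  ultimately have "openin (subtopology X U) {x \<in> U. F x \<in> B}"
    by simp
  then show ?thesis
    using U(1) by (simp add: openin_open_subtopology)
qed

text \<open>Two primitives differ by a constant near each common point, since in a chart their
  difference has derivative zero on a disc.\<close>

lemma local_primitives_differ_by_const:
  assumes F1: "local_primitive X A \<eta> U1 F1" and F2: "local_primitive X A \<eta> U2 F2"
    and x: "x \<in> U1" "x \<in> U2"
  obtains V where "openin X V" "x \<in> V" "V \<subseteq> U1 \<inter> U2"
    "\<And>y. y \<in> V \<Longrightarrow> F1 y - F2 y = F1 x - F2 x"
proof -
  have U: "openin X (U1 \<inter> U2)" using F1 F2 local_primitive_openin by blast
  then obtain c where c: "c \<in> A" "x \<in> cdom c" using x openin_subset chart_at by blast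
  have "open (coord c ` (U1 \<inter> U2 \<inter> cdom c))"
    using U c by (intro open_coord_image openin_Int[OF U] openin_cdom) auto
  then obtain r where r: "r > 0" "ball (coord c x) r \<subseteq> coord c ` (U1 \<inter> U2 \<inter> cdom c)"
    using x c by (elim openE[of _ "coord c x"]) auto
  let ?D = "\<lambda>z. (F1 \<circ> cinv c) z - (F2 \<circ> cinv c) z"
  have "(?D has_field_derivative 0) (at z within ball (coord c x) r)" if z: "z \<in> ball (coord c x) r" for z
  proof -
    obtain y where y: "z = coord c y" "y \<in> U1 \<inter> U2 \<inter> cdom c" using r z by blast
    have "(?D has_field_derivative \<eta> c (coord c y) - \<eta> c (coord c y)) (at (coord c y))"
      using y c by (intro DERIV_diff local_primitiveD[OF F1] local_primitiveD[OF F2]) auto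
    then show ?thesis using y by (simp add: has_field_derivative_at_within)
  qed
  then obtain k where k: "\<forall>z\<in>ball (coord c x) r. ?D z = k"
    using has_field_derivative_zero_constant[OF convex_ball, of "coord c x" r ?D] by blast
  let ?V = "{y \<in> cdom c. coord c y \<in> ball (coord c x) r}"
  have *: "F1 y - F2 y = k" "y \<in> U1 \<inter> U2" if "y \<in> ?V" for y
  proof -
    have "?D (coord c y) = k" using k that by blast
    then show "F1 y - F2 y = k" using c that by simp
    have "coord c y \<in> coord c ` (U1 \<inter> U2 \<inter> cdom c)" using that r(2) by blast
    then obtain y' where "coord c y = coord c y'" "y' \<in> U1 \<inter> U2 \<inter> cdom c" by blast
    then have "y = y'" using inj_on_coord[OF c(1)] that by (auto dest: inj_onD)
    then show "y \<in> U1 \<inter> U2" using \<open>y' \<in> _\<close> by blast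
  qed
  have "x \<in> ?V" using c r by simp
  show ?thesis
    by (rule that[of ?V]) (use * \<open>x \<in> ?V\<close> openin_coord_preimage[OF c(1) open_ball] in auto)
qed

end

section \<open>Primitives along paths\<close>

lemma pathin_reverse:
  assumes "pathin X g"
  shows "pathin X (\<lambda>t. g (1 - t))"
proof -
  have "continuous_map (top_of_set {0..1}) (top_of_set {0..1}) (\<lambda>t::real. 1 - t)"
    by (auto simp: continuous_map_in_subtopology intro!: continuous_intros)
  from continuous_map_compose[OF this] assms show ?thesis
    unfolding pathin_def o_def by blast
qed

lemma pathin_join:
  assumes g1: "pathin X g1" and g2: "pathin X g2" and "g1 1 = g2 0"
  shows "pathin X (\<lambda>t. if t \<le> 1/2 then g1 (2 * t) else g2 (2 * t - 1))"
proof -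
  let ?T01 = "top_of_set {0..1::real}"
  have "continuous_map ?T01 X (\<lambda>t. if t \<le> 1/2 then (g1 \<circ> (\<lambda>t. 2 * t)) t else (g2 \<circ> (\<lambda>t. 2 * t - 1)) t)"
  proof (intro continuous_map_cases_le continuous_map_compose, force, force)
    show "continuous_map (subtopology ?T01 {x \<in> topspace ?T01. x \<le> 1/2}) ?T01 ((*) 2)"
      by (auto simp: continuous_map_in_subtopology continuous_map_from_subtopology)
    have "continuous_map
           (subtopology (top_of_set {0..1}) {x. 0 \<le> x \<and> x \<le> 1 \<and> 1 \<le> x * 2})
           euclideanreal (\<lambda>t. 2 * t - 1)"
      by (intro continuous_intros) (force intro: continuous_map_from_subtopology)
    then show "continuous_map (subtopology ?T01 {x \<in> topspace ?T01. 1/2 \<le> x}) ?T01 (\<lambda>t. 2 * t - 1)"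
      by (force simp: continuous_map_in_subtopology)
    show "(g1 \<circ> (\<lambda>t. 2 * t)) t = (g2 \<circ> (\<lambda>t. 2 * t - 1)) t" if "t = 1/2" for t :: real
      unfolding that using assms(3) by simp
  qed (use assms in \<open>auto simp: pathin_def\<close>)
  then show ?thesis unfolding pathin_def o_def .
qed

text \<open>Closed curves are periodic on the whole line. Near an integer time the continuity of the periodic
  extension uses both ends of the loop.\<close>

lemma closed_curve_of_loop:
  assumes "pathin X g" "g 0 = g 1"
  shows "closed_curve X (\<lambda>t. g (frac t))"
proof -
  have g: "continuous_map (top_of_set {0..1}) X g" using assms(1) by (simp add: pathin_def)
  have "continuous_map (top_of_set UNIV) X (\<lambda>t. g (frac t))"
  proof (rule continuous_map_from_eventually_in_openin)
    fix t :: real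
    show "g (frac t) \<in> topspace X"
      using g frac_ge_0[of t] frac_lt_1[of t] by (auto simp: continuous_map image_subset_iff)
    fix W assume W: "openin X W" "g (frac t) \<in> W"
    have near: "\<exists>e>0. \<forall>s\<in>{0..1}. \<bar>s - u\<bar> < e \<longrightarrow> g s \<in> W" if "u \<in> {0..1}" "g u \<in> W" for u
      using continuous_map_eventually_in_openin[OF g that(1) W(1) that(2)] that(2)
      unfolding eventually_at by (auto simp: dist_real_def)
    define n :: real where "n = of_int \<lfloor>t\<rfloor>"
    have n: "n \<in> \<int>" "n \<le> t" "t < n + 1" "frac t = t - n"
      by (auto simp: n_def frac_def)
    obtain e1 where e1: "e1 > 0" "\<forall>s\<in>{0..1}. \<bar>s - frac t\<bar> < e1 \<longrightarrow> g s \<in> W"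
      using near[of "frac t"] W frac_ge_0[of t] frac_lt_1[of t] by force
    show "\<forall>\<^sub>F s in at t within UNIV. g (frac s) \<in> W"
    proof (cases "t = n")
      case False
      have "\<forall>\<^sub>F s in nhds t. s \<in> {n<..<n+1} \<inter> ball t e1"
        by (rule eventually_nhds_in_open) (use False n e1 in auto)
      then have "\<forall>\<^sub>F s in nhds t. g (frac s) \<in> W"
      proof eventually_elim
        case (elim s)
        then have "frac s = s - n" using n(1) by (subst frac_unique_iff) auto
        then show ?case using e1 elim n by (auto simp: dist_real_def)
      qed
      then show ?thesis by (simp add: eventually_at_filter eventually_mono)
    next
      case True
      have "frac t = 0" using n(4) True by simp
      with W(2) assms(2) have "g 1 \<in> W" by metis
      have e1': "\<forall>s\<in>{0..1}. \<bar>s - 0\<bar> < e1 \<longrightarrow> g s \<in> W"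
        using e1(2) unfolding \<open>frac t = 0\<close> .
      from near[of 1, OF _ \<open>g 1 \<in> W\<close>] obtain e2 where e2: "e2 > 0" "\<forall>s\<in>{0..1}. \<bar>s - 1\<bar> < e2 \<longrightarrow> g s \<in> W"
        by auto
      have "\<forall>\<^sub>F s in nhds t. s \<in> {n-1<..<n+1} \<inter> ball t e1 \<inter> ball t e2"
        by (intro eventually_nhds_in_open open_Int open_greaterThanLessThan open_ball)
          (use True n e1 e2 in auto)
      then have "\<forall>\<^sub>F s in nhds t. g (frac s) \<in> W"
      proof eventually_elim
        case (elim s)
        show ?case
        proof (cases "s < n")
          case True
          then have "frac s = s - (n - 1)" using n(1) elim by (subst frac_unique_iff) auto
          then show ?thesis using e2 elim n True \<open>t = n\<close> by (auto simp: dist_real_def)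
        next
          case False
          then have "frac s = s - n" using n(1) elim by (subst frac_unique_iff) auto
          then show ?thesis using e1' elim n False \<open>t = n\<close> by (auto simp: dist_real_def)
        qed
      qed
      then show ?thesis by (simp add: eventually_at_filter eventually_mono)
    qed
  qed
  then show ?thesis by (simp add: closed_curve_def frac_1_eq)
qed

context riemann_surface_form
begin

text \<open>Along a path a primitive changes like any local primitive, not only like those that witness the
  definition. In this form, primitives along two paths can be compared and joined.\<close>

lemma primitive_alongD:
  assumes f: "primitive_along X A \<eta> \<gamma> f" and \<gamma>: "pathin X \<gamma>" and t: "t \<in> {0..1}"
    and F: "local_primitive X A \<eta> U F" "\<gamma> t \<in> U"
  obtains e where "e > 0"
    "\<And>s. \<lbrakk>s \<in> {0..1}; \<bar>s - t\<bar> < e\<rbrakk> \<Longrightarrow> \<gamma> s \<in> U \<and> f s - f t = F (\<gamma> s) - F (\<gamma> t)"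
proof -
  obtain U' F' e where F': "e > 0" "local_primitive X A \<eta> U' F'"
    "\<And>s. \<lbrakk>s \<in> {0..1}; \<bar>s - t\<bar> < e\<rbrakk> \<Longrightarrow> \<gamma> s \<in> U' \<and> f s = F' (\<gamma> s)"
    using f t unfolding primitive_along_def by meson
  then have "\<gamma> t \<in> U'" using t by simp
  then obtain V where V: "openin X V" "\<gamma> t \<in> V" "V \<subseteq> U \<inter> U'"
    "\<And>y. y \<in> V \<Longrightarrow> F y - F' y = F (\<gamma> t) - F' (\<gamma> t)"
    using local_primitives_differ_by_const[OF F(1) F'(2) F(2)] by blast
  have "\<forall>\<^sub>F s in at t within {0..1}. \<gamma> s \<in> V"
    using continuous_map_eventually_in_openin[OF \<gamma>[unfolded pathin_def] t V(1,2)] .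
  then obtain e' where e': "e' > 0" "\<And>s. \<lbrakk>s \<in> {0..1}; s \<noteq> t; \<bar>s - t\<bar> < e'\<rbrakk> \<Longrightarrow> \<gamma> s \<in> V"
    unfolding eventually_at dist_real_def by blast
  show ?thesis
  proof (rule that[of "min e e'"])
    fix s assume s: "s \<in> {0..1}" "\<bar>s - t\<bar> < min e e'"
    then have "\<gamma> s \<in> V" using e' V by (cases "s = t") auto
    then show "\<gamma> s \<in> U \<and> f s - f t = F (\<gamma> s) - F (\<gamma> t)"
      using V(4)[of "\<gamma> s"] V(3) F'(3)[of s] F'(3)[of t] F'(1) s t by (auto simp: algebra_simps)
  qed (use F' e' in auto)
qed

lemma primitive_alongI:
  assumes \<gamma>: "pathin X \<gamma>"
    and f: "\<And>t U F. \<lbrakk>t \<in> {0..1}; local_primitive X A \<eta> U F; \<gamma> t \<in> U\<rbrakk> \<Longrightarrow>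
        \<exists>e>0. \<forall>s\<in>{0..1}. \<bar>s - t\<bar> < e \<longrightarrow> \<gamma> s \<in> U \<and> f s - f t = F (\<gamma> s) - F (\<gamma> t)"
  shows "primitive_along X A \<eta> \<gamma> f"
  unfolding primitive_along_def
proof
  fix t :: real assume t: "t \<in> {0..1}"
  then have "\<gamma> t \<in> topspace X"
    using \<gamma> by (auto simp: pathin_def continuous_map image_subset_iff)
  then obtain U F where F: "local_primitive X A \<eta> U F" "\<gamma> t \<in> U"
    using local_primitive_exists by metis
  then obtain e where e: "e > 0" 
    "\<And>s. s\<in>{0..1} \<Longrightarrow> \<bar>s - t\<bar> < e \<Longrightarrow> \<gamma> s \<in> U \<and> f s - f t = F (\<gamma> s) - F (\<gamma> t)"
    using f[OF t] by metis
  show "\<exists>U F e. e > 0 \<and> local_primitive X A \<eta> U F \<and>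
          (\<forall>s\<in>{0..1}. \<bar>s - t\<bar> < e \<longrightarrow> \<gamma> s \<in> U \<and> f s = F (\<gamma> s))"
    using e local_primitive_add_const[OF F(1), of "f t - F (\<gamma> t)"]
    by (intro exI[of _ U] exI[of _ "\<lambda>x. F x + (f t - F (\<gamma> t))"] exI[of _ e]) (force simp: algebra_simps)
qed

lemma primitive_along_unique:
  assumes \<gamma>: "pathin X \<gamma>" and f: "primitive_along X A \<eta> \<gamma> f" and g: "primitive_along X A \<eta> \<gamma> g"
  shows "f 1 - f 0 = g 1 - g 0"
proof -
  have "(\<lambda>t. f t - g t) 0 = (\<lambda>t. f t - g t) 1"
  proof (rule connected_local_const[of "{0..1::real}"])
    show "\<forall>t\<in>{0..1}. \<forall>\<^sub>F s in at t within {0..1}. f t - g t = f s - g s"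
    proof
      fix t :: real assume t: "t \<in> {0..1}"
      then have "\<gamma> t \<in> topspace X"
        using \<gamma> by (auto simp: pathin_def continuous_map image_subset_iff)
      then obtain U F where F: "local_primitive X A \<eta> U F" "\<gamma> t \<in> U"
        using local_primitive_exists by metis
      obtain e where e: "e > 0"
        "\<And>s. \<lbrakk>s \<in> {0..1}; \<bar>s - t\<bar> < e\<rbrakk> \<Longrightarrow> \<gamma> s \<in> U \<and> f s - f t = F (\<gamma> s) - F (\<gamma> t)"
        using primitive_alongD[OF f \<gamma> t F] by blast
      obtain e' where e': "e' > 0"
        "\<And>s. \<lbrakk>s \<in> {0..1}; \<bar>s - t\<bar> < e'\<rbrakk> \<Longrightarrow> \<gamma> s \<in> U \<and> g s - g t = F (\<gamma> s) - F (\<gamma> t)"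
        using primitive_alongD[OF g \<gamma> t F] by blast
      show "\<forall>\<^sub>F s in at t within {0..1}. f t - g t = f s - g s"
        unfolding eventually_at
      proof (intro exI[of _ "min e e'"] conjI ballI impI)
        fix s assume "s \<in> {0..1}" "s \<noteq> t \<and> dist s t < min e e'"
        then have "f s - f t = g s - g t"
          using e(2)[of s] e'(2)[of s] by (auto simp: dist_real_def)
        then show "f t - g t = f s - g s"
          by (simp add: algebra_simps)
      qed (use e e' in auto)
    qed
  qed auto
  then show ?thesis by (simp add: algebra_simps)
qed

lemma path_integral_form_eq:
  assumes "pathin X \<gamma>" "primitive_along X A \<eta> \<gamma> f"
  shows "path_integral_form X A \<eta> \<gamma> = f 1 - f 0"
  unfolding path_integral_form_def
  using assms primitive_along_unique by (intro the_equality) blast+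

lemma primitive_along_reverse:
  assumes \<gamma>: "pathin X \<gamma>" and f: "primitive_along X A \<eta> \<gamma> f"
  shows "primitive_along X A \<eta> (\<lambda>t. \<gamma> (1 - t)) (\<lambda>t. f (1 - t))"
proof (rule primitive_alongI)
  fix t U F assume t: "t \<in> {0..1::real}" and F: "local_primitive X A \<eta> U F" "\<gamma> (1 - t) \<in> U"
  have "1 - t \<in> {0..1}" using t by simp
  from primitive_alongD[OF f \<gamma> this F] obtain e where e: "e > 0"
    "\<And>s. \<lbrakk>s \<in> {0..1}; \<bar>s - (1 - t)\<bar> < e\<rbrakk> \<Longrightarrow> \<gamma> s \<in> U \<and> f s - f (1 - t) = F (\<gamma> s) - F (\<gamma> (1 - t))"
    by metis
  have "\<gamma> (1 - s) \<in> U \<and> f (1 - s) - f (1 - t) = F (\<gamma> (1 - s)) - F (\<gamma> (1 - t))"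
    if "s \<in> {0..1}" "\<bar>s - t\<bar> < e" for s
    by (rule e(2)) (use that in auto)
  then show "\<exists>e>0. \<forall>s\<in>{0..1}. \<bar>s - t\<bar> < e \<longrightarrow>
      \<gamma> (1 - s) \<in> U \<and> f (1 - s) - f (1 - t) = F (\<gamma> (1 - s)) - F (\<gamma> (1 - t))"
    using e(1) by blast
qed (rule pathin_reverse[OF \<gamma>])

text \<open>The second primitive is shifted to agree with the first one at the common end point.\<close>

lemma primitive_along_join:
  assumes \<gamma>1: "pathin X \<gamma>1" and f1: "primitive_along X A \<eta> \<gamma>1 f1"
    and \<gamma>2: "pathin X \<gamma>2" and f2: "primitive_along X A \<eta> \<gamma>2 f2"
    and join: "\<gamma>1 1 = \<gamma>2 0"
  shows "primitive_along X A \<eta> (\<lambda>t. if t \<le> 1/2 then \<gamma>1 (2 * t) else \<gamma>2 (2 * t - 1))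
           (\<lambda>t. if t \<le> 1/2 then f1 (2 * t) else f2 (2 * t - 1) + (f1 1 - f2 0))"
    (is "primitive_along X A \<eta> ?\<gamma> ?f")
proof (rule primitive_alongI)
  fix t U F assume t: "t \<in> {0..1::real}" and F: "local_primitive X A \<eta> U F" and U: "?\<gamma> t \<in> U"
  have \<gamma>: "?\<gamma> s = \<gamma>2 (2 * s - 1)" "?f s = f2 (2 * s - 1) + (f1 1 - f2 0)" if "s \<ge> 1/2" for s
  proof -
    have "2 * s = 1" if "s \<le> 1/2" using that \<open>s \<ge> 1/2\<close> by simp
    then show "?\<gamma> s = \<gamma>2 (2 * s - 1)" "?f s = f2 (2 * s - 1) + (f1 1 - f2 0)" using join by auto
  qed
  have "\<exists>e>0. \<forall>s\<in>{0..1/2}. \<bar>s - t\<bar> < e \<longrightarrow> ?\<gamma> s \<in> U \<and> ?f s - ?f t = F (?\<gamma> s) - F (?\<gamma> t)"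
  proof (cases "t \<le> 1/2")
    case True
    then have "2 * t \<in> {0..1}" "\<gamma>1 (2 * t) \<in> U" using t U by auto
    from primitive_alongD[OF f1 \<gamma>1 this(1) F this(2)] obtain e where e: "e > 0"
      "\<And>s. \<lbrakk>s \<in> {0..1}; \<bar>s - 2 * t\<bar> < e\<rbrakk> \<Longrightarrow> \<gamma>1 s \<in> U \<and> f1 s - f1 (2 * t) = F (\<gamma>1 s) - F (\<gamma>1 (2 * t))"
      by metis
    have "?\<gamma> s \<in> U \<and> ?f s - ?f t = F (?\<gamma> s) - F (?\<gamma> t)" if "s \<in> {0..1/2}" "\<bar>s - t\<bar> < e / 2" for s
    proof -
      have "\<bar>2 * s - 2 * t\<bar> < e" using that(2) by (simp add: abs_if split: if_splits)
      then show ?thesis using e(2)[of "2 * s"] that True by simp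
    qed
    then show ?thesis using e(1) by (intro exI[of _ "e/2"]) auto
  qed (auto intro!: exI[of _ "t - 1/2"])
  moreover have "\<exists>e>0. \<forall>s\<in>{1/2..1}. \<bar>s - t\<bar> < e \<longrightarrow> ?\<gamma> s \<in> U \<and> ?f s - ?f t = F (?\<gamma> s) - F (?\<gamma> t)"
  proof (cases "t \<ge> 1/2")
    case True
    then have "2 * t - 1 \<in> {0..1}" "\<gamma>2 (2 * t - 1) \<in> U" using t U \<gamma>[of t] by auto
    from primitive_alongD[OF f2 \<gamma>2 this(1) F this(2)] obtain e where e: "e > 0"
      "\<And>s. \<lbrakk>s \<in> {0..1}; \<bar>s - (2 * t - 1)\<bar> < e\<rbrakk> \<Longrightarrow>
         \<gamma>2 s \<in> U \<and> f2 s - f2 (2 * t - 1) = F (\<gamma>2 s) - F (\<gamma>2 (2 * t - 1))"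
      by metis
    have "?\<gamma> s \<in> U \<and> ?f s - ?f t = F (?\<gamma> s) - F (?\<gamma> t)" if "s \<in> {1/2..1}" "\<bar>s - t\<bar> < e / 2" for s
    proof -
      have "s \<ge> 1/2" using that by auto
      show ?thesis
        unfolding \<gamma>[OF True] \<gamma>[OF \<open>s \<ge> 1/2\<close>] using e(2)[of "2 * s - 1"] that
        by (simp add: abs_if split: if_splits)
    qed
    then show ?thesis using e(1) by (intro exI[of _ "e/2"]) auto
  qed (auto intro!: exI[of _ "1/2 - t"])
  ultimately obtain e1 e2 where e: "e1 > 0" "e2 > 0"
    "\<And>s. s\<in>{0..1/2} \<Longrightarrow> \<bar>s - t\<bar> < e1 \<Longrightarrow> ?\<gamma> s \<in> U \<and> ?f s - ?f t = F (?\<gamma> s) - F (?\<gamma> t)"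
    "\<And>s. s\<in>{1/2..1} \<Longrightarrow> \<bar>s - t\<bar> < e2 \<Longrightarrow> ?\<gamma> s \<in> U \<and> ?f s - ?f t = F (?\<gamma> s) - F (?\<gamma> t)"
    by metis
  show "\<exists>e>0. \<forall>s\<in>{0..1}. \<bar>s - t\<bar> < e \<longrightarrow> ?\<gamma> s \<in> U \<and> ?f s - ?f t = F (?\<gamma> s) - F (?\<gamma> t)"
  proof (intro exI[of _ "min e1 e2"] conjI ballI impI)
    fix s assume s: "s \<in> {0..1}" "\<bar>s - t\<bar> < min e1 e2"
    show "?\<gamma> s \<in> U" "?f s - ?f t = F (?\<gamma> s) - F (?\<gamma> t)"
      using e(3)[of s] e(4)[of s] s by (cases "s \<le> 1/2"; force)+
  qed (use e in auto)
qed (rule pathin_join[OF \<gamma>1 \<gamma>2 join])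

lemma primitive_along_in_primitive_domain:
  assumes F: "local_primitive X A \<eta> U F" and \<gamma>: "\<gamma> \<in> {0..1} \<rightarrow> U"
  shows "primitive_along X A \<eta> \<gamma> (F \<circ> \<gamma>)"
  unfolding primitive_along_def using assms by (auto intro!: exI[of _ U] exI[of _ F] exI[of _ 1])

text \<open>Height stands for \<open>Im \<integral> \<eta>\<close>. It is determined by a path, but by its end points only up to periods;
  therefore its change is a relation between the points.\<close>

definition height_change :: "'a set \<Rightarrow> 'a \<Rightarrow> 'a \<Rightarrow> real \<Rightarrow> bool" where
  "height_change Y x y k \<longleftrightarrow>
     (\<exists>\<gamma> f. pathin X \<gamma> \<and> \<gamma> \<in> {0..1} \<rightarrow> Y \<and> primitive_along X A \<eta> \<gamma> f \<and>
        \<gamma> 0 = x \<and> \<gamma> 1 = y \<and> k = Im (f 1 - f 0))"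

lemma height_change_sym: "height_change Y x y k \<Longrightarrow> height_change Y y x (- k)"
  unfolding height_change_def
proof (elim exE conjE)
  fix \<gamma> f assume *: "pathin X \<gamma>" "\<gamma> \<in> {0..1} \<rightarrow> Y" "primitive_along X A \<eta> \<gamma> f"
    "\<gamma> 0 = x" "\<gamma> 1 = y" "k = Im (f 1 - f 0)"
  show "\<exists>\<gamma> f. pathin X \<gamma> \<and> \<gamma> \<in> {0..1} \<rightarrow> Y \<and> primitive_along X A \<eta> \<gamma> f \<and>
      \<gamma> 0 = y \<and> \<gamma> 1 = x \<and> - k = Im (f 1 - f 0)"
    using * pathin_reverse[OF *(1)] primitive_along_reverse[OF *(1,3)]
    by (intro exI[of _ "\<lambda>t. \<gamma> (1 - t)"] exI[of _ "\<lambda>t. f (1 - t)"]) auto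
qed

lemma height_change_trans:
  assumes "height_change Y x y k" "height_change Y y z l"
  shows "height_change Y x z (k + l)"
proof -
  obtain \<gamma>1 f1 where 1: "pathin X \<gamma>1" "\<gamma>1 \<in> {0..1} \<rightarrow> Y" "primitive_along X A \<eta> \<gamma>1 f1"
    "\<gamma>1 0 = x" "\<gamma>1 1 = y" "k = Im (f1 1 - f1 0)"
    using assms(1) unfolding height_change_def by blast
  obtain \<gamma>2 f2 where 2: "pathin X \<gamma>2" "\<gamma>2 \<in> {0..1} \<rightarrow> Y" "primitive_along X A \<eta> \<gamma>2 f2"
    "\<gamma>2 0 = y" "\<gamma>2 1 = z" "l = Im (f2 1 - f2 0)"
    using assms(2) unfolding height_change_def by blast
  have j: "\<gamma>1 1 = \<gamma>2 0" using 1 2 by simp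
  show ?thesis
    unfolding height_change_def
    by (intro exI conjI)
      (rule pathin_join[OF 1(1) 2(1) j], use 1 2 in \<open>force simp: Pi_iff\<close>,
       rule primitive_along_join[OF 1(1) 1(3) 2(1) 2(3) j], use 1 2 in auto)
qed

lemma height_change_in_primitive_domain:
  assumes "local_primitive X A \<eta> U F" "pathin X \<gamma>" "\<gamma> \<in> {0..1} \<rightarrow> U \<inter> Y" "\<gamma> 0 = x" "\<gamma> 1 = y"
  shows "height_change Y x y (Im (F y) - Im (F x))"
  unfolding height_change_def
  using assms primitive_along_in_primitive_domain[OF assms(1), of \<gamma>]
  by (intro exI[of _ \<gamma>] exI[of _ "F \<circ> \<gamma>"]) auto

text \<open>Choose a base point in each path component of \<open>Y\<close> and integrate from it; as loops do not change
  the height, the result does not depend on the path.\<close>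

lemma potential_exists:
  assumes loops: "\<And>x k. height_change Y x x k \<Longrightarrow> k = 0"
  obtains h where "\<And>x y k. height_change Y x y k \<Longrightarrow> h y - h x = k"
proof -
  define base where "base x = (SOME b. \<exists>k. height_change Y b x k)" for x
  define h where "h x = (SOME k. height_change Y (base x) x k)" for x
  have "h y - h x = k" if xy: "height_change Y x y k" for x y k
  proof -
    have "(\<exists>k. height_change Y b x k) \<longleftrightarrow> (\<exists>k. height_change Y b y k)" for b
      using xy height_change_trans height_change_sym by blast
    then have "base x = base y" by (simp add: base_def)
    moreover have "\<exists>k. height_change Y (base y) y k"
      unfolding base_def by (rule someI[of _ x]) (use xy in blast)
    then have "height_change Y (base y) y (h y)"
      unfolding h_def by (rule someI_ex)
    moreover have "\<exists>k. height_change Y (base x) x k"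
      unfolding base_def by (rule someI[of _ y]) (use xy height_change_sym in blast)
    then have "height_change Y (base x) x (h x)"
      unfolding h_def by (rule someI_ex)
    ultimately have "height_change Y (base x) (base x) (h x + k + - h y)"
      using xy height_change_trans height_change_sym by metis
    then show ?thesis using loops by fastforce
  qed
  then show ?thesis by (rule that)
qed

end

section \<open>Zeros and flow boxes\<close>

lemma filterlim_of_real_diff: 
  "filterlim (\<lambda>s. complex_of_real (s - t)) (nhds 0) (nhds t)"
  by (rule tendsto_eq_intros refl filterlim_ident | simp)+

context riemann_surface_form
begin

lemma zeros_iff:
  assumes "c \<in> A" "x \<in> cdom c"
  shows "x \<in> zeros A \<eta> \<longleftrightarrow> \<eta> c (coord c x) = 0"
  unfolding zeros_def using assms coefficient_transition[OF assms(1)] by fastforce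

lemma openin_diff_zeros: "openin X (topspace X - zeros A \<eta>)"
proof (subst openin_subopen, intro ballI)
  fix x assume x: "x \<in> topspace X - zeros A \<eta>"
  then obtain c where c: "c \<in> A" "x \<in> cdom c" using chart_at by blast
  have "open (coord c ` cdom c \<inter> \<eta> c -` (- {0}))"
    using coefficient_holomorphic open_coord_cdom c
    by (intro continuous_open_preimage holomorphic_on_imp_continuous_on) auto
  note openin_coord_preimage[OF c(1) this]
  moreover have "x \<in> {y \<in> cdom c. coord c y \<in> coord c ` cdom c \<inter> \<eta> c -` (- {0})}"
    using x c zeros_iff by auto
  moreover have "{y \<in> cdom c. coord c y \<in> coord c ` cdom c \<inter> \<eta> c -` (- {0})} \<subseteq> topspace X - zeros A \<eta>"
    using cdom_subset[OF c(1)] zeros_iff[OF c(1)] by auto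
  ultimately show "\<exists>T. openin X T \<and> x \<in> T \<and> T \<subseteq> topspace X - zeros A \<eta>" by blast
qed

text \<open>Carrying the inverse \<open>G\<close> of the coordinate \<open>f\<close> along makes discs in the surface images of discs in the
  plane. The last condition says that \<open>G\<close> is a homeomorphism onto an open set.\<close>

definition disc_coordinate :: "('a \<Rightarrow> complex) \<Rightarrow> (complex \<Rightarrow> 'a) \<Rightarrow> real \<Rightarrow> bool" where
  "disc_coordinate f G r \<longleftrightarrow> 0 < r \<and> continuous_map (top_of_set (ball 0 r)) X G \<and>
     (\<forall>z\<in>ball 0 r. f (G z) = z) \<and> (\<forall>B. open B \<longrightarrow> B \<subseteq> ball 0 r \<longrightarrow> openin X (G ` B))"

lemma disc_coordinate_eventually:
  assumes "disc_coordinate f G r" "openin X W" "G 0 \<in> W"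
  shows "\<forall>\<^sub>F z in nhds 0. z \<in> ball 0 r \<and> G z \<in> W"
proof -
  have "\<forall>\<^sub>F z in nhds (0::complex). z \<in> ball 0 r"
    using assms(1) by (intro eventually_nhds_in_open) (auto simp: disc_coordinate_def)
  moreover have "\<forall>\<^sub>F z in nhds 0. G z \<in> W"
    using assms by (intro eventually_nhds_in_openin[of "ball 0 r"]) (auto simp: disc_coordinate_def)
  ultimately show ?thesis by eventually_elim simp
qed

lemma disc_coordinate_mono:
  "\<lbrakk>disc_coordinate f G r; 0 < s; s \<le> r\<rbrakk> \<Longrightarrow> disc_coordinate f G s"
  unfolding disc_coordinate_def
  by (meson continuous_map_from_subtopology_mono order_trans subset_ball subsetD)

lemma disc_coordinate_shrink:
  assumes "disc_coordinate f G r" "openin X W" "G 0 \<in> W"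
  obtains s where "0 < s" "s \<le> r" "disc_coordinate f G s" "G ` ball 0 s \<subseteq> W"
proof -
  obtain e where e: "e > 0" "\<And>z. dist z 0 < e \<Longrightarrow> G z \<in> W"
    using disc_coordinate_eventually[OF assms] unfolding eventually_nhds_metric by blast
  have "r > 0" using assms(1) by (simp add: disc_coordinate_def)
  show ?thesis
    using e \<open>r > 0\<close> by (intro that[of "min e r"] disc_coordinate_mono[OF assms(1)]) (auto simp: dist_commute)
qed

text \<open>The inverse function theorem for \<open>\<phi>\<close>, transported to the surface by the chart.\<close>

lemma disc_coordinate_exists:
  assumes c: "c \<in> A" "p \<in> cdom c" and W: "openin X W" "p \<in> W"
    and \<phi>: "\<phi> holomorphic_on S" "open S" "coord c p \<in> S"
    and deriv: "deriv \<phi> (coord c p) \<noteq> 0" and "\<phi> (coord c p) = 0"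
  obtains G r where "disc_coordinate (\<phi> \<circ> coord c) G r" "G 0 = p" "G ` ball 0 r \<subseteq> W \<inter> cdom c"
proof -
  let ?S = "S \<inter> coord c ` (W \<inter> cdom c)"
  have "open ?S"
    using c W \<phi> by (intro open_Int open_coord_image openin_Int openin_cdom) auto
  moreover have "\<phi> holomorphic_on ?S" "coord c p \<in> ?S"
    using \<phi> c W by (auto intro: holomorphic_on_subset)
  ultimately obtain \<rho> where \<rho>: "\<rho> > 0" "ball (coord c p) \<rho> \<subseteq> ?S" "inj_on \<phi> (ball (coord c p) \<rho>)"
    using has_complex_derivative_locally_injective deriv by metis
  let ?B = "ball (coord c p) \<rho>"
  have hol: "\<phi> holomorphic_on ?B" using \<phi>(1) \<rho>(2) holomorphic_on_subset by blast
  obtain g where g: "g holomorphic_on \<phi> ` ?B" "\<And>z. z \<in> ?B \<Longrightarrow> g (\<phi> z) = z"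
    using holomorphic_has_inverse[OF hol open_ball \<rho>(3)] by metis
  have "open (\<phi> ` ?B)" using open_mapping_thm3[OF hol open_ball \<rho>(3)] .
  moreover have "0 \<in> \<phi> ` ?B" using assms(9) \<rho>(1) by (auto intro!: image_eqI[of _ _ "coord c p"])
  ultimately obtain r where r: "r > 0" "ball 0 r \<subseteq> \<phi> ` ?B" using openE by blast
  let ?G = "cinv c \<circ> g"
  have g_ball: "g z \<in> ?B" "\<phi> (g z) = z" if "z \<in> ball 0 r" for z
    using r(2) g(2) that by auto
  have G: "?G z \<in> W \<inter> cdom c" "coord c (?G z) = g z" if z: "z \<in> ball 0 r" for z
  proof -
    have "g z \<in> coord c ` (W \<inter> cdom c)" using g_ball(1)[OF z] \<rho>(2) by blast
    then show "?G z \<in> W \<inter> cdom c" "coord c (?G z) = g z" using c by auto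
  qed
  have "disc_coordinate (\<phi> \<circ> coord c) ?G r"
    unfolding disc_coordinate_def
  proof (intro conjI allI impI ballI)
    have "continuous_map (top_of_set (ball 0 r)) (top_of_set (coord c ` cdom c)) g"
      unfolding continuous_map_in_subtopology
      using holomorphic_on_imp_continuous_on[OF holomorphic_on_subset[OF g(1) r(2)]] G
      by (auto simp: image_subset_iff) (metis G(1,2) IntD2 image_eqI mem_ball_0 comp_apply)
    then show "continuous_map (top_of_set (ball 0 r)) X ?G"
      using continuous_map_cinv[OF c(1)] by (rule continuous_map_compose)
    fix B :: "complex set" assume B: "open B" "B \<subseteq> ball 0 r"
    have "open (?B \<inter> \<phi> -` B)"
      using B hol by (intro continuous_open_preimage holomorphic_on_imp_continuous_on) auto
    moreover have "?G ` B = {x \<in> cdom c. coord c x \<in> ?B \<inter> \<phi> -` B}"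
    proof (intro equalityI subsetI)
      fix x assume x: "x \<in> {x \<in> cdom c. coord c x \<in> ?B \<inter> \<phi> -` B}"
      then have "x = ?G (\<phi> (coord c x))" using g(2) c by simp
      then show "x \<in> ?G ` B" using x by blast
    next
      fix x assume "x \<in> ?G ` B"
      then obtain z where "z \<in> B" "x = ?G z" by blast
      moreover have "z \<in> ball 0 r" using B(2) \<open>z \<in> B\<close> by blast
      ultimately show "x \<in> {x \<in> cdom c. coord c x \<in> ?B \<inter> \<phi> -` B}"
        using G[of z] g_ball[of z] by simp
    qed
    ultimately show "openin X (?G ` B)" using openin_coord_preimage[OF c(1), of "?B \<inter> \<phi> -` B"] by metis
  next
    fix z :: complex assume "z \<in> ball 0 r"
    then show "(\<phi> \<circ> coord c) (?G z) = z" using G g_ball by simp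
  qed (use r in auto)
  moreover have "g 0 = coord c p"
    using g(2)[of "coord c p"] assms(9) \<rho>(1) by simp
  ultimately show ?thesis
    using that[of ?G r] G(1) c by (simp add: image_subset_iff)
qed

text \<open>A disc in the natural coordinate \<open>w = \<integral> \<eta>\<close>, in which \<open>\<eta> = dw\<close> and the leaves are horizontal.\<close>

definition flow_box :: "('a \<Rightarrow> complex) \<Rightarrow> (complex \<Rightarrow> 'a) \<Rightarrow> real \<Rightarrow> bool" where
  "flow_box F G r \<longleftrightarrow> disc_coordinate F G r \<and> local_primitive X A \<eta> (G ` ball 0 r) F \<and>
     G ` ball 0 r \<inter> zeros A \<eta> = {}"

lemma disc_coordinate_cong:
  assumes "disc_coordinate f G r" "\<And>z. z \<in> ball 0 r \<Longrightarrow> f' (G z) = f (G z)"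
  shows "disc_coordinate f' G r"
  using assms unfolding disc_coordinate_def by auto

text \<open>Off the zeros a primitive of \<open>\<eta>\<close> has nonzero derivative in every chart.\<close>

lemma flow_box_exists:
  assumes p: "p \<notin> zeros A \<eta>" and F: "local_primitive X A \<eta> U F" and "p \<in> U"
  obtains G r where "flow_box (\<lambda>x. F x - F p) G r" "G 0 = p" "G ` ball 0 r \<subseteq> U"
proof -
  have U: "openin X U" "U \<subseteq> topspace X"
    using local_primitive_openin[OF F] openin_subset by blast+
  then obtain c where c: "c \<in> A" "p \<in> cdom c" using \<open>p \<in> U\<close> chart_at by blast
  let ?W = "U \<inter> (topspace X - zeros A \<eta>)"
  have W: "openin X ?W" "p \<in> ?W"
    using U openin_diff_zeros p \<open>p \<in> U\<close> by auto
  let ?\<phi> = "\<lambda>z. (F \<circ> cinv c) z - F p" and ?S = "coord c ` (?W \<inter> cdom c)"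
  have S: "open ?S" using c by (intro open_coord_image openin_Int[OF W(1)] openin_cdom) auto
  have der: "(?\<phi> has_field_derivative \<eta> c z - 0) (at z)" if "z \<in> ?S" for z
  proof -
    obtain y where y: "z = coord c y" "y \<in> U" "y \<in> cdom c" using \<open>z \<in> ?S\<close> by blast
    show ?thesis
      unfolding y(1) by (intro DERIV_diff DERIV_const local_primitiveD[OF F c(1)] y(2,3))
  qed
  have hol: "?\<phi> holomorphic_on ?S"
    using der unfolding holomorphic_on_def field_differentiable_def
    by (meson has_field_derivative_at_within)
  have "coord c p \<in> ?S" using W c by auto
  moreover have "deriv ?\<phi> (coord c p) \<noteq> 0"
    using DERIV_imp_deriv[OF der[OF calculation]] zeros_iff[OF c] p by simp
  ultimately obtain G r where G: "disc_coordinate (?\<phi> \<circ> coord c) G r" "G 0 = p" "G ` ball 0 r \<subseteq> ?W \<inter> cdom c"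
    using disc_coordinate_exists[OF c W hol S] c by (metis (no_types, lifting) cinv_coord comp_apply diff_self)
  have "disc_coordinate (\<lambda>x. F x - F p) G r"
    by (rule disc_coordinate_cong[OF G(1)]) (use G(3) c in force)
  moreover have "openin X (G ` ball 0 r)" using G(1) by (simp add: disc_coordinate_def)
  then have "local_primitive X A \<eta> (G ` ball 0 r) (\<lambda>x. F x - F p)"
    using local_primitive_subset[OF local_primitive_add_const[OF F, of "- F p"]] G(3) by auto
  ultimately have "flow_box (\<lambda>x. F x - F p) G r"
    using G(3) by (auto simp: flow_box_def)
  with G show ?thesis by (intro that[of G r]) auto
qed

lemma flow_box_disc: "flow_box F G r \<Longrightarrow> disc_coordinate F G r"
  by (simp add: flow_box_def)

lemma flow_box_pos: "flow_box F G r \<Longrightarrow> r > 0"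
  by (simp add: flow_box_def disc_coordinate_def)

lemma flow_box_inverse: "\<lbrakk>flow_box F G r; z \<in> ball 0 r\<rbrakk> \<Longrightarrow> F (G z) = z"
  by (simp add: flow_box_def disc_coordinate_def)

lemma flow_box_primitive: "flow_box F G r \<Longrightarrow> local_primitive X A \<eta> (G ` ball 0 r) F"
  by (simp add: flow_box_def)

lemma flow_box_eventually:
  assumes "flow_box F G r" "openin X W" "G 0 \<in> W"
  shows "\<forall>\<^sub>F s in nhds t. of_real (s - t) \<in> ball (0::complex) r \<and> G (of_real (s - t)) \<in> W"
  using eventually_compose_filterlim[OF 
      disc_coordinate_eventually[OF flow_box_disc[OF assms(1)] assms(2,3)] filterlim_of_real_diff] .

lemma flow_box_recentre:
  assumes "flow_box F G r" and w: "w \<in> ball 0 r"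
  shows "flow_box (\<lambda>x. F x - w) (\<lambda>z. G (w + z)) (r - norm w)"
proof -
  let ?B = "ball 0 (r - norm w)"
  have sub: "w + z \<in> ball 0 r" if "z \<in> ?B" for z
    using that norm_triangle_ineq[of w z] by simp
  have *: "disc_coordinate (\<lambda>x. F x - w) (\<lambda>z. G (w + z)) (r - norm w)"
    unfolding disc_coordinate_def
  proof (intro conjI allI impI ballI)
    have "continuous_map (top_of_set ?B) (top_of_set (ball 0 r)) (\<lambda>z. w + z)"
      using sub by (auto simp: continuous_map_in_subtopology intro!: continuous_intros)
    moreover have "continuous_map (top_of_set (ball 0 r)) X G"
      using assms by (simp add: flow_box_def disc_coordinate_def)
    ultimately have "continuous_map (top_of_set ?B) X (G \<circ> (\<lambda>z. w + z))"
      by (rule continuous_map_compose)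
    then show "continuous_map (top_of_set ?B) X (\<lambda>z. G (w + z))" by (simp add: o_def)
    fix B :: "complex set" assume B: "open B" "B \<subseteq> ?B"
    have "open ((\<lambda>z. w + z) ` B)" "(\<lambda>z. w + z) ` B \<subseteq> ball 0 r"
      using B sub by (auto intro: open_translation)
    then have "openin X (G ` ((\<lambda>z. w + z) ` B))"
      using assms unfolding flow_box_def disc_coordinate_def by blast
    then show "openin X ((\<lambda>z. G (w + z)) ` B)" by (simp add: image_image)
  qed (use w flow_box_inverse[OF assms(1) sub] in auto)
  have im: "(\<lambda>z. G (w + z)) ` ?B \<subseteq> G ` ball 0 r" using sub by blast
  have "openin X ((\<lambda>z. G (w + z)) ` ?B)" using * by (simp add: disc_coordinate_def)
  then have "local_primitive X A \<eta> ((\<lambda>z. G (w + z)) ` ?B) (\<lambda>x. F x + (- w))"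
    using im assms by (intro local_primitive_subset[OF local_primitive_add_const]) (auto simp: flow_box_def)
  then show ?thesis using * im assms by (auto simp: flow_box_def)
qed

text \<open>Two natural coordinates that vanish at the same point differ by a constant near it, so they
  coincide there, and so do their inverses.\<close>

lemma flow_box_germ:
  assumes 1: "flow_box F1 G1 r1" and 2: "flow_box F2 G2 r2" and eq: "G1 0 = G2 0"
  shows "\<forall>\<^sub>F z in nhds 0. G1 z = G2 z"
proof -
  have 0: "0 \<in> ball (0::complex) r1" "0 \<in> ball (0::complex) r2"
    using 1 2 by (auto simp: flow_box_def disc_coordinate_def)
  obtain V where V: "openin X V" "G2 0 \<in> V" "V \<subseteq> G1 ` ball 0 r1 \<inter> G2 ` ball 0 r2"
    "\<And>y. y \<in> V \<Longrightarrow> F1 y - F2 y = F1 (G2 0) - F2 (G2 0)"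
    using local_primitives_differ_by_const[OF flow_box_primitive[OF 1] flow_box_primitive[OF 2], of "G2 0"]
      0 eq by (metis image_eqI)
  have "F1 (G2 0) = 0" "F2 (G2 0) = 0"
    using flow_box_inverse[OF 1 0(1)] flow_box_inverse[OF 2 0(2)] eq by auto
  with V(4) have F: "F1 y = F2 y" if "y \<in> V" for y using that by force
  show ?thesis
    using disc_coordinate_eventually[OF flow_box_disc[OF 2] V(1,2)]
  proof eventually_elim
    case (elim z)
    then have "F1 (G2 z) = z" using F flow_box_inverse[OF 2] by metis
    moreover obtain w where "w \<in> ball 0 r1" "G2 z = G1 w" using elim V(3) by blast
    ultimately show ?case using flow_box_inverse[OF 1] by metis
  qed
qed

section \<open>Trajectories\<close>

text \<open>A trajectory moves with unit speed in natural coordinates, \<open>\<eta> \<gamma>' = 1\<close>. As the condition concerns only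
  the germ of \<open>\<gamma>\<close> at each time, trajectories can be glued.\<close>

definition trajectory :: "real set \<Rightarrow> (real \<Rightarrow> 'a) \<Rightarrow> bool" where
  "trajectory I \<gamma> \<longleftrightarrow> open I \<and> is_interval I \<and>
     (\<forall>t\<in>I. \<exists>F G r. flow_box F G r \<and> (\<forall>\<^sub>F s in nhds t. \<gamma> s = G (of_real (s - t))))"

lemma trajectory_flow_box:
  assumes "trajectory I \<gamma>" "t \<in> I" and F: "flow_box F G r" "G 0 = \<gamma> t"
  shows "\<forall>\<^sub>F s in nhds t. \<gamma> s = G (of_real (s - t))"
proof -
  obtain F' G' r' where F': "flow_box F' G' r'" and \<gamma>: "\<forall>\<^sub>F s in nhds t. \<gamma> s = G' (of_real (s - t))"
    using assms unfolding trajectory_def by blast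
  have "G' 0 = G 0" using eventually_nhds_x_imp_x[OF \<gamma>] F(2) by simp
  then have "\<forall>\<^sub>F s in nhds t. G' (of_real (s - t)) = G (of_real (s - t))"
    using eventually_compose_filterlim[OF flow_box_germ[OF F' F(1)] filterlim_of_real_diff] by simp
  with \<gamma> show ?thesis by eventually_elim simp
qed

lemma trajectory_avoids_zeros:
  assumes "trajectory I \<gamma>" "t \<in> I"
  shows "\<gamma> t \<in> topspace X - zeros A \<eta>"
proof -
  obtain F G r where F: "flow_box F G r" and \<gamma>: "\<forall>\<^sub>F s in nhds t. \<gamma> s = G (of_real (s - t))"
    using assms unfolding trajectory_def by blast
  have "\<gamma> t = G 0" using eventually_nhds_x_imp_x[OF \<gamma>] by simp
  moreover have "0 \<in> ball (0::complex) r" using flow_box_pos[OF F] by simp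
  moreover have "openin X (G ` ball 0 r)" using local_primitive_openin[OF flow_box_primitive[OF F]] .
  ultimately show ?thesis using F openin_subset unfolding flow_box_def by blast
qed

lemma trajectory_eventually_in:
  assumes \<gamma>: "trajectory I \<gamma>" "t \<in> I" and W: "openin X W" "\<gamma> t \<in> W"
  shows "\<forall>\<^sub>F s in nhds t. \<gamma> s \<in> W"
proof -
  obtain F G r where F: "flow_box F G r" and \<gamma>: "\<forall>\<^sub>F s in nhds t. \<gamma> s = G (of_real (s - t))"
    using \<gamma> unfolding trajectory_def by blast
  have "G 0 \<in> W" using eventually_nhds_x_imp_x[OF \<gamma>] W by simp
  from flow_box_eventually[OF F W(1) this, of t] \<gamma> show ?thesis by eventually_elim simp
qed

lemma trajectory_continuous:
  assumes "trajectory I \<gamma>"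
  shows "continuous_map (top_of_set I) X \<gamma>"
proof (rule continuous_map_from_eventually_in_openin)
  fix t W assume "t \<in> I" "openin X W" "\<gamma> t \<in> W"
  from trajectory_eventually_in[OF assms this] show "\<forall>\<^sub>F s in at t within I. \<gamma> s \<in> W"
    by (simp add: eventually_at_filter eventually_mono)
qed (use trajectory_avoids_zeros[OF assms] in blast)

text \<open>Two trajectories that meet at one time have the same germ there, while points at which they
  differ can be separated by open sets; so agreement is a locally constant property.\<close>

lemma trajectory_unique:
  assumes \<gamma>: "trajectory I \<gamma>" and \<delta>: "trajectory I' \<delta>"
    and "t0 \<in> I \<inter> I'" "\<gamma> t0 = \<delta> t0" "t \<in> I \<inter> I'"
  shows "\<gamma> t = \<delta> t"
proof -
  have "(\<gamma> t0 = \<delta> t0) = (\<gamma> t = \<delta> t)"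
  proof (rule connected_local_const[of "I \<inter> I'"])
    show "connected (I \<inter> I')"
      using \<gamma> \<delta> by (auto simp: trajectory_def is_interval_Int simp flip: is_interval_connected_1)
    show "\<forall>u\<in>I \<inter> I'. \<forall>\<^sub>F s in at u within I \<inter> I'. (\<gamma> u = \<delta> u) = (\<gamma> s = \<delta> s)"
    proof
      fix u assume u: "u \<in> I \<inter> I'"
      have "\<forall>\<^sub>F s in nhds u. (\<gamma> u = \<delta> u) = (\<gamma> s = \<delta> s)"
      proof (cases "\<gamma> u = \<delta> u")
        case True
        obtain F G r where F: "flow_box F G r" and G: "\<forall>\<^sub>F s in nhds u. \<gamma> s = G (of_real (s - u))"
          using \<gamma> u unfolding trajectory_def by blast
        have "G 0 = \<delta> u" using eventually_nhds_x_imp_x[OF G] True by simp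
        with trajectory_flow_box[OF \<delta> _ F] u have "\<forall>\<^sub>F s in nhds u. \<delta> s = G (of_real (s - u))" by blast
        with G show ?thesis by eventually_elim (use True in simp)
      next
        case False
        moreover have "\<gamma> u \<in> topspace X" "\<delta> u \<in> topspace X"
          using trajectory_avoids_zeros \<gamma> \<delta> u by blast+
        ultimately obtain V W where V: "openin X V" "openin X W" "\<gamma> u \<in> V" "\<delta> u \<in> W" "disjnt V W"
          using Hausdorff unfolding Hausdorff_space_def by metis
        have "\<forall>\<^sub>F s in nhds u. \<gamma> s \<in> V" "\<forall>\<^sub>F s in nhds u. \<delta> s \<in> W"
          using trajectory_eventually_in \<gamma> \<delta> V u by blast+
        then show ?thesis by eventually_elim (use V(5) False in \<open>auto simp: disjnt_iff\<close>)
      qed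
      then show "\<forall>\<^sub>F s in at u within I \<inter> I'. (\<gamma> u = \<delta> u) = (\<gamma> s = \<delta> s)"
        by (simp add: eventually_at_filter eventually_mono)
    qed
  qed (use assms in auto)
  with assms(4) show ?thesis by simp
qed

lemma trajectory_shift:
  assumes "trajectory I \<gamma>"
  shows "trajectory {t. t + a \<in> I} (\<lambda>t. \<gamma> (t + a))"
  unfolding trajectory_def
proof (intro conjI ballI)
  have eq: "{t. t + a \<in> I} = (\<lambda>t. t - a) ` I"
    by (auto intro!: image_eqI[of _ _ "_ + a"])
  show "open {t. t + a \<in> I}" "is_interval {t. t + a \<in> I}"
    using assms unfolding eq trajectory_def
    by (auto simp: open_translation_subtract)
  fix t assume "t \<in> {t. t + a \<in> I}"
  then obtain F G r where F: "flow_box F G r" and \<gamma>: "\<forall>\<^sub>F s in nhds (t + a). \<gamma> s = G (of_real (s - (t + a)))"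
    using assms unfolding trajectory_def by blast
  have "filterlim (\<lambda>s. s + a) (nhds (t + a)) (nhds t)"
    by (rule tendsto_eq_intros refl filterlim_ident)+
  from eventually_compose_filterlim[OF \<gamma> this] F
  show "\<exists>F G r. flow_box F G r \<and> (\<forall>\<^sub>F s in nhds t. \<gamma> (s + a) = G (of_real (s - t)))"
    by (intro exI[of _ F] exI[of _ G] exI[of _ r]) simp
qed

lemma trajectory_locally:
  assumes "open I" "is_interval I"
    and "\<And>t. t \<in> I \<Longrightarrow> \<exists>I' \<delta>. trajectory I' \<delta> \<and> t \<in> I' \<and> (\<forall>s\<in>I'. \<gamma> s = \<delta> s)"
  shows "trajectory I \<gamma>"
  unfolding trajectory_def
proof (intro conjI ballI assms(1,2))
  fix t assume "t \<in> I"
  then obtain I' \<delta> where \<delta>: "trajectory I' \<delta>" "t \<in> I'" "\<forall>s\<in>I'. \<gamma> s = \<delta> s"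
    using assms(3) by blast
  then obtain F G r where F: "flow_box F G r" and G: "\<forall>\<^sub>F s in nhds t. \<delta> s = G (of_real (s - t))"
    unfolding trajectory_def by blast
  have "\<forall>\<^sub>F s in nhds t. s \<in> I'"
    using \<delta> by (intro eventually_nhds_in_open) (auto simp: trajectory_def)
  with G have "\<forall>\<^sub>F s in nhds t. \<gamma> s = G (of_real (s - t))"
    by eventually_elim (use \<delta> in auto)
  with F show "\<exists>F G r. flow_box F G r \<and> (\<forall>\<^sub>F s in nhds t. \<gamma> s = G (of_real (s - t)))" by blast
qed

lemma trajectory_segment:
  assumes F: "flow_box F G r"
  shows "trajectory {t. w + of_real t \<in> ball 0 r} (\<lambda>t. G (w + of_real t))"
  unfolding trajectory_def
proof (intro conjI ballI)
  have eq: "{t. w + of_real t \<in> ball 0 r} = (\<lambda>t. w + complex_of_real t) -` ball 0 r" by auto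
  show "open {t. w + of_real t \<in> ball 0 r}"
    unfolding eq by (intro open_vimage continuous_intros open_ball)
  have "convex {t. w + of_real t \<in> ball 0 r}"
  proof (rule convexI)
    fix s t u v :: real
    assume *: "s \<in> {t. w + of_real t \<in> ball 0 r}" "t \<in> {t. w + of_real t \<in> ball 0 r}"
      "0 \<le> u" "0 \<le> v" "u + v = 1"
    have "u *\<^sub>R (w + of_real s) + v *\<^sub>R (w + of_real t) \<in> ball 0 r"
      using * convex_ball[of "0::complex" r] unfolding convex_def by blast
    moreover have "u *\<^sub>R (w + of_real s) + v *\<^sub>R (w + of_real t) = w + complex_of_real (u *\<^sub>R s + v *\<^sub>R t)"
    proof -
      have "u *\<^sub>R w + v *\<^sub>R w = w" using *(5) by (metis scaleR_left_distrib scaleR_one)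
      then show ?thesis by (simp add: scaleR_conv_of_real algebra_simps)
    qed
    ultimately show "u *\<^sub>R s + v *\<^sub>R t \<in> {t. w + of_real t \<in> ball 0 r}" by simp
  qed
  then show "is_interval {t. w + of_real t \<in> ball 0 r}"
    by (simp add: is_interval_convex_1)
  fix t assume "t \<in> {t. w + of_real t \<in> ball 0 r}"
  then have "flow_box (\<lambda>x. F x - (w + of_real t)) (\<lambda>z. G ((w + of_real t) + z)) (r - norm (w + of_real t))"
    using flow_box_recentre[OF F] by blast
  then show "\<exists>F' G' r'. flow_box F' G' r' \<and> (\<forall>\<^sub>F s in nhds t. G (w + of_real s) = G' (of_real (s - t)))"
    by (intro exI conjI) (assumption, simp)
qed

text \<open>Maximality is with respect to all trajectories that meet \<open>\<Phi>\<close> at some time, not only to those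
  extending it.\<close>

definition maximal_trajectory :: "real set \<Rightarrow> (real \<Rightarrow> 'a) \<Rightarrow> bool" where
  "maximal_trajectory I \<Phi> \<longleftrightarrow> trajectory I \<Phi> \<and>
     (\<forall>I' \<delta> t. trajectory I' \<delta> \<longrightarrow> t \<in> I \<inter> I' \<longrightarrow> \<delta> t = \<Phi> t \<longrightarrow> I' \<subseteq> I)"

text \<open>By uniqueness, all trajectories that start at \<open>x\<close> agree on common intervals; their union is
  maximal because a trajectory that meets it at any time extends it to another one of the family.\<close>

lemma maximal_trajectory_exists:
  assumes x: "x \<in> topspace X" "x \<notin> zeros A \<eta>"
  obtains I \<Phi> where "maximal_trajectory I \<Phi>" "0 \<in> I" "\<Phi> 0 = x"
proof -
  define T where "T = {(I, \<gamma>). trajectory I \<gamma> \<and> 0 \<in> I \<and> \<gamma> 0 = x}"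
  define I where "I = (\<Union>(I, \<gamma>)\<in>T. I)"
  define \<Phi> where "\<Phi> t = (SOME y. \<exists>(I, \<gamma>)\<in>T. t \<in> I \<and> y = \<gamma> t)" for t
  have \<Phi>: "\<Phi> t = \<gamma> t" if "(I', \<gamma>) \<in> T" "t \<in> I'" for I' \<gamma> t
  proof -
    have "\<exists>(I, \<gamma>)\<in>T. t \<in> I \<and> \<Phi> t = \<gamma> t"
      unfolding \<Phi>_def by (rule someI[of _ "\<gamma> t"]) (use that in blast)
    then obtain I'' \<delta> where \<delta>: "(I'', \<delta>) \<in> T" "t \<in> I''" "\<Phi> t = \<delta> t" by blast
    have "\<delta> t = \<gamma> t"
      by (rule trajectory_unique[of I'' \<delta> I' \<gamma> 0]) (use \<delta> that in \<open>auto simp: T_def\<close>)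
    with \<delta> show ?thesis by simp
  qed
  obtain U F where F: "x \<in> U" "local_primitive X A \<eta> U F"
    using local_primitive_exists[OF x(1)] by blast
  obtain G r where G: "flow_box (\<lambda>y. F y - F x) G r" "G 0 = x"
    using flow_box_exists[OF x(2) F(2,1)] by metis
  have T_seg: "({t. 0 + of_real t \<in> ball (0::complex) r}, \<lambda>t. G (0 + of_real t)) \<in> T"
    using trajectory_segment[OF G(1), of 0] G flow_box_pos[OF G(1)] by (simp add: T_def)
  then have "T \<noteq> {}" by blast
  have "0 \<in> I"
    unfolding I_def by (rule UN_I[OF T_seg]) (use flow_box_pos[OF G(1)] in simp)
  have T_interval: "open I'" "connected I'" "0 \<in> I'" "\<gamma> 0 = x" if "(I', \<gamma>) \<in> T" for I' \<gamma>
    using that by (auto simp: T_def trajectory_def is_interval_connected_1)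
  have "0 \<in> (\<Inter>(I, \<gamma>)\<in>T. I)" using T_interval by auto
  then have "(\<Inter>(I, \<gamma>)\<in>T. I) \<noteq> {}" by (metis empty_iff)
  then have "connected I"
    unfolding I_def by (rule connected_Union[rotated]) (auto dest: T_interval)
  moreover have "open I" unfolding I_def using T_interval by (auto intro!: open_Union)
  ultimately have tr: "trajectory I \<Phi>"
  proof (intro trajectory_locally)
    fix t assume "t \<in> I"
    then obtain I' \<gamma> where "(I', \<gamma>) \<in> T" "t \<in> I'" by (auto simp: I_def)
    then show "\<exists>I' \<delta>. trajectory I' \<delta> \<and> t \<in> I' \<and> (\<forall>s\<in>I'. \<Phi> s = \<delta> s)"
      using \<Phi> by (intro exI[of _ I'] exI[of _ \<gamma>]) (auto simp: T_def)
  qed (simp_all add: is_interval_connected_1)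
  have "I' \<subseteq> I" if \<delta>: "trajectory I' \<delta>" and t: "t \<in> I \<inter> I'" "\<delta> t = \<Phi> t" for I' \<delta> t
  proof -
    let ?\<gamma> = "\<lambda>s. if s \<in> I then \<Phi> s else \<delta> s"
    have "trajectory (I \<union> I') ?\<gamma>"
    proof (rule trajectory_locally)
      show "open (I \<union> I')"
        using tr \<delta> by (simp add: trajectory_def open_Un)
      have "connected I" "connected I'" "I \<inter> I' \<noteq> {}"
        using tr \<delta> t by (auto simp: trajectory_def is_interval_connected_1)
      then show "is_interval (I \<union> I')"
        by (simp add: is_interval_connected_1 connected_Un)
      fix u assume "u \<in> I \<union> I'"
      moreover have "\<forall>s\<in>I'. ?\<gamma> s = \<delta> s"
        using trajectory_unique[OF tr \<delta> t(1) t(2)[symmetric]] by simp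
      ultimately show "\<exists>I' \<delta>. trajectory I' \<delta> \<and> u \<in> I' \<and> (\<forall>s\<in>I'. ?\<gamma> s = \<delta> s)"
        using tr \<delta> by (cases "u \<in> I") (force intro!: exI[of _ I] exI[of _ \<Phi>], blast)
    qed
    moreover have "\<Phi> 0 = x" using \<Phi> T_interval \<open>T \<noteq> {}\<close> by fast
    ultimately have "(I \<union> I', ?\<gamma>) \<in> T" using \<open>0 \<in> I\<close> by (auto simp: T_def)
    then show ?thesis by (auto simp: I_def)
  qed
  with tr have "maximal_trajectory I \<Phi>" by (auto simp: maximal_trajectory_def)
  moreover have "\<Phi> 0 = x" using \<Phi> T_interval \<open>T \<noteq> {}\<close> by fast
  ultimately show ?thesis using \<open>0 \<in> I\<close> that by blast
qed

text \<open>Shifting the time reduces to trajectories that meet at the same time.\<close>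

lemma maximal_trajectory_absorbs:
  assumes \<Phi>: "maximal_trajectory I \<Phi>" and \<delta>: "trajectory I' \<delta>"
    and "t0 \<in> I'" "u \<in> I" "\<delta> t0 = \<Phi> u" "t \<in> I'"
  shows "u + (t - t0) \<in> I \<and> \<delta> t = \<Phi> (u + (t - t0))"
proof -
  let ?I = "{s. s + (t0 - u) \<in> I'}" and ?\<delta> = "\<lambda>s. \<delta> (s + (t0 - u))"
  have *: "trajectory ?I ?\<delta>" using trajectory_shift[OF \<delta>] .
  have sub: "?I \<subseteq> I"
    using \<Phi> * assms(3-5) unfolding maximal_trajectory_def by force
  moreover have t: "u + (t - t0) \<in> ?I" using assms by simp
  moreover have "?\<delta> (u + (t - t0)) = \<Phi> (u + (t - t0))"
    by (rule trajectory_unique[OF *, of I \<Phi> u])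
      (use \<Phi> assms t sub in \<open>auto simp: maximal_trajectory_def\<close>)
  ultimately show ?thesis by auto
qed

lemma maximal_trajectory_segment:
  assumes "maximal_trajectory I \<Phi>" "flow_box F G r" "u \<in> I" "\<Phi> u = G w"
    "w \<in> ball 0 r" "w + of_real \<tau> \<in> ball 0 r"
  shows "u + \<tau> \<in> I \<and> \<Phi> (u + \<tau>) = G (w + of_real \<tau>)"
  using maximal_trajectory_absorbs[OF assms(1) trajectory_segment[OF assms(2)], of 0 w u \<tau>] assms(3-)
  by simp

lemma interval_closed_under_shift_eq_UNIV:
  fixes I :: "real set"
  assumes "is_interval I" "u \<in> I" "T > 0" "\<And>t. t \<in> I \<Longrightarrow> t + T \<in> I" "\<And>t. t \<in> I \<Longrightarrow> t - T \<in> I"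
  shows "I = UNIV"
proof -
  have *: "u + of_nat n * T \<in> I" "u - of_nat n * T \<in> I" for n
  proof (induction n)
    case (Suc n)
    {
      case 1 show ?case using assms(4)[OF Suc(1)] by (simp add: algebra_simps)
    next
      case 2 show ?case using assms(5)[OF Suc(2)] by (simp add: algebra_simps)
    }
  qed (use assms(2) in auto)
  have "s \<in> I" for s
  proof -
    obtain n where "\<bar>s - u\<bar> < of_nat n * T" using reals_Archimedean3[OF assms(3)] by blast
    then have "u - of_nat n * T \<le> s" "s \<le> u + of_nat n * T" by linarith+
    then show ?thesis using *[of n] assms(1) unfolding is_interval_1 by blast
  qed
  then show ?thesis by auto
qed

text \<open>A return to the same point makes the domain invariant under the shift by the return time.\<close>

lemma maximal_trajectory_periodic:
  assumes \<Phi>: "maximal_trajectory I \<Phi>" and u: "u \<in> I" "v \<in> I" "u < v" "\<Phi> u = \<Phi> v"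
  shows "I = UNIV" "\<Phi> (t + (v - u)) = \<Phi> t"
proof -
  have tr: "trajectory I \<Phi>" using \<Phi> by (simp add: maximal_trajectory_def)
  have 1: "t + (v - u) \<in> I \<and> \<Phi> t = \<Phi> (t + (v - u))" if "t \<in> I" for t
    using maximal_trajectory_absorbs[OF \<Phi> tr u(1,2,4) that] by (simp add: algebra_simps)
  have 2: "t - (v - u) \<in> I" if "t \<in> I" for t
    using maximal_trajectory_absorbs[OF \<Phi> tr u(2,1) u(4)[symmetric] that] by (simp add: algebra_simps)
  show "I = UNIV"
    using tr u 1 2 by (intro interval_closed_under_shift_eq_UNIV[of I u "v - u"]) (auto simp: trajectory_def)
  with 1 show "\<Phi> (t + (v - u)) = \<Phi> t" by auto
qed

end

section \<open>Leaves as maximal trajectories\<close>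

text \<open>Horizontal curves are parametrized by the whole real line and trajectories by open intervals; this
  is used to pass from the latter to the former.\<close>

lemma open_interval_parametrization:
  fixes I :: "real set"
  assumes "open I" "is_interval I" "I \<noteq> {}"
  obtains \<psi> \<psi>' where "range \<psi> = I" "\<And>t. (\<psi> has_real_derivative \<psi>' t) (at t)" "\<And>t. \<psi>' t > 0"
proof -
  have int: "I = interior I" using assms(1) by (simp add: interior_open)
  have "\<exists>a b. I = {} \<or> I = UNIV \<or> I = {..<b} \<or> I = {..b} \<or> I = {a<..} \<or> I = {a..} \<or>
    I = {a<..<b} \<or> I = {a<..b} \<or> I = {a..<b} \<or> I = {a..b}"
    by (rule interval_cases) (use assms(2) in \<open>unfold is_interval_1, blast\<close>)
  then obtain a b where "I = {} \<or> I = UNIV \<or> I = {..<b} \<or> I = {..b} \<or> I = {a<..} \<or> I = {a..} \<or>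
    I = {a<..<b} \<or> I = {a<..b} \<or> I = {a..<b} \<or> I = {a..b}"
    by (elim exE)
  then have "I = UNIV \<or> I = {..<b} \<or> I = {a<..} \<or> I = {a<..<b}"
    using int assms(3) by (elim disjE) simp_all
  then consider "I = UNIV" | "I = {..<b}" | "I = {a<..}" | "I = {a<..<b}" by blast
  then show ?thesis
  proof cases
    case 1
    show ?thesis by (rule that[of "\<lambda>t. t" "\<lambda>t. 1"]) (auto simp: 1)
  next
    case 2
    have "s \<in> range (\<lambda>t. b - exp (- t))" if "s < b" for s
      by (rule range_eqI[of _ _ "- ln (b - s)"]) (use that in simp)
    then show ?thesis
      by (intro that[of "\<lambda>t. b - exp (- t)" "\<lambda>t. exp (- t)"])
        (auto simp: 2 intro!: derivative_eq_intros)
  next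
    case 3
    have "s \<in> range (\<lambda>t. a + exp t)" if "s > a" for s
      by (rule range_eqI[of _ _ "ln (s - a)"]) (use that in simp)
    then show ?thesis
      by (intro that[of "\<lambda>t. a + exp t" "\<lambda>t. exp t"])
        (auto simp: 3 intro!: derivative_eq_intros)
  next
    case 4
    then have "a < b" using assms(3) by simp
    have pos: "1 + exp t > 0" "1 + exp t \<noteq> 0" for t :: real using exp_gt_zero[of t] by linarith+
    have "a < (a + b * exp t) / (1 + exp t)" "(a + b * exp t) / (1 + exp t) < b" for t
      using \<open>a < b\<close> pos[of t] by (auto simp: field_simps)
    moreover have "s \<in> range (\<lambda>t. (a + b * exp t) / (1 + exp t))" if "a < s" "s < b" for s
    proof (rule range_eqI[of _ _ "ln ((s - a) / (b - s))"])
      have "exp (ln ((s - a) / (b - s))) = (s - a) / (b - s)" using that by simp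
      then show "s = (a + b * exp (ln ((s - a) / (b - s)))) / (1 + exp (ln ((s - a) / (b - s))))"
      proof -
        have "1 + (s - a) / (b - s) = (b - a) / (b - s)"
          "a + b * ((s - a) / (b - s)) = s * (b - a) / (b - s)"
          using that by (simp_all add: field_simps)
        then show ?thesis using \<open>exp _ = _\<close> that \<open>a < b\<close> by simp
      qed
    qed
    ultimately have "range (\<lambda>t. (a + b * exp t) / (1 + exp t)) = I" by (auto simp: 4)
    moreover have "((\<lambda>t. (a + b * exp t) / (1 + exp t)) has_real_derivative
        (b - a) * exp t / (1 + exp t)\<^sup>2) (at t)" for t
      using pos[of t] by (auto intro!: derivative_eq_intros simp: field_simps power2_eq_square)
    ultimately show ?thesis
      using \<open>a < b\<close> pos by (intro that[of "\<lambda>t. (a + b * exp t) / (1 + exp t)" "\<lambda>t. (b - a) * exp t / (1 + exp t)\<^sup>2"]) auto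
  qed
qed

context riemann_surface_form
begin

abbreviation q :: "'a differential" where
  "q \<equiv> \<lambda>c z. (\<eta> c z)\<^sup>2"

lemma zeros_square: "zeros A q = zeros A \<eta>"
  by (simp add: zeros_def)

text \<open>The derivative of the inverse of a primitive of \<open>\<eta>\<close> is \<open>1 / \<eta>\<close>.\<close>

lemma trajectory_has_vector_derivative:
  assumes \<gamma>: "trajectory I \<gamma>" "t \<in> I" and c: "c \<in> A" "\<gamma> t \<in> cdom c"
  shows "((coord c \<circ> \<gamma>) has_vector_derivative inverse (\<eta> c (coord c (\<gamma> t)))) (at t)"
proof -
  obtain F G r where F: "flow_box F G r" and G: "\<forall>\<^sub>F s in nhds t. \<gamma> s = G (of_real (s - t))"
    using \<gamma> unfolding trajectory_def by blast
  have G0: "G 0 = \<gamma> t" using eventually_nhds_x_imp_x[OF G] by simp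
  have near: "\<forall>\<^sub>F z in nhds 0. z \<in> ball 0 r \<and> G z \<in> W" if "openin X W" "\<gamma> t \<in> W" for W
    using disc_coordinate_eventually[OF flow_box_disc[OF F] that(1)] that(2) G0 by simp
  have "\<forall>\<^sub>F z in nhds 0. (F \<circ> cinv c) ((coord c \<circ> G) z) = z"
    using near[OF openin_cdom[OF c(1)] c(2)]
    by eventually_elim (use c flow_box_inverse[OF F] in auto)
  then obtain T where T: "open T" "0 \<in> T" "\<And>z. z \<in> T \<Longrightarrow> (F \<circ> cinv c) ((coord c \<circ> G) z) = z"
    unfolding eventually_nhds by blast
  have cont: "continuous (at 0) (coord c \<circ> G)"
    unfolding continuous_within topological_tendstoD tendsto_def
  proof (intro allI impI)
    fix B assume B: "open B" "(coord c \<circ> G) 0 \<in> B"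
    have "\<forall>\<^sub>F z in nhds 0. z \<in> ball 0 r \<and> G z \<in> {y \<in> cdom c. coord c y \<in> B}"
      using B c G0 by (intro near openin_coord_preimage) auto
    then have "\<forall>\<^sub>F z in nhds 0. (coord c \<circ> G) z \<in> B" by eventually_elim simp
    then show "\<forall>\<^sub>F z in at 0. (coord c \<circ> G) z \<in> B"
      by (simp add: eventually_at_filter eventually_mono)
  qed
  have der: "DERIV (F \<circ> cinv c) ((coord c \<circ> G) 0) :> \<eta> c (coord c (\<gamma> t))"
  proof -
    have "\<gamma> t \<in> G ` ball 0 r"
      using flow_box_pos[OF F] unfolding G0[symmetric] by (intro imageI) simp
    from local_primitiveD[OF flow_box_primitive[OF F] c(1) this c(2)] show ?thesis
      by (simp add: G0)
  qed
  have "\<eta> c (coord c (\<gamma> t)) \<noteq> 0"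
    using trajectory_avoids_zeros[OF \<gamma>] zeros_iff[OF c] by simp
  then have "DERIV (coord c \<circ> G) 0 :> inverse (\<eta> c (coord c (\<gamma> t)))"
    by (rule has_field_derivative_inverse_basic[OF der _ cont T])
  moreover have "((\<lambda>s. complex_of_real (s - t)) has_vector_derivative 1) (at t)"
    by (auto intro!: derivative_eq_intros)
  ultimately have "((coord c \<circ> G) \<circ> (\<lambda>s. complex_of_real (s - t)) has_vector_derivative
      1 * inverse (\<eta> c (coord c (\<gamma> t)))) (at t)"
    by (intro field_vector_diff_chain_at) simp_all
  moreover have "\<forall>\<^sub>F s in nhds t. s \<in> UNIV \<longrightarrow> (coord c \<circ> \<gamma>) s = ((coord c \<circ> G) \<circ> (\<lambda>s. complex_of_real (s - t))) s"
    using G by eventually_elim simp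
  ultimately show ?thesis
    using has_vector_derivative_cong_ev[of UNIV "coord c \<circ> \<gamma>" _ t] G0 by (simp add: o_def)
qed

lemma trajectory_reparametrized_horizontal:
  assumes \<gamma>: "trajectory I \<gamma>" and \<psi>: "range \<psi> \<subseteq> I" "\<And>t. (\<psi> has_real_derivative \<psi>' t) (at t)" "\<And>t. \<psi>' t > 0"
  shows "horizontal_curve X A q (\<gamma> \<circ> \<psi>)"
  unfolding horizontal_curve_def
proof (intro conjI allI ballI impI)
  have "continuous_on UNIV \<psi>" using \<psi>(2) DERIV_continuous_on by blast
  then have "continuous_map euclideanreal (top_of_set I) \<psi>"
    using \<psi>(1) by (auto simp: continuous_map_in_subtopology)
  then show "continuous_map euclideanreal X (\<gamma> \<circ> \<psi>)"
    using trajectory_continuous[OF \<gamma>] by (rule continuous_map_compose)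
  show "range (\<gamma> \<circ> \<psi>) \<inter> zeros A q = {}"
    using trajectory_avoids_zeros[OF \<gamma>] \<psi>(1) by (auto simp: zeros_square)
  fix t c assume c: "c \<in> A" "(\<gamma> \<circ> \<psi>) t \<in> cdom c"
  let ?e = "\<eta> c (coord c (\<gamma> (\<psi> t)))"
  have t: "\<psi> t \<in> I" using \<psi>(1) by blast
  have "((coord c \<circ> \<gamma>) has_vector_derivative inverse ?e) (at (\<psi> t))"
    using trajectory_has_vector_derivative[OF \<gamma> t] c by simp
  then have "((coord c \<circ> \<gamma>) \<circ> \<psi> has_vector_derivative \<psi>' t *\<^sub>R inverse ?e) (at t)"
    using \<psi>(2)[of t] by (intro vector_diff_chain_at) (simp_all add: has_real_derivative_iff_has_vector_derivative)
  moreover have "?e \<noteq> 0" using trajectory_avoids_zeros[OF \<gamma> t] zeros_iff c by simp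
  then have "?e\<^sup>2 * (\<psi>' t *\<^sub>R inverse ?e)\<^sup>2 = complex_of_real ((\<psi>' t)\<^sup>2)"
    by (simp add: scaleR_conv_of_real power_mult_distrib field_simps)
  ultimately show "\<exists>v r. (coord c \<circ> (\<gamma> \<circ> \<psi>) has_vector_derivative v) (at t) \<and> 0 < r \<and>
      (\<eta> c (coord c ((\<gamma> \<circ> \<psi>) t)))\<^sup>2 * v\<^sup>2 = complex_of_real r"
    using \<psi>(3)[of t] by (intro exI[of _ "\<psi>' t *\<^sub>R inverse ?e"] exI[of _ "(\<psi>' t)\<^sup>2"]) (auto simp: o_assoc)
qed

lemma horizontal_curve_in_topspace:
  "horizontal_curve X A q \<gamma> \<Longrightarrow> \<gamma> t \<in> topspace X - zeros A \<eta>"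
  unfolding horizontal_curve_def zeros_square continuous_map topspace_euclidean by blast

lemma horizontal_curve_eventually_in:
  assumes "horizontal_curve X A q \<gamma>" "openin X W" "\<gamma> t \<in> W"
  shows "\<forall>\<^sub>F s in nhds t. \<gamma> s \<in> W"
  using assms by (intro eventually_nhds_in_openin[of UNIV X]) (auto simp: horizontal_curve_def)

text \<open>On a tangent vector \<open>v\<close> the number \<open>\<eta> v\<close> is real because its square is positive.\<close>

lemma horizontal_curve_height_derivative:
  assumes \<gamma>: "horizontal_curve X A q \<gamma>" and F: "local_primitive X A \<eta> U F" "\<gamma> t \<in> U"
  shows "((\<lambda>s. Im (F (\<gamma> s))) has_real_derivative 0) (at t)"
proof -
  have "\<gamma> t \<in> topspace X" using horizontal_curve_in_topspace[OF \<gamma>] by blast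
  then obtain c where c: "c \<in> A" "\<gamma> t \<in> cdom c" using chart_at by blast
  let ?e = "\<eta> c (coord c (\<gamma> t))"
  obtain v r where v: "((coord c \<circ> \<gamma>) has_vector_derivative v) (at t)" "r > 0" "?e\<^sup>2 * v\<^sup>2 = complex_of_real r"
    using \<gamma> c unfolding horizontal_curve_def by blast
  have "((F \<circ> cinv c) \<circ> (coord c \<circ> \<gamma>) has_vector_derivative v * ?e) (at t)"
    using local_primitiveD[OF F(1) c(1) F(2) c(2)] by (intro field_vector_diff_chain_at v) simp
  moreover have "\<forall>\<^sub>F s in nhds t. s \<in> UNIV \<longrightarrow> F (\<gamma> s) = ((F \<circ> cinv c) \<circ> (coord c \<circ> \<gamma>)) s"
    using horizontal_curve_eventually_in[OF \<gamma> openin_cdom[OF c(1)] c(2)]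
    by eventually_elim (use c in simp)
  ultimately have "((\<lambda>s. F (\<gamma> s)) has_vector_derivative v * ?e) (at t)"
    using has_vector_derivative_cong_ev[of UNIV "\<lambda>s. F (\<gamma> s)" _ t] c by (simp add: o_def)
  then have "((\<lambda>s. Im (F (\<gamma> s))) has_vector_derivative Im (v * ?e)) (at t)"
    by (rule bounded_linear.has_vector_derivative[OF bounded_linear_Im])
  moreover have "Im (v * ?e) = 0"
  proof -
    have sq: "(v * ?e)\<^sup>2 = complex_of_real r" using v(3) by (simp add: power_mult_distrib mult.commute)
    have "Re (v * ?e) * Im (v * ?e) = 0" "(Re (v * ?e))\<^sup>2 - (Im (v * ?e))\<^sup>2 = r"
      using arg_cong[OF sq, of Im] arg_cong[OF sq, of Re] by (auto simp: power2_eq_square)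
    then show ?thesis using v(2) by (cases "Re (v * ?e) = 0") (auto simp: power2_eq_square)
  qed
  ultimately show ?thesis by (simp add: has_real_derivative_iff_has_vector_derivative)
qed

lemma horizontal_curve_height_constant:
  assumes \<gamma>: "horizontal_curve X A q \<gamma>" and F: "local_primitive X A \<eta> U F"
    and "convex S" "\<gamma> ` S \<subseteq> U" "s \<in> S" "t \<in> S"
  shows "Im (F (\<gamma> s)) = Im (F (\<gamma> t))"
proof -
  have "((\<lambda>s. Im (F (\<gamma> s))) has_real_derivative 0) (at u within S)" if "u \<in> S" for u
    using horizontal_curve_height_derivative[OF \<gamma> F, of u] that assms
    by (auto intro: has_field_derivative_at_within)
  from has_field_derivative_zero_constant[OF assms(3) this] assms(5,6) show ?thesis by auto
qed

lemma horizontal_curve_height_locally_constant: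
  assumes \<gamma>: "horizontal_curve X A q \<gamma>" and F: "local_primitive X A \<eta> U F" "\<gamma> t \<in> U"
  shows "\<forall>\<^sub>F s in nhds t. \<gamma> s \<in> U \<and> Im (F (\<gamma> s)) = Im (F (\<gamma> t))"
proof -
  have "\<forall>\<^sub>F s in nhds t. \<gamma> s \<in> U"
    using horizontal_curve_eventually_in[OF \<gamma> local_primitive_openin[OF F(1)] F(2)] .
  then obtain e where e: "e > 0" "\<And>s. dist s t < e \<Longrightarrow> \<gamma> s \<in> U"
    unfolding eventually_nhds_metric by blast
  have "\<forall>\<^sub>F s in nhds t. s \<in> ball t e"
    using e by (intro eventually_nhds_in_open) auto
  then show ?thesis
  proof eventually_elim
    case (elim s)
    have "\<gamma> ` ball t e \<subseteq> U" using e(2) by (auto simp: dist_commute)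
    from horizontal_curve_height_constant[OF \<gamma> F(1) convex_ball this elim] e elim show ?case
      by (simp add: dist_commute)
  qed
qed

lemma flow_box_height_inj:
  assumes "flow_box F G r" "x \<in> G ` ball 0 r"
  shows "G (F x) = x" "F x \<in> ball 0 r"
  using assms flow_box_inverse[OF assms(1)] by (metis imageE)+

text \<open>Since a horizontal curve stays on a horizontal line of each flow box, to be on the maximal
  trajectory is a property that is locally constant along it.\<close>

lemma maximal_trajectory_contains_horizontal_curve:
  assumes \<Phi>: "maximal_trajectory I \<Phi>" and \<gamma>: "horizontal_curve X A q \<gamma>" and "\<gamma> t0 \<in> \<Phi> ` I"
  shows "\<gamma> t \<in> \<Phi> ` I"
proof -
  have "(\<gamma> t0 \<in> \<Phi> ` I) = (\<gamma> t \<in> \<Phi> ` I)"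
  proof (rule connected_local_const[of UNIV t0 t "\<lambda>t. \<gamma> t \<in> \<Phi> ` I"])
    show "\<forall>t\<in>UNIV. \<forall>\<^sub>F s in at t. (\<gamma> t \<in> \<Phi> ` I) = (\<gamma> s \<in> \<Phi> ` I)"
    proof
      fix t
      have t: "\<gamma> t \<in> topspace X" "\<gamma> t \<notin> zeros A \<eta>" using horizontal_curve_in_topspace[OF \<gamma>] by blast+
      then obtain U F where F: "\<gamma> t \<in> U" "local_primitive X A \<eta> U F" using local_primitive_exists by blast
      obtain G r where G: "flow_box (\<lambda>x. F x - F (\<gamma> t)) G r" "G 0 = \<gamma> t"
        using flow_box_exists[OF t(2) F(2,1)] by metis
      let ?F = "\<lambda>x. F x - F (\<gamma> t)"
      have 0: "0 \<in> ball (0::complex) r" using flow_box_pos[OF G(1)] by simp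
      have "\<gamma> t \<in> G ` ball 0 r" using 0 G(2) by (metis image_eqI)
      from horizontal_curve_height_locally_constant[OF \<gamma> flow_box_primitive[OF G(1)] this]
      have "\<forall>\<^sub>F s in nhds t. (\<gamma> t \<in> \<Phi> ` I) = (\<gamma> s \<in> \<Phi> ` I)"
      proof eventually_elim
        case (elim s)
        define a where "a = Re (?F (\<gamma> s))"
        have "?F (\<gamma> s) = of_real a" using elim by (simp add: a_def complex_eq_iff)
        then have a: "\<gamma> s = G (of_real a)" "complex_of_real a \<in> ball 0 r"
          using flow_box_height_inj[OF G(1), of "\<gamma> s"] elim by auto
        show ?case
        proof
          assume "\<gamma> t \<in> \<Phi> ` I"
          then obtain u where "u \<in> I" "\<Phi> u = G 0" using G(2) by auto
          from maximal_trajectory_segment[OF \<Phi> G(1) this 0, of a] a show "\<gamma> s \<in> \<Phi> ` I" by force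
        next
          assume "\<gamma> s \<in> \<Phi> ` I"
          then obtain u where "u \<in> I" "\<Phi> u = G (of_real a)" using a by auto
          from maximal_trajectory_segment[OF \<Phi> G(1) this a(2), of "- a"] 0 G(2)
          show "\<gamma> t \<in> \<Phi> ` I" by force
        qed
      qed
      then show "\<forall>\<^sub>F s in at t. (\<gamma> t \<in> \<Phi> ` I) = (\<gamma> s \<in> \<Phi> ` I)"
        by (simp add: eventually_at_filter eventually_mono)
    qed
  qed auto
  with assms(3) show ?thesis by simp
qed

text \<open>A leaf is contained in the maximal trajectory through one of its points, and the latter can be
  parametrized as a horizontal curve; maximality of the leaf gives equality.\<close>

lemma leaf_is_maximal_trajectory:
  assumes L: "leaf X A q L"
  obtains I \<Phi> where "maximal_trajectory I \<Phi>" "I \<noteq> {}" "L = \<Phi> ` I"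
proof -
  obtain \<gamma> where \<gamma>: "horizontal_curve X A q \<gamma>" "range \<gamma> = L" using L unfolding leaf_def by blast
  obtain I \<Phi> where \<Phi>: "maximal_trajectory I \<Phi>" "0 \<in> I" "\<Phi> 0 = \<gamma> 0"
    using maximal_trajectory_exists horizontal_curve_in_topspace[OF \<gamma>(1), of 0] by blast
  have tr: "trajectory I \<Phi>" using \<Phi>(1) by (simp add: maximal_trajectory_def)
  then obtain \<psi> \<psi>' where \<psi>: "range \<psi> = I" "\<And>t. (\<psi> has_real_derivative \<psi>' t) (at t)" "\<And>t. \<psi>' t > 0"
    using open_interval_parametrization[of I] \<Phi>(2) unfolding trajectory_def by blast
  have "horizontal_curve X A q (\<Phi> \<circ> \<psi>)"
    using trajectory_reparametrized_horizontal[OF tr _ \<psi>(2,3)] \<psi>(1) by blast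
  moreover have "L \<subseteq> range (\<Phi> \<circ> \<psi>)"
  proof -
    have "\<gamma> 0 \<in> \<Phi> ` I" using \<Phi>(2) unfolding \<Phi>(3)[symmetric] by (rule imageI)
    then have "range \<gamma> \<subseteq> \<Phi> ` I"
      using maximal_trajectory_contains_horizontal_curve[OF \<Phi>(1) \<gamma>(1)] by blast
    then show ?thesis using \<gamma>(2) \<psi>(1) by (metis image_comp)
  qed
  ultimately have "range (\<Phi> \<circ> \<psi>) = L" using L unfolding leaf_def by blast
  then have "L = \<Phi> ` I" using \<psi>(1) by (metis image_comp)
  with \<Phi> show ?thesis by (intro that) auto
qed

lemma noninjective_leaf_closed:
  assumes L: "leaf X A q L" and \<Phi>: "maximal_trajectory I \<Phi>" "L = \<Phi> ` I" and "\<not> inj_on \<Phi> I"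
  shows "closed_leaf X A q L"
proof -
  obtain u v where "u \<in> I" "v \<in> I" "u < v" "\<Phi> u = \<Phi> v"
    using assms(4) unfolding inj_on_def by (metis linorder_neqE_linordered_idom)
  note per = maximal_trajectory_periodic[OF \<Phi>(1) this]
  have "horizontal_curve X A q (\<Phi> \<circ> (\<lambda>t. t))"
    using \<Phi> per(1) by (intro trajectory_reparametrized_horizontal[of I _ _ "\<lambda>_. 1"]) (auto simp: maximal_trajectory_def)
  then show ?thesis
    unfolding closed_leaf_def using L \<Phi> per \<open>u < v\<close>
    by (intro conjI exI[of _ \<Phi>] exI[of _ "v - u"]) (auto simp: o_def)
qed

end

section \<open>Real chains\<close>

text \<open>Boundary and integral of chains are sums over the support; for additive summands they are
  additive although the support of a difference may be smaller.\<close>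

lemma sum_keys_diff:
  fixes g :: "'b \<Rightarrow> real \<Rightarrow> 'c::ab_group_add" and C D :: "'b \<Rightarrow>\<^sub>0 real"
  assumes g: "\<And>\<sigma> a b. g \<sigma> (a - b) = g \<sigma> a - g \<sigma> b"
  shows "(\<Sum>\<sigma>\<in>Poly_Mapping.keys (C - D). g \<sigma> (Poly_Mapping.lookup (C - D) \<sigma>)) =
    (\<Sum>\<sigma>\<in>Poly_Mapping.keys C. g \<sigma> (Poly_Mapping.lookup C \<sigma>)) -
    (\<Sum>\<sigma>\<in>Poly_Mapping.keys D. g \<sigma> (Poly_Mapping.lookup D \<sigma>))"
proof -
  let ?K = "Poly_Mapping.keys C \<union> Poly_Mapping.keys D"
  have g0: "g \<sigma> 0 = 0" for \<sigma> using g[of \<sigma> 0 0] by simp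
  have *: "(\<Sum>\<sigma>\<in>Poly_Mapping.keys E. g \<sigma> (Poly_Mapping.lookup E \<sigma>)) =
      (\<Sum>\<sigma>\<in>?K. g \<sigma> (Poly_Mapping.lookup E \<sigma>))" if "Poly_Mapping.keys E \<subseteq> ?K" for E
    using that by (intro sum.mono_neutral_left) (auto simp: g0 in_keys_iff)
  have "(\<Sum>\<sigma>\<in>?K. g \<sigma> (Poly_Mapping.lookup (C - D) \<sigma>)) =
      (\<Sum>\<sigma>\<in>?K. g \<sigma> (Poly_Mapping.lookup C \<sigma>)) - (\<Sum>\<sigma>\<in>?K. g \<sigma> (Poly_Mapping.lookup D \<sigma>))"
    by (simp add: lookup_minus g sum_subtractf)
  then show ?thesis
    using *[OF keys_diff] *[of C] *[of D] by simp
qed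

lemma rboundary_diff: "rboundary p (C - D) = rboundary p C - rboundary p D"
  unfolding rboundary_def
  by (simp add: sum_keys_diff[where g = "\<lambda>\<sigma> a. \<Sum>k\<le>p. Poly_Mapping.single (singular_face p k \<sigma>) ((-1) ^ k * a)"]
      right_diff_distrib single_diff sum_subtractf)

lemma chain_integral_diff: "chain_integral X A \<eta> (C - D) = chain_integral X A \<eta> C - chain_integral X A \<eta> D"
  unfolding chain_integral_def
  by (rule sum_keys_diff) (simp add: left_diff_distrib)

lemma rboundary_single:
  "rboundary 1 (Poly_Mapping.single \<sigma> r) =
     Poly_Mapping.single (singular_face 1 0 \<sigma>) r - Poly_Mapping.single (singular_face 1 1 \<sigma>) r"
  by (cases "r = 0") (simp_all add: rboundary_def single_uminus)

text \<open>Both faces of the singular simplex are the base point of the curve.\<close>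

lemma rboundary_curve_cycle:
  assumes "closed_curve X \<gamma>"
  shows "rboundary 1 (curve_cycle r \<gamma>) = 0"
proof -
  have "\<gamma> 1 = \<gamma> 0" using assms unfolding closed_curve_def by (metis add_0)
  have "singular_face 1 0 (restrict (\<lambda>x. \<gamma> (x 1)) (standard_simplex 1)) =
      singular_face 1 1 (restrict (\<lambda>x. \<gamma> (x 1)) (standard_simplex 1))"
  proof
    fix x
    show "singular_face 1 0 (restrict (\<lambda>x. \<gamma> (x 1)) (standard_simplex 1)) x =
        singular_face 1 1 (restrict (\<lambda>x. \<gamma> (x 1)) (standard_simplex 1)) x"
    proof (cases "x \<in> standard_simplex 0")
      case True
      then have "x 0 = 1" by (auto simp: standard_simplex_def)
      have "simplical_face 0 x \<in> standard_simplex 1" "simplical_face 1 x \<in> standard_simplex 1"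
        using simplical_face_in_standard_simplex[of 1 _ x] True by auto
      then show ?thesis using True \<open>x 0 = 1\<close> \<open>\<gamma> 1 = \<gamma> 0\<close>
        by (simp add: singular_face_def) (simp add: simplical_face_def)
    qed (simp add: singular_face_def)
  qed
  then show ?thesis
    unfolding curve_cycle_def rboundary_single by simp
qed

lemma singular_simplex_curve:
  assumes "closed_curve X \<gamma>"
  shows "singular_simplex 1 X (restrict (\<lambda>x. \<gamma> (x 1)) (standard_simplex 1))"
proof -
  have "continuous_map (powertop_real UNIV) euclideanreal (\<lambda>x. x (1::nat))"
    by (rule continuous_map_product_projection) simp
  then have "continuous_map (subtopology (powertop_real UNIV) (standard_simplex 1)) X (\<gamma> \<circ> (\<lambda>x. x 1))"
    using assms by (intro continuous_map_compose[OF continuous_map_from_subtopology])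
      (auto simp: closed_curve_def)
  then show ?thesis
    unfolding singular_simplex_def
    by (auto simp: o_def intro: continuous_map_eq)
qed

lemma rcycle1_curve_cycle:
  assumes "closed_curve X \<gamma>"
  shows "rcycle1 X (curve_cycle r \<gamma>)"
  using singular_simplex_curve[OF assms] rboundary_curve_cycle[OF assms, of r]
  by (auto simp: rcycle1_def rchain_in_def curve_cycle_def)

lemma rcycle1_diff: "\<lbrakk>rcycle1 X C; rcycle1 X D\<rbrakk> \<Longrightarrow> rcycle1 X (C - D)"
  unfolding rcycle1_def rchain_in_def using keys_diff[of C D] by (auto simp: rboundary_diff)

lemma homologous1_refl: "homologous1 X C C"
  unfolding homologous1_def by (rule exI[of _ 0]) (simp add: rchain_in_def rboundary_def)

lemma rchain_map_curve_cycle: "rchain_map 1 f (curve_cycle 1 \<gamma>) = curve_cycle 1 (f \<circ> \<gamma>)"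
  by (simp add: rchain_map_def curve_cycle_def simplex_map_def restrict_compose_left o_def cong: restrict_cong)

lemma curve_cycle_minus: "curve_cycle (- 1) \<gamma> = - curve_cycle 1 \<gamma>"
  by (simp add: curve_cycle_def single_uminus)

text \<open>Disjoint curves are transverse with no crossings at all.\<close>

lemma has_intersection_number_disjoint:
  assumes "closed_curve X \<gamma>1" "closed_curve X \<gamma>2" "closed_curve X \<delta>"
    and "range \<gamma>1 \<inter> range \<delta> = {}" "range \<gamma>2 \<inter> range \<delta> = {}"
  shows "has_intersection_number X A (curve_cycle 1 \<gamma>1 - curve_cycle 1 \<gamma>2) (curve_cycle 1 \<delta>) 0"
proof -
  have cr: "crossings \<gamma>1 \<delta> = {}" "crossings \<gamma>2 \<delta> = {}"
    using assms(4,5) unfolding crossings_def by blast+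
  let ?\<gamma> = "\<lambda>i::nat. if i = 0 then \<gamma>1 else \<gamma>2" and ?r = "\<lambda>i::nat. if i = 0 then 1 else - 1 :: real"
  have "(\<Sum>i<(2::nat). curve_cycle (?r i) (?\<gamma> i)) = curve_cycle 1 \<gamma>1 - curve_cycle 1 \<gamma>2"
    by (simp add: numeral_2_eq_2 curve_cycle_minus)
  then have "homologous1 X (curve_cycle 1 \<gamma>1 - curve_cycle 1 \<gamma>2) (\<Sum>i<(2::nat). curve_cycle (?r i) (?\<gamma> i))"
    by (metis homologous1_refl)
  moreover have "homologous1 X (curve_cycle 1 \<delta>) (\<Sum>j<(1::nat). curve_cycle 1 \<delta>)"
    by (simp add: homologous1_refl)
  moreover have "\<forall>i<2. \<forall>j<(1::nat). transverse A (?\<gamma> i) \<delta>"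
    using cr by (simp add: transverse_def)
  moreover have "0 = (\<Sum>i<(2::nat). \<Sum>j<(1::nat). ?r i * 1 * crossing_number A (?\<gamma> i) \<delta>)"
    using cr by (simp add: crossing_number_def numeral_2_eq_2)
  moreover have "\<forall>i<(2::nat). closed_curve X (?\<gamma> i)" "\<forall>j<(1::nat). closed_curve X \<delta>"
    using assms(1-3) by simp_all
  ultimately show ?thesis
    unfolding has_intersection_number_def
    by (intro exI[of _ "2::nat"] exI[of _ "1::nat"] exI[of _ ?\<gamma>] exI[of _ "\<lambda>_. \<delta>"]
        exI[of _ ?r] exI[of _ "\<lambda>_. 1"] conjI) assumption+
qed

lemma primitive_along_cong:
  assumes "\<And>t. t \<in> {0..1} \<Longrightarrow> \<gamma> t = \<delta> t" and "primitive_along X A \<eta> \<gamma> f"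
  shows "primitive_along X A \<eta> \<delta> f"
  unfolding primitive_along_def
proof
  fix t :: real assume "t \<in> {0..1}"
  then obtain U F e where "e > 0" "local_primitive X A \<eta> U F"
    "\<forall>s\<in>{0..1}. \<bar>s - t\<bar> < e \<longrightarrow> \<gamma> s \<in> U \<and> f s = F (\<gamma> s)"
    using assms(2) unfolding primitive_along_def by meson
  then show "\<exists>U F e. e > 0 \<and> local_primitive X A \<eta> U F \<and>
      (\<forall>s\<in>{0..1}. \<bar>s - t\<bar> < e \<longrightarrow> \<delta> s \<in> U \<and> f s = F (\<delta> s))"
    using assms(1) by (intro exI[of _ U] exI[of _ F] exI[of _ e]) simp
qed

lemma chain_integral_curve_cycle:
  "chain_integral X A \<eta> (curve_cycle 1 \<gamma>) = path_integral_form X A \<eta> \<gamma>"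
proof -
  have "simplex_path (restrict (\<lambda>x. \<gamma> (x 1)) (standard_simplex 1)) t = \<gamma> t" if "t \<in> {0..1}" for t
  proof -
    have "(\<lambda>i. if i = 0 then 1 - t else if i = 1 then t else 0) \<in> standard_simplex 1"
      using that by (auto simp: standard_simplex_def)
    then show ?thesis by (simp add: simplex_path_def)
  qed
  then have "primitive_along X A \<eta> (simplex_path (restrict (\<lambda>x. \<gamma> (x 1)) (standard_simplex 1))) =
      primitive_along X A \<eta> \<gamma>"
    by (intro ext iffI) (metis primitive_along_cong)+
  then show ?thesis
    by (simp add: chain_integral_def curve_cycle_def path_integral_form_def)
qed

section \<open>Real forms\<close>

locale real_riemann_surface_form = riemann_surface_form X A \<eta>
  for X :: "'a topology" and A :: "'a chart set" and \<eta> :: "'a differential" +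
  fixes J :: "'a \<Rightarrow> 'a"
  assumes involution: "anticonformal_involution X A J"
    and real: "real_differential A J \<eta>"
begin

lemma continuous_map_J: "continuous_map X X J"
  using involution by (simp add: anticonformal_involution_def)

lemma J_J: "x \<in> topspace X \<Longrightarrow> J (J x) = x"
  using involution by (simp add: anticonformal_involution_def)

lemma J_in_topspace: "x \<in> topspace X \<Longrightarrow> J x \<in> topspace X"
  using continuous_map_J unfolding continuous_map by blast

lemma openin_J_preimage: "openin X U \<Longrightarrow> openin X {x \<in> topspace X. J x \<in> U}"
  using continuous_map_J unfolding continuous_map by blast

abbreviation nonreal :: "'a set" where
  "nonreal \<equiv> {x \<in> topspace X. J x \<noteq> x}"

lemma openin_nonreal: "openin X nonreal"
proof -
  have "closedin X {x \<in> topspace X. J x = id x}"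
    by (intro closedin_continuous_maps_eq[OF Hausdorff] continuous_map_J continuous_map_id)
  moreover have "topspace X - {x \<in> topspace X. J x = id x} = nonreal" by auto
  ultimately show ?thesis using openin_diff[OF openin_topspace, of X "{x \<in> topspace X. J x = id x}"] by simp
qed

lemma J_chart_holomorphic:
  assumes "c \<in> A" "d \<in> A"
  shows "open (coord c ` {x \<in> cdom c. J x \<in> cdom d})"
    and "(cnj \<circ> coord d \<circ> J \<circ> cinv c) holomorphic_on coord c ` {x \<in> cdom c. J x \<in> cdom d}"
proof -
  have "{x \<in> cdom c. J x \<in> cdom d} = cdom c \<inter> {x \<in> topspace X. J x \<in> cdom d}"
    using cdom_subset[OF assms(1)] by auto
  then have "openin X {x \<in> cdom c. J x \<in> cdom d}"
    using openin_Int[OF openin_cdom[OF assms(1)] openin_J_preimage[OF openin_cdom[OF assms(2)]]] by simp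
  then show "open (coord c ` {x \<in> cdom c. J x \<in> cdom d})"
    by (rule open_coord_image[OF assms(1)]) auto
  show "(cnj \<circ> coord d \<circ> J \<circ> cinv c) holomorphic_on coord c ` {x \<in> cdom c. J x \<in> cdom d}"
    using involution assms by (auto simp: anticonformal_involution_def)
qed

text \<open>This is the condition \<open>J\<^sup>* \<eta> = cnj \<eta>\<close> in integrated form.\<close>

lemma conjugate_local_primitive:
  assumes F: "local_primitive X A \<eta> U F"
  shows "local_primitive X A \<eta> {x \<in> topspace X. J x \<in> U} (\<lambda>x. cnj (F (J x)))"
  unfolding local_primitive_def
proof (intro conjI ballI)
  show "openin X {x \<in> topspace X. J x \<in> U}"
    by (rule openin_J_preimage[OF local_primitive_openin[OF F]])
  fix c x assume c: "c \<in> A" and x: "x \<in> {x \<in> topspace X. J x \<in> U} \<inter> cdom c"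
  then obtain d where d: "d \<in> A" "J x \<in> cdom d" using J_in_topspace chart_at by blast
  let ?h = "cnj \<circ> coord d \<circ> J \<circ> cinv c" and ?z = "coord c x"
  let ?S = "coord c ` {x \<in> cdom c. J x \<in> cdom d}"
  have zS: "?z \<in> ?S" using x d by auto
  have hz: "cnj (?h ?z) = coord d (J x)" using c x by simp
  have "(?h has_field_derivative deriv ?h ?z) (at ?z)"
    by (rule holomorphic_derivI[OF J_chart_holomorphic(2,1)[OF c d(1)] zS])
  moreover have "((F \<circ> cinv d) has_field_derivative \<eta> d (coord d (J x))) (at (cnj (?h ?z)))"
    unfolding hz using x d by (intro local_primitiveD[OF F]) auto
  then have "((cnj \<circ> (F \<circ> cinv d) \<circ> cnj) has_field_derivative cnj (\<eta> d (coord d (J x)))) (at (?h ?z))"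
    by (rule has_field_derivative_cnj_cnj)
  ultimately have "((cnj \<circ> (F \<circ> cinv d) \<circ> cnj) \<circ> ?h has_field_derivative
      cnj (\<eta> d (coord d (J x))) * deriv ?h ?z) (at ?z)"
    by (rule DERIV_chain[rotated])
  moreover have "\<eta> d (cnj (?h ?z)) * cnj (deriv ?h ?z) = cnj (\<eta> c ?z)"
    using real c d x unfolding real_differential_def Let_def by blast
  then have "cnj (\<eta> d (coord d (J x))) * deriv ?h ?z = \<eta> c ?z"
    unfolding hz by (metis complex_cnj_cnj complex_cnj_mult)
  moreover have "\<forall>\<^sub>F z in nhds ?z. z \<in> ?S"
    using J_chart_holomorphic(1)[OF c d(1)] zS by (rule eventually_nhds_in_open)
  then have "\<forall>\<^sub>F z in nhds ?z. ((\<lambda>x. cnj (F (J x))) \<circ> cinv c) z = ((cnj \<circ> (F \<circ> cinv d) \<circ> cnj) \<circ> ?h) z"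
    by eventually_elim (use c d in auto)
  ultimately show "((\<lambda>x. cnj (F (J x))) \<circ> cinv c has_field_derivative \<eta> c ?z) (at ?z)"
    by (subst DERIV_cong_ev[OF refl _ refl]) auto
qed

lemma primitive_along_conjugate:
  assumes \<gamma>: "pathin X \<gamma>" and f: "primitive_along X A \<eta> \<gamma> f"
  shows "primitive_along X A \<eta> (J \<circ> \<gamma>) (cnj \<circ> f)"
  unfolding primitive_along_def
proof
  fix t :: real assume "t \<in> {0..1}"
  then obtain U F e where F: "e > 0" "local_primitive X A \<eta> U F"
    "\<And>s. \<lbrakk>s \<in> {0..1}; \<bar>s - t\<bar> < e\<rbrakk> \<Longrightarrow> \<gamma> s \<in> U \<and> f s = F (\<gamma> s)"
    using f unfolding primitive_along_def by meson
  have "\<gamma> s \<in> topspace X" if "s \<in> {0..1}" for s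
    using \<gamma> that by (auto simp: pathin_def continuous_map image_subset_iff)
  then show "\<exists>U F e. e > 0 \<and> local_primitive X A \<eta> U F \<and>
      (\<forall>s\<in>{0..1}. \<bar>s - t\<bar> < e \<longrightarrow> (J \<circ> \<gamma>) s \<in> U \<and> (cnj \<circ> f) s = F ((J \<circ> \<gamma>) s))"
    using F(1,3) conjugate_local_primitive[OF F(2)] J_J J_in_topspace
    by (intro exI[of _ "{x \<in> topspace X. J x \<in> U}"] exI[of _ "\<lambda>x. cnj (F (J x))"] exI[of _ e]) auto
qed

definition odd_periods_vanish :: bool where
  "odd_periods_vanish \<longleftrightarrow>
     (\<forall>C. odd_cycle X J C \<longrightarrow>
        (\<forall>R. oriented_real_oval X J R \<longrightarrow> has_intersection_number X A C (curve_cycle 1 R) 0) \<longrightarrow>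
        chain_integral X A \<eta> C = 0)"

text \<open>The odd cycle is \<open>\<gamma> - J \<circ> \<gamma>\<close>, where \<open>\<gamma>\<close> is the loop. Both curves stay off the real ovals.\<close>

lemma loop_height_change_zero:
  assumes periods: odd_periods_vanish
    and "height_change nonreal x x k"
  shows "k = 0"
proof -
  obtain \<gamma>0 f where \<gamma>0: "pathin X \<gamma>0" "\<gamma>0 \<in> {0..1} \<rightarrow> nonreal" "primitive_along X A \<eta> \<gamma>0 f"
    "\<gamma>0 0 = x" "\<gamma>0 1 = x" "k = Im (f 1 - f 0)"
    using assms(2) unfolding height_change_def by blast
  define \<gamma> where "\<gamma> = (\<lambda>t. \<gamma>0 (frac t))"
  have \<gamma>: "closed_curve X \<gamma>"
    unfolding \<gamma>_def using \<gamma>0 by (intro closed_curve_of_loop) auto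
  have "frac t \<in> {0..1}" for t :: real using frac_ge_0[of t] frac_lt_1[of t] by simp
  then have nonreal: "\<gamma> t \<in> nonreal" for t using \<gamma>0(2) unfolding \<gamma>_def by blast
  have "\<gamma> t = \<gamma>0 t" if "t \<in> {0..1}" for t
    using that \<gamma>0(4,5) by (cases "t = 1") (auto simp: \<gamma>_def frac_eq[THEN iffD2])
  then have f: "primitive_along X A \<eta> \<gamma> f"
    by (intro primitive_along_cong[OF _ \<gamma>0(3)]) simp
  have path: "pathin X \<gamma>"
    using \<gamma> by (auto simp: pathin_def closed_curve_def intro: continuous_map_from_subtopology)
  have J\<gamma>: "closed_curve X (J \<circ> \<gamma>)"
    using \<gamma> continuous_map_J by (auto simp: closed_curve_def intro: continuous_map_compose)
  let ?C = "curve_cycle 1 \<gamma> - curve_cycle 1 (J \<circ> \<gamma>)"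
  have "chain_integral X A \<eta> ?C = 0"
  proof -
    have "rcycle1 X ?C" by (intro rcycle1_diff rcycle1_curve_cycle \<gamma> J\<gamma>)
    moreover have "homologous1 X ?C (curve_cycle 1 \<gamma> - rchain_map 1 J (curve_cycle 1 \<gamma>))"
      unfolding rchain_map_curve_cycle by (rule homologous1_refl)
    ultimately have "odd_cycle X J ?C"
      using rcycle1_curve_cycle[OF \<gamma>] unfolding odd_cycle_def by blast
    moreover have "has_intersection_number X A ?C (curve_cycle 1 R) 0"
      if R: "oriented_real_oval X J R" for R
    proof -
      from R have "range R \<subseteq> topspace (subtopology X {x \<in> topspace X. J x = x})"
        unfolding oriented_real_oval_def real_ovals_def by (intro connected_components_of_subset) auto
      then have "J (R t) = R t" for t by auto
      then have "\<gamma> s \<noteq> R t" "J (\<gamma> s) \<noteq> R t" for s t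
        using nonreal[of s] J_J by force+
      then show "has_intersection_number X A ?C (curve_cycle 1 R) 0"
        using R \<gamma> J\<gamma> by (intro has_intersection_number_disjoint) (auto simp: oriented_real_oval_def)
    qed
    ultimately show ?thesis using periods unfolding odd_periods_vanish_def by blast
  qed
  moreover have "path_integral_form X A \<eta> \<gamma> = f 1 - f 0"
    by (rule path_integral_form_eq[OF path f])
  moreover have "path_integral_form X A \<eta> (J \<circ> \<gamma>) = cnj (f 1) - cnj (f 0)"
    using path_integral_form_eq[OF pathin_compose[OF path continuous_map_J] primitive_along_conjugate[OF path f]]
    by simp
  ultimately have "(f 1 - f 0) - cnj (f 1 - f 0) = 0"
    by (simp add: chain_integral_diff chain_integral_curve_cycle)
  then show ?thesis using \<gamma>0(6) by (auto simp: complex_eq_iff)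
qed

text \<open>On real ovals the height is not determined by paths in their complement. The value \<open>0\<close> there makes
  \<open>h\<close> differ from a local height by a constant on an oval too.\<close>

definition height_function :: "('a \<Rightarrow> real) \<Rightarrow> bool" where
  "height_function h \<longleftrightarrow>
     (\<forall>x y k. height_change nonreal x y k \<longrightarrow> h y - h x = k) \<and> (\<forall>x. J x = x \<longrightarrow> h x = 0)"

lemma height_function_exists:
  assumes odd_periods_vanish
  obtains h where "height_function h"
proof -
  obtain h where h: "\<And>x y k. height_change nonreal x y k \<Longrightarrow> h y - h x = k"
  proof (rule potential_exists[of nonreal])
    fix x k assume "height_change nonreal x x k"
    then show "k = 0" by (rule loop_height_change_zero[OF assms])
  qed (rule that)
  have J: "J x \<noteq> x \<and> J y \<noteq> y" if xy: "height_change nonreal x y k" for x y k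
  proof -
    obtain \<gamma> where "\<gamma> \<in> {0..1} \<rightarrow> nonreal" "\<gamma> (0::real) = x" "\<gamma> 1 = y"
      using xy unfolding height_change_def by blast
    then show ?thesis using funcset_mem[of \<gamma> "{0..1}" nonreal 0] funcset_mem[of \<gamma> "{0..1}" nonreal 1] by simp
  qed
  have "height_function (\<lambda>x. if J x = x then 0 else h x)"
    unfolding height_function_def
  proof (intro conjI allI impI)
    fix x y k assume "height_change nonreal x y k"
    from J[OF this] h[OF this]
    show "(if J y = y then 0 else h y) - (if J x = x then 0 else h x) = k" by simp
  qed simp
  then show ?thesis by (rule that)
qed

text \<open>The image of a segment of the convex set \<open>S\<close> is a path along which \<open>h\<close> and \<open>Im F\<close> change alike.\<close>

lemma height_minus_primitive_constant:
  assumes h: "height_function h"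
    and G: "disc_coordinate f G r" and F: "local_primitive X A \<eta> U F"
    and S: "convex S" "S \<subseteq> ball 0 r" "G ` S \<subseteq> U \<inter> nonreal" and "z \<in> S" "w \<in> S"
  shows "h (G z) - Im (F (G z)) = h (G w) - Im (F (G w))"
proof -
  have seg: "linepath z w t \<in> S" if "t \<in> {0..1}" for t
    using linepath_in_path[OF that, of z w] closed_segment_subset[OF \<open>z \<in> S\<close> \<open>w \<in> S\<close> S(1)] by blast
  have "continuous_map (top_of_set {0..1}) (top_of_set (ball 0 r)) (linepath z w)"
    using seg S(2) unfolding continuous_map_in_subtopology
    by (auto simp: continuous_on_linepath simp del: mem_ball_0)
  then have "pathin X (G \<circ> linepath z w)"
    unfolding pathin_def by (rule continuous_map_compose) (use G in \<open>simp add: disc_coordinate_def\<close>)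
  then have "height_change nonreal (G z) (G w) (Im (F (G w)) - Im (F (G z)))"
  proof (rule height_change_in_primitive_domain[OF F])
    show "G \<circ> linepath z w \<in> {0..1} \<rightarrow> U \<inter> nonreal"
      using seg S(3) unfolding Pi_iff comp_def by blast
  qed (simp_all add: linepath_0' linepath_1')
  then show ?thesis using h by (force simp: height_function_def)
qed

text \<open>Near a fixed point the involution is complex conjugation in the coordinate \<open>\<alpha> z + cnj (\<alpha> J(z))\<close>,
  where \<open>z\<close> is a coordinate centred at the point; it is a coordinate for \<open>\<alpha> = 1\<close> or for \<open>\<alpha> = \<i>\<close>.\<close>

lemma real_coordinate_exists:
  assumes p: "p \<in> topspace X" "J p = p" and W: "openin X W" "p \<in> W"
  obtains f G r where "disc_coordinate f G r" "G 0 = p" "G ` ball 0 r \<subseteq> W"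
    "\<And>x. x \<in> G ` ball 0 r \<Longrightarrow> J x = x \<longleftrightarrow> Im (f x) = 0"
proof -
  obtain c where c: "c \<in> A" "p \<in> cdom c" using chart_at p by blast
  let ?h = "cnj \<circ> coord c \<circ> J \<circ> cinv c" and ?z = "coord c p"
  let ?D = "{x \<in> cdom c. J x \<in> cdom c}"
  let ?S = "coord c ` ?D"
  have D: "openin X ?D"
  proof -
    have "?D = cdom c \<inter> {x \<in> topspace X. J x \<in> cdom c}" using cdom_subset[OF c(1)] by auto
    then show ?thesis
      using openin_Int[OF openin_cdom[OF c(1)] openin_J_preimage[OF openin_cdom[OF c(1)]]] by simp
  qed
  have WD: "openin X (W \<inter> ?D)" "p \<in> W \<inter> ?D"
    using openin_Int[OF W(1) D] W(2) c(2) p(2) by simp_all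
  have zS: "?z \<in> ?S" using c p by auto
  have S: "open ?S" and hol: "?h holomorphic_on ?S"
    using J_chart_holomorphic[OF c(1) c(1)] by auto
  obtain \<alpha> :: complex where \<alpha>: "\<alpha> + cnj \<alpha> * deriv ?h ?z \<noteq> 0"
  proof (cases "deriv ?h ?z = - 1")
    case True
    then show ?thesis by (intro that[of \<i>]) simp
  next
    case False
    then show ?thesis by (intro that[of 1]) (simp add: add_eq_0_iff)
  qed
  define \<phi> where "\<phi> z = \<alpha> * (z - ?z) + cnj \<alpha> * (?h z - cnj ?z)" for z
  have \<phi>_hol: "\<phi> holomorphic_on ?S" unfolding \<phi>_def by (intro holomorphic_intros hol)
  have "(\<phi> has_field_derivative \<alpha> * (1 - 0) + cnj \<alpha> * (deriv ?h ?z - 0)) (at ?z)"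
    unfolding \<phi>_def
    by (intro DERIV_add DERIV_cmult DERIV_diff DERIV_ident DERIV_const holomorphic_derivI[OF hol S zS])
  then have "deriv \<phi> ?z \<noteq> 0" using \<alpha> by (simp add: DERIV_imp_deriv)
  moreover have "\<phi> ?z = 0" using c p by (simp add: \<phi>_def)
  ultimately obtain G r where G: "disc_coordinate (\<phi> \<circ> coord c) G r" "G 0 = p" "G ` ball 0 r \<subseteq> W \<inter> ?D \<inter> cdom c"
    using disc_coordinate_exists[OF c WD \<phi>_hol S zS] by blast
  let ?f = "\<phi> \<circ> coord c"
  have sym: "?f (J x) = cnj (?f x)" if "x \<in> ?D" for x
  proof -
    have "J (J x) = x" using that cdom_subset[OF c(1)] by (auto intro: J_J)
    then show ?thesis using that c(1) by (simp add: \<phi>_def algebra_simps)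
  qed
  have "r > 0" using G(1) by (simp add: disc_coordinate_def)
  let ?B = "G ` ball 0 r"
  have B: "openin X ?B" using G(1) by (simp add: disc_coordinate_def)
  have "p \<in> ?B" using \<open>r > 0\<close> unfolding G(2)[symmetric] by (intro imageI) simp
  then have "openin X (?B \<inter> {x \<in> topspace X. J x \<in> ?B})" "G 0 \<in> ?B \<inter> {x \<in> topspace X. J x \<in> ?B}"
    using openin_Int[OF B openin_J_preimage[OF B]] p G(2) by auto
  then obtain s where s: "0 < s" "s \<le> r" "disc_coordinate ?f G s"
    "G ` ball 0 s \<subseteq> ?B \<inter> {x \<in> topspace X. J x \<in> ?B}"
    by (rule disc_coordinate_shrink[OF G(1)])
  have inj: "x = y" if "x \<in> ?B" "y \<in> ?B" "?f x = ?f y" for x y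
    using that G(1) unfolding disc_coordinate_def by auto
  have "J x = x \<longleftrightarrow> Im (?f x) = 0" if "x \<in> G ` ball 0 s" for x
  proof -
    have x: "x \<in> ?B" "J x \<in> ?B" "x \<in> ?D" using that s(4) G(3) by blast+
    have "J x = x \<longleftrightarrow> ?f (J x) = ?f x" using inj[OF x(2,1)] by auto
    also have "\<dots> \<longleftrightarrow> Im (?f x) = 0" unfolding sym[OF x(3)] by (simp add: complex_eq_iff)
    finally show ?thesis .
  qed
  then show ?thesis
    using s(3,4) G(2,3) by (intro that[of ?f G s]) blast+
qed

text \<open>Near a fixed point the constants are one for each of the two half discs and one for the oval itself.
  The point \<open>p\<close> may be a zero of \<open>\<eta>\<close>, where \<open>Im F\<close> is not a coordinate; hence the half discs are taken in the
  coordinate of the preceding lemma.\<close>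

lemma height_jumps_finite:
  assumes h: "height_function h" and p: "p \<in> topspace X"
  obtains U F K where "p \<in> U" "local_primitive X A \<eta> U F" "finite K" "\<And>x. x \<in> U \<Longrightarrow> h x - Im (F x) \<in> K"
proof -
  obtain U F where F: "p \<in> U" "local_primitive X A \<eta> U F" using local_primitive_exists[OF p] .
  have U: "openin X U" using local_primitive_openin[OF F(2)] .
  show ?thesis
  proof (cases "J p = p")
    case False
    obtain c where c: "c \<in> A" "p \<in> cdom c" using chart_at p by blast
    have W: "openin X (U \<inter> nonreal)" "p \<in> U \<inter> nonreal"
      using openin_Int[OF U openin_nonreal] F(1) p False by auto
    have hol: "(\<lambda>z. z - coord c p) holomorphic_on UNIV" by (intro holomorphic_intros)
    obtain G r where G: "disc_coordinate ((\<lambda>z. z - coord c p) \<circ> coord c) G r" "G 0 = p"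
      "G ` ball 0 r \<subseteq> (U \<inter> nonreal) \<inter> cdom c"
      by (rule disc_coordinate_exists[OF c W hol open_UNIV UNIV_I]) simp_all
    have r: "r > 0" and B: "openin X (G ` ball 0 r)" using G(1) by (auto simp: disc_coordinate_def)
    have G3: "G ` ball 0 r \<subseteq> U \<inter> nonreal" using G(3) by blast
    show ?thesis
    proof (rule that[of "G ` ball 0 r" F "{h p - Im (F p)}"])
      show "p \<in> G ` ball 0 r" using r unfolding G(2)[symmetric] by (intro imageI) simp
      show "local_primitive X A \<eta> (G ` ball 0 r) F"
        using local_primitive_subset[OF F(2) B] G3 by blast
      fix x assume "x \<in> G ` ball 0 r"
      then obtain z where "z \<in> ball 0 r" "x = G z" by blast
      then show "h x - Im (F x) \<in> {h p - Im (F p)}"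
        using height_minus_primitive_constant[OF h G(1) F(2) convex_ball order_refl G3, where z = z and w = 0] r G(2)
        by simp
    qed simp
  next
    case True
    have "local_primitive X A \<eta> {x \<in> topspace X. J x \<in> U} (\<lambda>x. cnj (F (J x)))"
      by (rule conjugate_local_primitive[OF F(2)])
    moreover have "p \<in> {x \<in> topspace X. J x \<in> U}" using p True F(1) by simp
    ultimately obtain V where V: "openin X V" "p \<in> V" "V \<subseteq> U \<inter> {x \<in> topspace X. J x \<in> U}"
      "\<And>y. y \<in> V \<Longrightarrow> F y - cnj (F (J y)) = F p - cnj (F (J p))"
      by (rule local_primitives_differ_by_const[OF F(2) _ F(1)]) (rule that)
    have on_real: "Im (F y) = Im (F p)" if "y \<in> V" "J y = y" for y
      using V(4)[OF that(1)] that(2) True by (simp add: complex_eq_iff)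
    obtain f G r where G: "disc_coordinate f G r" "G 0 = p" "G ` ball 0 r \<subseteq> V"
      "\<And>x. x \<in> G ` ball 0 r \<Longrightarrow> J x = x \<longleftrightarrow> Im (f x) = 0"
      by (rule real_coordinate_exists[OF p True V(1,2)]) (rule that)
    have r: "r > 0" and B: "openin X (G ` ball 0 r)" and f: "\<And>z. z \<in> ball 0 r \<Longrightarrow> f (G z) = z"
      using G(1) by (auto simp: disc_coordinate_def)
    have real_iff: "J (G z) = G z \<longleftrightarrow> Im z = 0" if "z \<in> ball 0 r" for z
      using G(4)[OF imageI[OF that]] f[OF that] by simp
    have in_U: "G z \<in> U \<inter> topspace X" if "z \<in> ball 0 r" for z
      using G(3) V(3) imageI[OF that, of G] by blast
    let ?up = "ball 0 r \<inter> {z. Im z > 0}" and ?low = "ball 0 r \<inter> {z. Im z < 0}"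
    have conv: "convex ?up" "convex ?low"
      by (intro convex_Int convex_ball convex_halfspace_Im_gt convex_halfspace_Im_lt)+
    have sub: "G ` ?up \<subseteq> U \<inter> nonreal" "G ` ?low \<subseteq> U \<inter> nonreal"
      using real_iff in_U by force+
    let ?i = "\<i> * of_real (r / 2)"
    have i: "?i \<in> ?up" "- ?i \<in> ?low" using r by (auto simp: norm_mult)
    let ?K = "{- Im (F p), h (G ?i) - Im (F (G ?i)), h (G (- ?i)) - Im (F (G (- ?i)))}"
    show ?thesis
    proof (rule that[of "G ` ball 0 r" F ?K])
      show "p \<in> G ` ball 0 r" using r unfolding G(2)[symmetric] by (intro imageI) simp
      show "local_primitive X A \<eta> (G ` ball 0 r) F"
        using local_primitive_subset[OF F(2) B] G(3) V(3) by blast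
      fix x assume "x \<in> G ` ball 0 r"
      then obtain z where z: "z \<in> ball 0 r" "x = G z" by blast
      consider "Im z = 0" | "z \<in> ?up" | "z \<in> ?low" using z(1) by force
      then show "h x - Im (F x) \<in> ?K"
      proof cases
        case 1
        then have "J x = x" "x \<in> V" using real_iff z G(3) by auto
        then show ?thesis using h on_real by (simp add: height_function_def)
      next
        case 2
        then show ?thesis
          using height_minus_primitive_constant[OF h G(1) F(2) conv(1) _ sub(1) _ i(1), where z = z] z by simp
      next
        case 3
        then show ?thesis
          using height_minus_primitive_constant[OF h G(1) F(2) conv(2) _ sub(2) _ i(2), where z = z] z by simp
      qed
    qed simp
  qed
qed

end

section \<open>Zeros of a nonzero differential\<close>

context riemann_surface_form
begin

lemma zeros_subset: "zeros A \<eta> \<subseteq> topspace X"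
  unfolding zeros_def using cdom_subset by blast

text \<open>By the identity theorem, the interior of the set of zeros and the set of points near which there is at most
  one zero are open, disjoint, and cover the surface.\<close>

lemma zeros_isolated:
  assumes nz: "nonzero_differential A \<eta>" and x: "x \<in> topspace X"
  obtains W where "openin X W" "x \<in> W" "W \<inter> zeros A \<eta> \<subseteq> {x}"
proof -
  define V where "V = \<Union>{W. openin X W \<and> W \<subseteq> zeros A \<eta>}"
  define E where "E = {x \<in> topspace X. \<exists>W. openin X W \<and> x \<in> W \<and> W \<inter> zeros A \<eta> \<subseteq> {x}}"
  have nonzero_in_E: "x \<in> E" if "x \<in> topspace X" "x \<notin> zeros A \<eta>" for x
    unfolding E_def using that openin_diff_zeros by blast
  have "openin X V" unfolding V_def by (intro openin_Union) auto
  moreover have "openin X E"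
  proof (subst openin_subopen, intro ballI)
    fix x assume "x \<in> E"
    then obtain W where W: "openin X W" "x \<in> W" "W \<inter> zeros A \<eta> \<subseteq> {x}" unfolding E_def by blast
    then have "W \<subseteq> E" using nonzero_in_E \<open>x \<in> E\<close> openin_subset[OF W(1)] by blast
    with W show "\<exists>T. openin X T \<and> x \<in> T \<and> T \<subseteq> E" by blast
  qed
  moreover have "topspace X \<subseteq> V \<union> E"
  proof
    fix x assume x: "x \<in> topspace X"
    then obtain c where c: "c \<in> A" "x \<in> cdom c" using chart_at by blast
    then obtain r where r: "r > 0" "ball (coord c x) r \<subseteq> coord c ` cdom c"
      using openE[OF open_coord_cdom[OF c(1)], of "coord c x"] by auto
    have hol: "\<eta> c holomorphic_on ball (coord c x) r"
      using coefficient_holomorphic[OF c(1)] r(2) holomorphic_on_subset by blast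
    have nbhd: "openin X {y \<in> cdom c. coord c y \<in> ball (coord c x) s}" for s
      by (rule openin_coord_preimage[OF c(1) open_ball])
    show "x \<in> V \<union> E"
    proof (cases "x \<in> zeros A \<eta> \<and> (\<exists>\<beta>\<in>ball (coord c x) r. \<eta> c \<beta> \<noteq> 0)")
      case True
      then obtain \<beta> where \<beta>: "\<beta> \<in> ball (coord c x) r" "\<eta> c \<beta> \<noteq> 0" "\<eta> c (coord c x) = 0"
        using zeros_iff[OF c] by blast
      have "coord c x \<in> ball (coord c x) r" using r(1) by simp
      then obtain s where s: "s > 0" "\<And>z. z \<in> ball (coord c x) s - {coord c x} \<Longrightarrow> \<eta> c z \<noteq> 0"
        by (rule isolated_zeros[OF hol open_ball connected_ball _ \<beta>(3,1,2)]) blast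
      have "{y \<in> cdom c. coord c y \<in> ball (coord c x) s} \<inter> zeros A \<eta> \<subseteq> {x}"
      proof
        fix y assume y: "y \<in> {y \<in> cdom c. coord c y \<in> ball (coord c x) s} \<inter> zeros A \<eta>"
        then have "coord c y = coord c x" using s(2)[of "coord c y"] zeros_iff[OF c(1), of y] by blast
        then show "y \<in> {x}" using inj_onD[OF inj_on_coord[OF c(1)]] y c(2) by blast
      qed
      moreover have "x \<in> {y \<in> cdom c. coord c y \<in> ball (coord c x) s}" using c s(1) by simp
      ultimately have "x \<in> E" unfolding E_def using x nbhd by blast
      then show ?thesis by blast
    next
      case False
      then consider "x \<notin> zeros A \<eta>" | "\<forall>\<beta>\<in>ball (coord c x) r. \<eta> c \<beta> = 0" by blast
      then show ?thesis
      proof cases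
        case 1
        then show ?thesis using nonzero_in_E x by blast
      next
        case 2
        then have "{y \<in> cdom c. coord c y \<in> ball (coord c x) r} \<subseteq> zeros A \<eta>"
          using zeros_iff[OF c(1)] by blast
        moreover have "x \<in> {y \<in> cdom c. coord c y \<in> ball (coord c x) r}" using c r(1) by simp
        ultimately have "x \<in> V" unfolding V_def using nbhd by blast
        then show ?thesis by blast
      qed
    qed
  qed
  moreover have "V \<inter> E = {}"
  proof (rule ccontr)
    assume "V \<inter> E \<noteq> {}"
    then obtain x W W' where W: "openin X W" "W \<subseteq> zeros A \<eta>" "x \<in> W"
      "openin X W'" "W' \<inter> zeros A \<eta> \<subseteq> {x}" "x \<in> W'" "x \<in> topspace X"
      unfolding V_def E_def by blast
    then obtain c where c: "c \<in> A" "x \<in> cdom c" using chart_at by blast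
    have "W \<inter> W' \<inter> cdom c = {x}" using W c by blast
    moreover have "openin X (W \<inter> W' \<inter> cdom c)"
      using W openin_cdom[OF c(1)] by (intro openin_Int)
    ultimately have "open (coord c ` {x})" using open_coord_image[OF c(1), of "{x}"] c(2) by simp
    then show False by (simp add: not_open_singleton)
  qed
  moreover have "E \<noteq> {}"
  proof -
    obtain c z where "c \<in> A" "z \<in> coord c ` cdom c" "\<eta> c z \<noteq> 0"
      using nz unfolding nonzero_differential_def by blast
    then obtain y where "c \<in> A" "y \<in> cdom c" "\<eta> c (coord c y) \<noteq> 0" by blast
    then show ?thesis using nonzero_in_E[of y] cdom_subset zeros_iff by blast
  qed
  moreover have "connected_space X" using surface by (simp add: riemann_surface_def)
  ultimately have "V = {}" unfolding connected_space_def by blast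
  then have "x \<in> E" using \<open>topspace X \<subseteq> V \<union> E\<close> x by blast
  then show ?thesis unfolding E_def using that by blast
qed

lemma finite_zeros:
  assumes "nonzero_differential A \<eta>" "compact_space X"
  shows "finite (zeros A \<eta>)"
proof -
  let ?\<U> = "{W. openin X W \<and> finite (W \<inter> zeros A \<eta>)}"
  have "topspace X \<subseteq> \<Union>?\<U>"
  proof
    fix x assume "x \<in> topspace X"
    then obtain W where W: "openin X W" "x \<in> W" "W \<inter> zeros A \<eta> \<subseteq> {x}"
      by (rule zeros_isolated[OF assms(1)])
    then have "W \<in> ?\<U>" using finite_subset[OF W(3)] by simp
    then show "x \<in> \<Union>?\<U>" using W(2) by blast
  qed
  then obtain \<F> where \<F>: "finite \<F>" "\<F> \<subseteq> ?\<U>" "topspace X \<subseteq> \<Union>\<F>"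
    using compactinD[of X "topspace X" ?\<U>] assms(2) by (auto simp: compact_space_def)
  then have "zeros A \<eta> \<subseteq> (\<Union>W\<in>\<F>. W \<inter> zeros A \<eta>)" using zeros_subset by blast
  moreover have "finite (\<Union>W\<in>\<F>. W \<inter> zeros A \<eta>)" using \<F> by blast
  ultimately show ?thesis by (rule finite_subset)
qed

end

section \<open>Cluster points of a curve at infinity\<close>

definition cluster_point :: "'a topology \<Rightarrow> (real \<Rightarrow> 'a) \<Rightarrow> 'a \<Rightarrow> bool" where
  "cluster_point X \<gamma> p \<longleftrightarrow> (\<forall>W N. openin X W \<longrightarrow> p \<in> W \<longrightarrow> (\<exists>t>N. \<gamma> t \<in> W))"

text \<open>Otherwise finitely many open sets, each of which the curve eventually avoids, would cover \<open>K\<close>.\<close>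

lemma cluster_point_in_compact:
  assumes K: "compactin X K" and \<gamma>: "\<And>N. \<exists>t>N. \<gamma> t \<in> K"
  shows "\<exists>p\<in>K. cluster_point X \<gamma> p"
proof (rule ccontr)
  assume no_cluster: "\<not> (\<exists>p\<in>K. cluster_point X \<gamma> p)"
  let ?\<U> = "{W. openin X W \<and> (\<exists>N. \<forall>t>N. \<gamma> t \<notin> W)}"
  have "K \<subseteq> \<Union>?\<U>"
  proof
    fix p assume "p \<in> K"
    with no_cluster have "\<not> cluster_point X \<gamma> p" by simp
    then obtain W N where W: "openin X W" "p \<in> W" "\<forall>t>N. \<gamma> t \<notin> W"
      by (auto simp: cluster_point_def)
    then have "W \<in> ?\<U>" by auto
    with W(2) show "p \<in> \<Union>?\<U>" by (rule UnionI[rotated])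
  qed
  then obtain \<F> where \<F>: "finite \<F>" "\<F> \<subseteq> {W. openin X W \<and> (\<exists>N. \<forall>t>N. \<gamma> t \<notin> W)}" "K \<subseteq> \<Union>\<F>"
    using compactinD[OF K, of "{W. openin X W \<and> (\<exists>N. \<forall>t>N. \<gamma> t \<notin> W)}"] by auto
  then have "\<forall>W\<in>\<F>. \<forall>\<^sub>F t in at_top. \<gamma> t \<notin> W"
    unfolding eventually_at_top_dense by auto
  then have "\<forall>\<^sub>F t in at_top. \<forall>W\<in>\<F>. \<gamma> t \<notin> W"
    using \<F>(1) by (rule eventually_ball_finite[rotated])
  then obtain N where "\<forall>t>N. \<forall>W\<in>\<F>. \<gamma> t \<notin> W"
    unfolding eventually_at_top_dense by blast
  with \<gamma>[of N] \<F>(3) show False by blast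
qed

text \<open>A closed neighbourhood \<open>C\<close> of \<open>p\<close> without other cluster points has an open kernel \<open>V\<close>; the curve
  eventually avoids the compact set \<open>C - V\<close>, so it cannot leave \<open>V\<close> any more.\<close>

lemma limit_of_finitely_many_cluster_points:
  assumes X: "compact_space X" "Hausdorff_space X" and \<gamma>: "continuous_map euclideanreal X \<gamma>"
    and Z: "finite Z" "\<And>p. p \<in> topspace X \<Longrightarrow> cluster_point X \<gamma> p \<Longrightarrow> p \<in> Z"
    and p: "p \<in> topspace X" "cluster_point X \<gamma> p"
  shows "limitin X \<gamma> p at_top"
  unfolding limitin_def
proof (intro conjI allI impI p(1))
  fix W assume W: "openin X W \<and> p \<in> W"
  have "closedin X (topspace X \<inter> (Z - {p}))"
    using Z(1) Hausdorff_imp_t1_space[OF X(2)] by (simp add: t1_space_closedin_finite)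
  then have W': "openin X (W - topspace X \<inter> (Z - {p}))" "p \<in> W - topspace X \<inter> (Z - {p})"
    using W by auto
  have "neighbourhood_base_of (closedin X) X"
    using compact_Hausdorff_imp_regular_space[OF X] by (simp add: neighbourhood_base_of_closedin)
  with W' obtain V C where V: "openin X V" "closedin X C" "p \<in> V" "V \<subseteq> C" "C \<subseteq> W - topspace X \<inter> (Z - {p})"
    unfolding neighbourhood_base_of by meson
  have "compactin X (C - V)"
    using V X(1) by (intro closedin_compact_space closedin_diff)
  moreover have "\<not> cluster_point X \<gamma> x" if "x \<in> C - V" for x
    using that Z(2)[of x] V closedin_subset by fast
  ultimately obtain N where N: "\<And>t. t > N \<Longrightarrow> \<gamma> t \<notin> C - V"
    using cluster_point_in_compact[of X "C - V" \<gamma>] by metis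
  obtain t0 where t0: "t0 > N" "\<gamma> t0 \<in> V"
    using p(2) V(1,3) unfolding cluster_point_def by blast
  have "\<gamma> t \<in> V" if "t > N" for t
  proof -
    have "(\<gamma> t0 \<in> V) = (\<gamma> t \<in> V)"
    proof (rule connected_local_const[of "{N<..}" t0 t "\<lambda>t. \<gamma> t \<in> V"])
      show "\<forall>t\<in>{N<..}. \<forall>\<^sub>F s in at t within {N<..}. (\<gamma> t \<in> V) = (\<gamma> s \<in> V)"
      proof
        fix t assume t: "t \<in> {N<..}"
        have cont: "continuous_map (top_of_set {N<..}) X \<gamma>"
          using \<gamma> by (rule continuous_map_from_subtopology)
        show "\<forall>\<^sub>F s in at t within {N<..}. (\<gamma> t \<in> V) = (\<gamma> s \<in> V)"
        proof (cases "\<gamma> t \<in> V")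
          case True
          from continuous_map_eventually_in_openin[OF cont t V(1) this]
          show ?thesis by eventually_elim (use True in simp)
        next
          case False
          then have "\<gamma> t \<in> topspace X - C"
            using N t \<gamma> by (auto simp: continuous_map)
          from continuous_map_eventually_in_openin[OF cont t openin_diff[OF openin_topspace V(2)] this]
          show ?thesis by eventually_elim (use False V(4) in auto)
        qed
      qed
    qed (use that t0 in auto)
    with t0 show ?thesis by simp
  qed
  then show "\<forall>\<^sub>F t in at_top. \<gamma> t \<in> W"
    unfolding eventually_at_top_dense using V(4,5) by blast
qed

section \<open>Leaves meet flow boxes in finitely many heights\<close>

context real_riemann_surface_form
begin

text \<open>At a fixed point \<open>p\<close> that is not a zero, \<open>J\<close> is complex conjugation in the natural coordinate centred at
  \<open>p\<close>, so it fixes the horizontal line through \<open>p\<close>.\<close>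

lemma horizontal_curve_real_or_nonreal:
  assumes \<gamma>: "horizontal_curve X A q \<gamma>"
  shows "J (\<gamma> s) = \<gamma> s \<longleftrightarrow> J (\<gamma> t) = \<gamma> t"
proof (rule connected_local_const[of UNIV s t "\<lambda>t. J (\<gamma> t) = \<gamma> t"])
  show "\<forall>t\<in>UNIV. \<forall>\<^sub>F s in at t. (J (\<gamma> t) = \<gamma> t) = (J (\<gamma> s) = \<gamma> s)"
  proof
    fix t
    let ?p = "\<gamma> t"
    have p: "?p \<in> topspace X" "?p \<notin> zeros A \<eta>" using horizontal_curve_in_topspace[OF \<gamma>] by blast+
    have "\<forall>\<^sub>F s in nhds t. (J (\<gamma> t) = \<gamma> t) = (J (\<gamma> s) = \<gamma> s)"
    proof (cases "J ?p = ?p")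
      case False
      then have "?p \<in> nonreal" using p by simp
      from horizontal_curve_eventually_in[OF \<gamma> openin_nonreal this]
      show ?thesis by eventually_elim (use False in simp)
    next
      case True
      obtain U F where F: "?p \<in> U" "local_primitive X A \<eta> U F" using local_primitive_exists[OF p(1)] .
      have "local_primitive X A \<eta> {x \<in> topspace X. J x \<in> U} (\<lambda>x. cnj (F (J x)))"
        by (rule conjugate_local_primitive[OF F(2)])
      moreover have "?p \<in> {x \<in> topspace X. J x \<in> U}" using p True F(1) by simp
      ultimately obtain V where V: "openin X V" "?p \<in> V" "V \<subseteq> U \<inter> {x \<in> topspace X. J x \<in> U}"
        "\<And>y. y \<in> V \<Longrightarrow> F y - cnj (F (J y)) = F ?p - cnj (F (J ?p))"
        by (rule local_primitives_differ_by_const[OF F(2) _ F(1)]) (rule that)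
      have "V \<subseteq> U" using V(3) by blast
      obtain G r where G: "flow_box (\<lambda>x. F x - F ?p) G r" "G 0 = ?p" "G ` ball 0 r \<subseteq> V"
        using flow_box_exists[OF p(2) local_primitive_subset[OF F(2) V(1) \<open>V \<subseteq> U\<close>] V(2)] .
      let ?B = "G ` ball 0 r"
      have B: "openin X ?B" using local_primitive_openin[OF flow_box_primitive[OF G(1)]] .
      have pB: "?p \<in> ?B" using flow_box_pos[OF G(1)] unfolding G(2)[symmetric] by (intro imageI) simp
      have "?p \<in> {x \<in> topspace X. J x \<in> ?B}" using p(1) pB True by simp
      from horizontal_curve_eventually_in[OF \<gamma> openin_J_preimage[OF B] this]
        horizontal_curve_height_locally_constant[OF \<gamma> flow_box_primitive[OF G(1)] pB]
      show ?thesis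
      proof eventually_elim
        case (elim s)
        let ?x = "\<gamma> s"
        have x: "?x \<in> ?B" "J ?x \<in> ?B" "Im (F ?x) = Im (F ?p)" using elim by auto
        have "F (J ?x) - F ?p = cnj (F ?x - F ?p)"
          using V(4)[of ?x] x(1) G(3) True by (auto simp: complex_eq_iff)
        also have "\<dots> = F ?x - F ?p" using x(3) by (simp add: complex_eq_iff)
        finally have "J ?x = ?x"
          using flow_box_height_inj(1)[OF G(1) x(1)] flow_box_height_inj(1)[OF G(1) x(2)] by simp
        with True show ?case by simp
      qed
    qed
    then show "\<forall>\<^sub>F s in at t. (J (\<gamma> t) = \<gamma> t) = (J (\<gamma> s) = \<gamma> s)"
      by (simp add: eventually_at_filter eventually_mono)
  qed
qed auto

lemma height_function_constant_on_horizontal_curve: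
  assumes h: "height_function h" and \<gamma>: "horizontal_curve X A q \<gamma>"
  shows "h (\<gamma> s) = h (\<gamma> t)"
proof (cases "J (\<gamma> s) = \<gamma> s")
  case True
  then show ?thesis
    using h horizontal_curve_real_or_nonreal[OF \<gamma>, of s t] by (simp add: height_function_def)
next
  case False
  then have nonreal: "\<gamma> u \<in> nonreal" for u
    using horizontal_curve_real_or_nonreal[OF \<gamma>, of s u] horizontal_curve_in_topspace[OF \<gamma>] by blast
  show ?thesis
  proof (rule connected_local_const[of UNIV s t "\<lambda>t. h (\<gamma> t)"])
    show "\<forall>t\<in>UNIV. \<forall>\<^sub>F s in at t. h (\<gamma> t) = h (\<gamma> s)"
    proof
      fix t
      have "\<gamma> t \<in> topspace X" using nonreal[of t] by simp
      then obtain U F where F: "\<gamma> t \<in> U" "local_primitive X A \<eta> U F" using local_primitive_exists by blast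
      have "\<forall>\<^sub>F s in nhds t. \<gamma> s \<in> U \<and> Im (F (\<gamma> s)) = Im (F (\<gamma> t))"
        by (rule horizontal_curve_height_locally_constant[OF \<gamma> F(2,1)])
      then obtain e where e: "e > 0" "\<And>s. dist s t < e \<Longrightarrow> \<gamma> s \<in> U \<and> Im (F (\<gamma> s)) = Im (F (\<gamma> t))"
        unfolding eventually_nhds_metric by blast
      have "h (\<gamma> t) = h (\<gamma> s)" if s: "dist s t < e" for s
      proof -
        have seg: "dist (linepath t s u) t < e" if "u \<in> {0..1}" for u
          using linepath_in_path[OF that, of t s] closed_segment_subset[OF _ _ convex_ball, of t t e s] s e(1)
          by (auto simp: dist_commute)
        have "continuous_map (top_of_set {0..1}) euclideanreal (linepath t s)"
          by (simp add: continuous_on_linepath)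
        then have path: "pathin X (\<gamma> \<circ> linepath t s)"
          unfolding pathin_def by (rule continuous_map_compose) (use \<gamma> in \<open>simp add: horizontal_curve_def\<close>)
        have "height_change nonreal (\<gamma> t) (\<gamma> s) (Im (F (\<gamma> s)) - Im (F (\<gamma> t)))"
        proof (rule height_change_in_primitive_domain[OF F(2) path])
          show "\<gamma> \<circ> linepath t s \<in> {0..1} \<rightarrow> U \<inter> nonreal"
            using seg e(2) nonreal by (simp add: Pi_iff)
        qed (simp_all add: linepath_0' linepath_1')
        then have "h (\<gamma> s) - h (\<gamma> t) = Im (F (\<gamma> s)) - Im (F (\<gamma> t))"
          using h unfolding height_function_def by blast
        then show ?thesis using e(2)[OF s] by simp
      qed
      then show "\<forall>\<^sub>F s in at t. h (\<gamma> t) = h (\<gamma> s)"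
        unfolding eventually_at using e(1) by blast
    qed
  qed auto
qed

section \<open>Leaves are closed or critical\<close>

text \<open>If the trajectory \<open>\<Phi>\<close> of the leaf is injective, then two visits to a flow box at the same height are at
  bounded distance in time, because both lie on one segment. As there are finitely many heights, the
  visits to the flow box are bounded in time; but each visit can be prolonged by a fixed time.\<close>

lemma leaf_closed_or_critical:
  assumes h: "height_function h" and X: "compact_space X" and nz: "nonzero_differential A \<eta>"
    and L: "leaf X A q L"
  shows "closed_leaf X A q L \<or> critical_leaf X A q L"
proof -
  obtain I \<Phi> where \<Phi>: "maximal_trajectory I \<Phi>" "I \<noteq> {}" "L = \<Phi> ` I"
    using leaf_is_maximal_trajectory[OF L] .
  show ?thesis
  proof (cases "inj_on \<Phi> I")
    case False
    then show ?thesis using noninjective_leaf_closed[OF L \<Phi>(1,3)] by blast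
  next
    case inj: True
    have tr: "trajectory I \<Phi>" using \<Phi>(1) by (simp add: maximal_trajectory_def)
    then have I: "open I" "is_interval I" by (auto simp: trajectory_def)
    obtain \<psi> \<psi>' where \<psi>: "range \<psi> = I" "\<And>t. (\<psi> has_real_derivative \<psi>' t) (at t)" "\<And>t. \<psi>' t > 0"
      by (rule open_interval_parametrization[OF I \<Phi>(2)]) (rule that)
    have \<psi>_mono: "\<psi> s < \<psi> t" if "s < t" for s t
      using DERIV_pos_imp_increasing[OF that, of \<psi>] \<psi>(2,3) by blast
    let ?\<gamma> = "\<Phi> \<circ> \<psi>"
    have \<gamma>: "horizontal_curve X A q ?\<gamma>"
      by (rule trajectory_reparametrized_horizontal[OF tr _ \<psi>(2,3)]) (simp add: \<psi>(1))
    have range: "range ?\<gamma> = L" using \<Phi>(3) \<psi>(1) by (metis image_comp)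
    have in_top: "?\<gamma> t \<in> topspace X" for t using horizontal_curve_in_topspace[OF \<gamma>] by blast
    have zero: "p \<in> zeros A \<eta>" if p: "p \<in> topspace X" "cluster_point X ?\<gamma> p" for p
    proof (rule ccontr)
      assume "p \<notin> zeros A \<eta>"
      obtain U F K where F: "p \<in> U" "local_primitive X A \<eta> U F" "finite K"
        "\<And>x. x \<in> U \<Longrightarrow> h x - Im (F x) \<in> K"
        by (rule height_jumps_finite[OF h p(1)]) (rule that)
      obtain G r where G: "flow_box (\<lambda>x. F x - F p) G r" "G 0 = p" "G ` ball 0 r \<subseteq> U"
        using flow_box_exists[OF \<open>p \<notin> zeros A \<eta>\<close> F(2,1)] .
      let ?F = "\<lambda>x. F x - F p"
      have r: "r > 0" using flow_box_pos[OF G(1)] .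
      let ?B = "G ` ball 0 (r / 2)"
      have B: "openin X ?B" "p \<in> ?B" "?B \<subseteq> G ` ball 0 r"
      proof -
        have "disc_coordinate ?F G (r / 2)"
          using disc_coordinate_mono[OF flow_box_disc[OF G(1)], of "r / 2"] r by simp
        then show "openin X ?B" by (simp add: disc_coordinate_def)
        show "p \<in> ?B" unfolding G(2)[symmetric] using r by (intro imageI) simp
        show "?B \<subseteq> G ` ball 0 r" using r by (intro image_mono) auto
      qed
      \<comment> \<open>From the disc of radius \<open>r / 2\<close>, a trajectory can be continued within the disc of radius \<open>r\<close>.\<close>
      define V where "V = {u \<in> I. \<Phi> u \<in> ?B}"
      have coord_V: "\<Phi> u = G (?F (\<Phi> u))" "?F (\<Phi> u) \<in> ball 0 r" "norm (?F (\<Phi> u)) < r / 2" if "u \<in> V" for u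
      proof -
        obtain z where z: "z \<in> ball 0 (r / 2)" "\<Phi> u = G z" using \<open>u \<in> V\<close> unfolding V_def by blast
        have "z \<in> ball 0 r" using z(1) r by simp
        then have "?F (\<Phi> u) = z" using flow_box_inverse[OF G(1)] z(2) by simp
        then show "\<Phi> u = G (?F (\<Phi> u))" "?F (\<Phi> u) \<in> ball 0 r" "norm (?F (\<Phi> u)) < r / 2"
          using z \<open>z \<in> ball 0 r\<close> by auto
      qed
      have advance: "u + \<tau> \<in> I \<and> \<Phi> (u + \<tau>) = G (?F (\<Phi> u) + of_real \<tau>)"
        if "u \<in> V" "?F (\<Phi> u) + of_real \<tau> \<in> ball 0 r" for u \<tau>
        by (rule maximal_trajectory_segment[OF \<Phi>(1) G(1) _ coord_V(1,2)[OF that(1)] that(2)])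
          (use that(1) in \<open>simp add: V_def\<close>)
      have recurrent: "\<exists>u'\<in>V. u' > u" if "u \<in> I" for u
      proof -
        obtain t0 where "u = \<psi> t0" using \<open>u \<in> I\<close> \<psi>(1) by blast
        moreover obtain t where "t > t0" "?\<gamma> t \<in> ?B"
          using p(2) B(1,2) unfolding cluster_point_def by blast
        ultimately show ?thesis using \<psi>_mono \<psi>(1) by (intro bexI[of _ "\<psi> t"]) (auto simp: V_def)
      qed
      define v where "v = h (?\<gamma> 0)"
      let ?V = "\<lambda>y. {u \<in> V. Im (?F (\<Phi> u)) = y}" and ?E = "(\<lambda>k. v - k - Im (F p)) ` K"
      have "V \<subseteq> (\<Union>y\<in>?E. ?V y)"
      proof
        fix u assume u: "u \<in> V"
        then obtain t where "u = \<psi> t" using \<psi>(1) unfolding V_def by blast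
        then have "h (\<Phi> u) = v"
          using height_function_constant_on_horizontal_curve[OF h \<gamma>, of t 0] by (simp add: v_def)
        moreover have "\<Phi> u \<in> U" using u B(3) G(3) unfolding V_def by blast
        ultimately have "v - Im (F (\<Phi> u)) \<in> K" using F(4) by metis
        then have "Im (?F (\<Phi> u)) \<in> ?E" by (force intro: rev_image_eqI)
        with u show "u \<in> (\<Union>y\<in>?E. ?V y)" by blast
      qed
      moreover have "bdd_above (?V y)" for y
      proof (cases "?V y = {}")
        case False
        then obtain u where u: "u \<in> ?V y" by blast
        have "u' \<le> u + r" if u': "u' \<in> ?V y" for u'
        proof -
          let ?\<tau> = "Re (?F (\<Phi> u')) - Re (?F (\<Phi> u))"
          have eq: "?F (\<Phi> u) + of_real ?\<tau> = ?F (\<Phi> u')" using u u' by (simp add: complex_eq_iff)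
          have "u + ?\<tau> \<in> I" "\<Phi> (u + ?\<tau>) = \<Phi> u'"
            using advance[of u ?\<tau>] coord_V(1,2)[of u'] u u' unfolding eq by auto
          then have "u + ?\<tau> = u'" using inj_onD[OF inj] u' unfolding V_def by blast
          moreover have "\<bar>Re (?F (\<Phi> u'))\<bar> < r / 2" "\<bar>Re (?F (\<Phi> u))\<bar> < r / 2"
            using coord_V(3)[of u] coord_V(3)[of u'] u u' abs_Re_le_cmod order_le_less_trans by blast+
          ultimately show ?thesis by linarith
        qed
        then show ?thesis by (intro bdd_aboveI[of _ "u + r"]) blast
      next
        case True
        then show ?thesis by (metis bdd_above_empty)
      qed
      then have "\<forall>y\<in>?E. bdd_above (?V y)" by (intro ballI)
      then have "bdd_above (\<Union>y\<in>?E. ?V y)" unfolding bdd_above_UN[OF finite_imageI[OF F(3)]] .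
      ultimately have bdd: "bdd_above V" by (rule bdd_above_mono[rotated])
      have "V \<noteq> {}" using recurrent \<Phi>(2) by blast
      then obtain s where s: "s \<in> V" "Sup V - r / 4 < s"
        using less_cSupD[of V "Sup V - r / 4"] r by auto
      have "norm (?F (\<Phi> s) + of_real (r / 4)) \<le> norm (?F (\<Phi> s)) + norm (complex_of_real (r / 4))"
        by (rule norm_triangle_ineq)
      also have "\<dots> < r" using coord_V(3)[OF s(1)] r by simp
      finally have "s + r / 4 \<in> I" using advance[OF s(1), of "r / 4"] by simp
      then obtain u where "u \<in> V" "u > s + r / 4" using recurrent by blast
      with s(2) cSup_upper[OF _ bdd, of u] show False by linarith
    qed
    have "compactin X (topspace X)" using X by (simp add: compact_space_def)
    then obtain p where p: "p \<in> topspace X" "cluster_point X ?\<gamma> p"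
      using cluster_point_in_compact[of X "topspace X" ?\<gamma>] in_top gt_ex by metis
    have "limitin X ?\<gamma> p at_top"
      by (rule limit_of_finitely_many_cluster_points[OF X Hausdorff _ finite_zeros[OF nz X] zero p])
        (use \<gamma> in \<open>simp_all add: horizontal_curve_def\<close>)
    then have "critical_leaf X A q L"
      unfolding critical_leaf_def zeros_square using L \<gamma> range zero[OF p] by blast
    then show ?thesis ..
  qed
qed

section \<open>The critical graph is compact\<close>

text \<open>The height in a local primitive at \<open>p\<close> is constant along the end of the curve, hence equal to the height of
  \<open>p\<close> by continuity.\<close>

lemma critical_heights_finite_at:
  assumes h: "height_function h" and p: "p \<in> topspace X"
  obtains H where "finite H"
    "\<And>\<gamma> t. horizontal_curve X A q \<gamma> \<Longrightarrow> limitin X \<gamma> p at_top \<Longrightarrow> h (\<gamma> t) \<in> H"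
proof -
  obtain U F K where F: "p \<in> U" "local_primitive X A \<eta> U F" "finite K"
    "\<And>x. x \<in> U \<Longrightarrow> h x - Im (F x) \<in> K"
    by (rule height_jumps_finite[OF h p]) (rule that)
  have U: "openin X U" using local_primitive_openin[OF F(2)] .
  have "h (\<gamma> t) \<in> (\<lambda>k. k + Im (F p)) ` K"
    if \<gamma>: "horizontal_curve X A q \<gamma>" and lim: "limitin X \<gamma> p at_top" for \<gamma> t
  proof -
    have "\<forall>\<^sub>F t in at_top. \<gamma> t \<in> U" using lim U F(1) unfolding limitin_def by blast
    then obtain N where N: "\<And>t. t \<ge> N \<Longrightarrow> \<gamma> t \<in> U" unfolding eventually_at_top_linorder by blast
    have const: "Im (F (\<gamma> t)) = Im (F (\<gamma> N))" if "t \<ge> N" for t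
      by (rule horizontal_curve_height_constant[OF \<gamma> F(2), of "{N..}"]) (use that N in auto)
    have "Im (F (\<gamma> N)) = Im (F p)"
    proof (rule ccontr)
      assume "Im (F (\<gamma> N)) \<noteq> Im (F p)"
      then have e: "\<bar>Im (F (\<gamma> N)) - Im (F p)\<bar> > 0" (is "?e > 0") by simp
      have "openin X {x \<in> U. F x \<in> ball (F p) ?e}"
        by (rule openin_local_primitive_preimage[OF F(2) open_ball])
      moreover have "p \<in> {x \<in> U. F x \<in> ball (F p) ?e}" using F(1) e by simp
      ultimately have "\<forall>\<^sub>F t in at_top. \<gamma> t \<in> {x \<in> U. F x \<in> ball (F p) ?e}"
        using lim unfolding limitin_def by blast
      moreover have "\<forall>\<^sub>F t in at_top. t \<ge> N" by (rule eventually_ge_at_top)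
      ultimately have "\<forall>\<^sub>F t in at_top. F (\<gamma> t) \<in> ball (F p) ?e \<and> t \<ge> N" by eventually_elim simp
      then obtain t where t: "F (\<gamma> t) \<in> ball (F p) ?e" "t \<ge> N"
        using eventually_happens[of _ at_top] by fastforce
      have "\<bar>Im (F (\<gamma> t) - F p)\<bar> \<le> norm (F (\<gamma> t) - F p)" by (rule abs_Im_le_cmod)
      then show False using t const[OF t(2)] by (simp add: dist_norm norm_minus_commute)
    qed
    moreover have "h (\<gamma> N) - Im (F (\<gamma> N)) \<in> K" using F(4) N by simp
    ultimately have "h (\<gamma> N) \<in> (\<lambda>k. k + Im (F p)) ` K" by (force intro: rev_image_eqI)
    then show ?thesis using height_function_constant_on_horizontal_curve[OF h \<gamma>, of t N] by simp
  qed
  then show ?thesis using F(3) by (intro that[of "(\<lambda>k. k + Im (F p)) ` K"]) blast+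
qed

lemma critical_heights_finite:
  assumes h: "height_function h" and X: "compact_space X" and nz: "nonzero_differential A \<eta>"
  obtains H where "finite H" "\<And>L x. critical_leaf X A q L \<Longrightarrow> x \<in> L \<Longrightarrow> h x \<in> H"
proof -
  have "\<exists>H. finite H \<and> (\<forall>\<gamma> t. horizontal_curve X A q \<gamma> \<longrightarrow> limitin X \<gamma> p at_top \<longrightarrow> h (\<gamma> t) \<in> H)"
    if p: "p \<in> zeros A \<eta>" for p
  proof -
    have "p \<in> topspace X" using p zeros_subset by blast
    then show ?thesis by (rule critical_heights_finite_at[OF h]) blast
  qed
  then obtain H where H: "\<And>p. p \<in> zeros A \<eta> \<Longrightarrow> finite (H p)"
    "\<And>p \<gamma> t. p \<in> zeros A \<eta> \<Longrightarrow> horizontal_curve X A q \<gamma> \<Longrightarrow> limitin X \<gamma> p at_top \<Longrightarrow> h (\<gamma> t) \<in> H p"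
    by metis
  show ?thesis
  proof (rule that[of "\<Union>p\<in>zeros A \<eta>. H p"])
    show "finite (\<Union>p\<in>zeros A \<eta>. H p)" using finite_zeros[OF nz X] H(1) by blast
    fix L x assume "critical_leaf X A q L" "x \<in> L"
    then show "h x \<in> (\<Union>p\<in>zeros A \<eta>. H p)"
      unfolding critical_leaf_def zeros_square using H(2) by blast
  qed
qed

text \<open>In a flow box at \<open>x\<close>, remove the finitely many heights of critical leaves other than the height of \<open>x\<close>. A
  point of a critical leaf in the rest lies on the same segment as \<open>x\<close>, and a leaf contains every
  segment that it meets.\<close>

lemma critical_graph_compact:
  assumes h: "height_function h" and X: "compact_space X" and nz: "nonzero_differential A \<eta>"
  shows "compactin X (critical_graph X A q)"
proof (rule closedin_compact_space[OF X])
  let ?C = "critical_graph X A q"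
  obtain H where H: "finite H" "\<And>L x. critical_leaf X A q L \<Longrightarrow> x \<in> L \<Longrightarrow> h x \<in> H"
    by (rule critical_heights_finite[OF h X nz]) (rule that)
  have C_sub: "?C \<subseteq> topspace X"
    using zeros_subset horizontal_curve_in_topspace
    unfolding critical_graph_def critical_leaf_def leaf_def zeros_square by blast
  moreover have "openin X (topspace X - ?C)"
  proof (subst openin_subopen, intro ballI)
    fix x assume x: "x \<in> topspace X - ?C"
    then have x: "x \<in> topspace X" "x \<notin> ?C" and "x \<notin> zeros A \<eta>"
      by (auto simp: critical_graph_def zeros_square)
    obtain U F K where F: "x \<in> U" "local_primitive X A \<eta> U F" "finite K"
      "\<And>y. y \<in> U \<Longrightarrow> h y - Im (F y) \<in> K"
      by (rule height_jumps_finite[OF h x(1)]) (rule that)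
    obtain G r where G: "flow_box (\<lambda>y. F y - F x) G r" "G 0 = x" "G ` ball 0 r \<subseteq> U"
      using flow_box_exists[OF \<open>x \<notin> zeros A \<eta>\<close> F(2,1)] .
    let ?F = "\<lambda>y. F y - F x" and ?B = "G ` ball 0 r"
    let ?E = "(\<lambda>(v, k). v - k - Im (F x)) ` (H \<times> K) - {0}"
    have "finite ?E" using H(1) F(3) by simp
    then have "open (Im -` (- ?E))"
      by (intro open_vimage open_Compl finite_imp_closed continuous_intros)
    then have N: "openin X {y \<in> ?B. ?F y \<in> Im -` (- ?E)}" (is "openin X ?N")
      by (rule openin_local_primitive_preimage[OF flow_box_primitive[OF G(1)]])
    have 0: "0 \<in> ball (0::complex) r" using flow_box_pos[OF G(1)] by simp
    then have "x \<in> ?B" unfolding G(2)[symmetric] by (rule imageI)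
    then have "x \<in> ?N" by simp
    moreover have "?N \<subseteq> topspace X - ?C"
    proof
      fix y assume y: "y \<in> ?N"
      have "y \<notin> ?C"
      proof
        assume "y \<in> ?C"
        moreover have "y \<notin> zeros A \<eta>" using y G(1) by (auto simp: flow_box_def)
        ultimately obtain L where L: "critical_leaf X A q L" "y \<in> L"
          by (auto simp: critical_graph_def zeros_square)
        have "h y \<in> H" "h y - Im (F y) \<in> K" using H(2)[OF L] F(4) G(3) y by auto
        then have "Im (?F y) \<in> (\<lambda>(v, k). v - k - Im (F x)) ` (H \<times> K)"
          by (intro image_eqI[of _ _ "(h y, h y - Im (F y))"]) auto
        with y have "Im (?F y) = 0" by auto
        then have eq: "?F y + of_real (- Re (?F y)) = 0" by (simp add: complex_eq_iff)
        have "leaf X A q L" using L(1) by (simp add: critical_leaf_def)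
        then obtain I \<Phi> where \<Phi>: "maximal_trajectory I \<Phi>" "I \<noteq> {}" "L = \<Phi> ` I"
          by (rule leaf_is_maximal_trajectory)
        then obtain u where u: "u \<in> I" "\<Phi> u = y" using L(2) by blast
        have yB: "G (?F y) = y" "?F y \<in> ball 0 r"
          using flow_box_height_inj[OF G(1), of y] y by auto
        have "u + - Re (?F y) \<in> I \<and> \<Phi> (u + - Re (?F y)) = G (?F y + of_real (- Re (?F y)))"
          by (rule maximal_trajectory_segment[OF \<Phi>(1) G(1) u(1)]) (use u yB eq 0 in auto)
        then have "x \<in> L" unfolding eq G(2) \<Phi>(3) by (metis imageI)
        then have "x \<in> ?C" using L(1) by (auto simp: critical_graph_def)
        with x show False by simp
      qed
      moreover have "y \<in> topspace X" using y openin_subset[OF N] by blast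
      ultimately show "y \<in> topspace X - ?C" by blast
    qed
    ultimately show "\<exists>T. openin X T \<and> x \<in> T \<and> T \<subseteq> topspace X - ?C" using N by blast
  qed
  ultimately show "closedin X ?C" by (simp add: closedin_def)
qed

end

theorem theorem1:
  fixes X :: "'a topology" and A :: "'a chart set" and J :: "'a \<Rightarrow> 'a"
    and \<eta> :: "'a differential" and g :: nat
  assumes "compact_riemann_surface X A"
    and "has_genus X g" and "g \<ge> 1"
    and "anticonformal_involution X A J"
    and "holomorphic_differential 1 A \<eta>"
    and "nonzero_differential A \<eta>"
    and "real_differential A J \<eta>"
    and "\<And>C. odd_cycle X J C \<Longrightarrow>
           (\<And>R. oriented_real_oval X J R \<Longrightarrow>
              has_intersection_number X A C (curve_cycle 1 R) 0) \<Longrightarrow>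
           chain_integral X A \<eta> C = 0"
  shows "jenkins_strebel X A (\<lambda>c z. (\<eta> c z)\<^sup>2)"
proof -
  have X: "riemann_surface X A" "compact_space X"
    using assms(1) by (auto simp: compact_riemann_surface_def)
  interpret real_riemann_surface_form X A \<eta> J
    by unfold_locales (use X assms in auto)
  obtain h where h: "height_function h"
  proof (rule height_function_exists)
    show odd_periods_vanish using assms(8) by (simp add: odd_periods_vanish_def)
  qed
  have "holomorphic_differential 2 A q"
    using assms(5) unfolding holomorphic_differential_def
    by (auto intro!: holomorphic_intros simp: power_mult_distrib)
  moreover have "nonzero_differential A q"
    using assms(6) by (auto simp: nonzero_differential_def)
  moreover have "compactin X (critical_graph X A q)"
    by (rule critical_graph_compact[OF h X(2) assms(6)])
  moreover have "closed_leaf X A q L" if "leaf X A q L" "\<not> L \<subseteq> critical_graph X A q" for L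
    using leaf_closed_or_critical[OF h X(2) assms(6) that(1)] that(2)
    unfolding critical_graph_def by blast
  ultimately show ?thesis unfolding jenkins_strebel_def by blast
qed

end
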